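(* Suppose $\Sigma$ is a convex polyhedral subset of finite type in $\Delta(\mathbb{Q})$ which is contained within a single apartment of $\Delta(\mathbb{Q})$. If $\Sigma$ is not $\Delta(\mathbb{Q})$-completely reducible, then $\Sigma$ has a $G$-centre.
   Context: Setting. $G$ is a semisimple linear algebraic group over an algebraically closed field; subgroups are closed. $Y$ is the set of cocharacters of $G$. For a maximal torus $T$, $Y_T$ and $X_T$ are its cocharacter and character groups (additive), with pairing $\langle\ ,\ \rangle:Y_T\times X_T\to\mathbb{Z}$. $G$ acts on $Y$ by $(g\cdot\lambda)(a)=g\lambda(a)g^{-1}$. For $K=\mathbb{Q}$ or $\mathbb{R}$, $Y_T(K)=Y_T\otimes_{\mathbb{Z}}K$ and $X_T(K)=X_T\otimes_{\mathbb{Z}}K$; pairings and the action extend. For $\lambda\in Y_T(\mathbb{R})$, $P_\lambda$ is the parabolic subgroup generated by $T$ and the root groups $U_\alpha$ ($\alpha$ a root of $G$ with respect to $T$) with $\langle\lambda,\alpha\rangle\ge 0$; its Levi subgroup $L_\lambda$ is generated by $T$ and the $U_\alpha$ with $\langle\lambda,\alpha\rangle=0$; $R_u$ denotes unipotent radical. $Y(K)$ is the quotient of the disjoint union of the $Y_T(K)$ over all maximal tori $T$ obtained by identifying $\nu\in Y_T(K)$ with $x\cdot\nu\in Y_{xTx^{-1}}(K)$ for $x\in L_\nu$; each $Y_T(K)$ is regarded as a subset of $Y(K)$, $G$ acts on $Y(K)$, and $Y\subset Y(\mathbb{Q})\subset Y(\mathbb{R})$. A norm $\|\ \|$ on $Y$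 is fixed: a $G$-invariant non-negative function such that on each $Y_T$ one has $\|\lambda\|^2=(\lambda,\lambda)$ for some positive definite integer-valued bilinear form; it extends to a $G$-invariant norm on $Y(K)$. Building. $V(K)$ is the set of classes of $Y(K)$ under $\lambda\equiv u\cdot\lambda$ ($u\in R_u(P_\lambda)$), $\varphi:Y(K)\to V(K)$ the projection; the norm descends to $V(K)$. $\Delta(\mathbb{R})$ is the unit sphere of $V(\mathbb{R})$, $\zeta:Y(\mathbb{R})\setminus\{0\}\to\Delta(\mathbb{R})$ is $\zeta(\lambda)=\varphi(\lambda/\|\lambda\|)$, and $\Delta(\mathbb{Q})=\zeta(Y(\mathbb{Q})\setminus\{0\})$ is the rational spherical building of $G$ (here $\zeta^{-1}(\Sigma)$ means preimage in $Y(\mathbb{Q})\setminus\{0\}$). $G$ acts on $\Delta(\mathbb{Q})$ and $\zeta$ is $G$-equivariant. The apartments of $\Delta(\mathbb{Q})$ are the sets $\Delta_T(\mathbb{Q})=\zeta(Y_T(\mathbb{Q})\setminus\{0\})$, $T$ a maximal torus. Any two points of $\Delta(\mathbb{Q})$ have the form $\zeta(\lambda),\zeta(\mu)$ with $\lambda,\mu$ in a common $Y_T(\mathbb{Q})$; they are opposite if $\mu$ can be taken to be a negative multiple of $\lambda$ in such a $Y_T(\mathbb{Q})$; otherwise the geodesic between them is $\{\zeta(a\lambda+b\mu)\mid a,b\in \mathbb{Q}_{\ge0}\text{ not both }0\}$. $\Sigma\subseteq\Delta(\mathbb{Q})$ is convex if it contains the geodesic between any two of its non-opposite points. With $C=\zeta^{-1}(\Sigma)\cup\{0\}$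 and $C_T=C\cap Y_T(\mathbb{Q})$, a convex $\Sigma$ is polyhedral if each $C_T$ is a polyhedral cone (of the form $\{\lambda\in Y_T(\mathbb{Q})\mid\langle\lambda,\beta\rangle\ge0\ \forall\beta\in D\}$ with $D\subset X_T(\mathbb{Q})$ finite), and then of finite type if for every $T$ the set $\{g\cdot(C_{g^{-1}Tg})\mid g\in G\}$ is finite. A convex $\Sigma$ is $\Delta(\mathbb{Q})$-completely reducible if every point of $\Sigma$ has an opposite in $\Sigma$. A $G$-centre of $\Sigma$ is a point $c\in\Sigma$ fixed by the setwise stabilizer $N_G(\Sigma)$ of $\Sigma$ in $G$. *)

theory Defs
  imports
    "HOL-Analysis.Analysis"
    "HOL-Algebra.Solvable_Groups"
    "HOL-Computational_Algebra.Polynomial"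
    "HOL-Library.Poly_Mapping"
begin

section \<open>Linear algebraic groups\<close>

text \<open>
  A linear algebraic group is a Zariski-closed subgroup of \<open>GL\<^sub>n(k)\<close>, where \<open>k\<close> is the
  (algebraically closed) entry type and \<open>n\<close> is the cardinality of the index type.
\<close>

definition GL :: "('k::field^'n^'n) monoid" where
  "GL = \<lparr>carrier = {A. invertible A}, monoid.mult = (**), one = mat 1\<rparr>"

text \<open>Polynomial functions in the matrix entries. The field will be infinite, so these are
  the same thing as polynomials.\<close>

inductive_set poly_funs :: "('k::field^'n^'n \<Rightarrow> 'k) set" where
  const: "(\<lambda>A. c) \<in> poly_funs"
| entry: "(\<lambda>A. A $ i $ j) \<in> poly_funs"
| add: "f \<in> poly_funs \<Longrightarrow> h \<in> poly_funs \<Longrightarrow> (\<lambda>A. f A + h A) \<in> poly_funs"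
| mult: "f \<in> poly_funs \<Longrightarrow> h \<in> poly_funs \<Longrightarrow> (\<lambda>A. f A * h A) \<in> poly_funs"

text \<open>The coordinate ring \<open>k[x\<^sub>i\<^sub>j, 1/det]\<close> of \<open>GL\<^sub>n\<close>; its elements are only meaningful
  on invertible matrices. Regular functions on a closed subgroup are restrictions of these.\<close>

definition regular_funs :: "('k::field^'n^'n \<Rightarrow> 'k) set" where
  "regular_funs = {\<lambda>A. f A / det A ^ m | f m. f \<in> poly_funs}"

definition regular_map :: "('k::field^'n^'n \<Rightarrow> 'k^'n^'n) \<Rightarrow> bool" where
  "regular_map \<phi> \<longleftrightarrow> (\<forall>i j. (\<lambda>A. \<phi> A $ i $ j) \<in> regular_funs)"

text \<open>The Zariski topology of \<open>GL\<^sub>n\<close>, with the principal open sets as basis.\<close>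

definition zariski :: "('k::field^'n^'n) topology" where
  "zariski = topology_generated_by {{A \<in> carrier GL. f A \<noteq> 0} | f. f \<in> poly_funs}"

definition closed_subgroup :: "('k::field^'n^'n) set \<Rightarrow> bool" where
  "closed_subgroup H \<longleftrightarrow> subgroup H GL \<and> closedin zariski H"

definition alg_iso :: "('k::field^'n^'n) set \<Rightarrow> ('k^'n^'n) set \<Rightarrow> bool" where
  "alg_iso H H' \<longleftrightarrow> (\<exists>\<phi> \<psi>. regular_map \<phi> \<and> regular_map \<psi>
      \<and> \<phi> \<in> iso (GL\<lparr>carrier := H\<rparr>) (GL\<lparr>carrier := H'\<rparr>) \<and> (\<forall>h\<in>H. \<psi> (\<phi> h) = h))"

definition mconj :: "'k::field^'n^'n \<Rightarrow> 'k^'n^'n \<Rightarrow> 'k^'n^'n" where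
  "mconj g A = g ** A ** matrix_inv g"

text \<open>The power \<open>^\<close> on the type of matrices is entrywise, hence the iterated product.\<close>

definition unipotent :: "'k::field^'n^'n \<Rightarrow> bool" where
  "unipotent u \<longleftrightarrow> (\<exists>m. (((**) (u - mat 1)) ^^ m) (mat 1) = 0)"

text \<open>The union below has a largest member, the radical in the usual sense; likewise for the
  unipotent radical.\<close>

definition radical :: "('k::field^'n^'n) set \<Rightarrow> ('k^'n^'n) set" where
  "radical H = \<Union>{R. R \<lhd> GL\<lparr>carrier := H\<rparr> \<and> closedin zariski R \<and> connectedin zariski R
                     \<and> solvable (GL\<lparr>carrier := R\<rparr>)}"

definition unipotent_radical :: "('k::field^'n^'n) set \<Rightarrow> ('k^'n^'n) set" where
  "unipotent_radical H = \<Union>{R. R \<lhd> GL\<lparr>carrier := H\<rparr> \<and> closedin zariski R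
                     \<and> connectedin zariski R \<and> (\<forall>u\<in>R. unipotent u)}"

text \<open>A linear algebraic group with trivial radical; as in Borel's convention, connectedness is not
  required.\<close>

definition semisimple :: "('k::field^'n^'n) set \<Rightarrow> bool" where
  "semisimple G \<longleftrightarrow> closed_subgroup G \<and> radical G = {mat 1}"


section \<open>Tori, characters and cocharacters\<close>

text \<open>The standard torus of rank \<open>card J\<close>. Since a torus in \<open>GL\<^sub>n\<close> has rank at most \<open>n\<close>, every
  torus in \<open>GL\<^sub>n\<close> is isomorphic to one of these.\<close>

definition diag_torus :: "'n set \<Rightarrow> ('k::field^'n^'n) set" where
  "diag_torus J = {A. (\<forall>i j. i \<noteq> j \<longrightarrow> A $ i $ j = 0) \<and> (\<forall>i. A $ i $ i \<noteq> 0)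
                      \<and> (\<forall>i. i \<notin> J \<longrightarrow> A $ i $ i = 1)}"

definition torus :: "('k::field^'n^'n) set \<Rightarrow> bool" where
  "torus T \<longleftrightarrow> closed_subgroup T \<and> (\<exists>J. alg_iso (diag_torus J) T)"

definition max_torus :: "('k::field^'n^'n) set \<Rightarrow> ('k^'n^'n) set \<Rightarrow> bool" where
  "max_torus G T \<longleftrightarrow> torus T \<and> T \<subseteq> G \<and> (\<forall>T'. torus T' \<and> T \<subseteq> T' \<and> T' \<subseteq> G \<longrightarrow> T' = T)"

type_synonym ('k, 'n) cochar = "'k \<Rightarrow> 'k^'n^'n"
type_synonym ('k, 'n) char = "'k^'n^'n \<Rightarrow> 'k"

text \<open>Morphisms \<open>k\<^sup>* \<rightarrow> H\<close>, totalised by the value \<open>0\<close> at \<open>0\<close>, so that equality of cocharacters is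
  equality of functions. Their entries are Laurent polynomials.\<close>

definition cochars :: "('k::field^'n^'n) set \<Rightarrow> ('k, 'n) cochar set" where
  "cochars H = {l. l 0 = 0 \<and> (\<forall>a. a \<noteq> 0 \<longrightarrow> l a \<in> H)
      \<and> (\<forall>a b. a \<noteq> 0 \<longrightarrow> b \<noteq> 0 \<longrightarrow> l (a * b) = l a ** l b)
      \<and> (\<forall>i j. \<exists>p m. \<forall>a. a \<noteq> 0 \<longrightarrow> l a $ i $ j = poly p a / a ^ m)}"

text \<open>Morphisms \<open>H \<rightarrow> k\<^sup>*\<close>, totalised by \<open>0\<close> outside \<open>H\<close>.\<close>

definition chars :: "('k::field^'n^'n) set \<Rightarrow> ('k, 'n) char set" where
  "chars H = {\<theta>. (\<forall>h. h \<notin> H \<longrightarrow> \<theta> h = 0) \<and> (\<forall>h\<in>H. \<theta> h \<noteq> 0)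
      \<and> (\<forall>h\<in>H. \<forall>h'\<in>H. \<theta> (h ** h') = \<theta> h * \<theta> h')
      \<and> (\<exists>f\<in>regular_funs. \<forall>h\<in>H. \<theta> h = f h)}"

definition cochar_mult :: "('k::field, 'n::finite) cochar \<Rightarrow> ('k, 'n) cochar \<Rightarrow> ('k, 'n) cochar" where
  "cochar_mult l m = (\<lambda>a. l a ** m a)"

text \<open>The abelian groups \<open>Y\<^sub>T\<close> and \<open>X\<^sub>T\<close>, written multiplicatively as functions.\<close>

definition Y_grp :: "('k::field^'n^'n) set \<Rightarrow> ('k, 'n) cochar monoid" where
  "Y_grp T = \<lparr>carrier = cochars T, monoid.mult = cochar_mult,
              one = (\<lambda>a. if a = 0 then 0 else mat 1)\<rparr>"

definition X_grp :: "('k::field^'n^'n) set \<Rightarrow> ('k, 'n) char monoid" where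
  "X_grp T = \<lparr>carrier = chars T, monoid.mult = (\<lambda>\<theta> \<psi> h. \<theta> h * \<psi> h),
              one = (\<lambda>h. if h \<in> T then 1 else 0)\<rparr>"

definition pairing :: "('k::field, 'n::finite) cochar \<Rightarrow> ('k, 'n) char \<Rightarrow> int" where
  "pairing l \<theta> = (THE m. \<forall>a. a \<noteq> 0 \<longrightarrow> \<theta> (l a) = a powi m)"

definition cochar_conj :: "'k::field^'n^'n \<Rightarrow> ('k, 'n) cochar \<Rightarrow> ('k, 'n) cochar" where
  "cochar_conj g l = (\<lambda>a. mconj g (l a))"


section \<open>Roots and root groups\<close>

text \<open>Tangent space at the identity: matrices \<open>X\<close> such that the differential at \<open>1\<close>, in direction
  \<open>X\<close>, of every polynomial vanishing on \<open>G\<close> is zero. This differential is the linear coefficient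
  of the one-variable polynomial \<open>t \<mapsto> f (1 + t X)\<close>.\<close>

definition lie_algebra :: "('k::field^'n^'n) set \<Rightarrow> ('k^'n^'n) set" where
  "lie_algebra G = {X. \<forall>f\<in>poly_funs. (\<forall>g\<in>G. f g = 0) \<longrightarrow>
      (\<exists>p. (\<forall>t. f (mat 1 + (\<chi> i j. t * X $ i $ j)) = poly p t) \<and> coeff p 1 = 0)}"

definition roots :: "('k::field^'n^'n) set \<Rightarrow> ('k^'n^'n) set \<Rightarrow> ('k, 'n) char set" where
  "roots G T = {\<alpha> \<in> chars T. \<alpha> \<noteq> one (X_grp T) \<and>
      (\<exists>X\<in>lie_algebra G. X \<noteq> 0 \<and> (\<forall>t\<in>T. mconj t X = (\<chi> i j. \<alpha> t * X $ i $ j)))}"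

text \<open>\<open>U\<close> is the image of an isomorphism \<open>u\<close> from the additive group onto a closed subgroup of \<open>G\<close>
  with \<open>t u(x) t\<inverse> = u(\<alpha>(t) x)\<close>. For a root \<open>\<alpha>\<close> of a group with trivial radical there is exactly
  one such \<open>U\<close>.\<close>

definition root_group ::
  "('k::field^'n^'n) set \<Rightarrow> ('k^'n^'n) set \<Rightarrow> ('k, 'n) char \<Rightarrow> ('k^'n^'n) set \<Rightarrow> bool" where
  "root_group G T \<alpha> U \<longleftrightarrow> closed_subgroup U \<and> U \<subseteq> G \<and>
     (\<exists>u. (\<forall>i j. \<exists>p. \<forall>x. u x $ i $ j = poly p x) \<and> (\<forall>x y. u (x + y) = u x ** u y)
        \<and> range u = U \<and> (\<exists>f\<in>regular_funs. \<forall>x. f (u x) = x)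
        \<and> (\<forall>t\<in>T. \<forall>x. mconj t (u x) = u (\<alpha> t * x)))"


section \<open>Extension of scalars\<close>

text \<open>For an abelian group \<open>A\<close> (written as a multiplicative monoid record), \<open>A \<otimes> \<real>\<close> is the real vector
  space on the set \<open>A\<close> modulo the subspace spanned by all \<open>[x y] - [x] - [y]\<close>. Its elements are
  represented as cosets. \<open>A \<otimes> \<rat>\<close> is regarded as the subset of cosets of rational combinations.\<close>

definition rscale :: "real \<Rightarrow> ('a \<Rightarrow>\<^sub>0 real) \<Rightarrow> ('a \<Rightarrow>\<^sub>0 real)" where
  "rscale r p = Poly_Mapping.map ((*) r) p"

definition tensor_rel :: "'a monoid \<Rightarrow> (('a \<Rightarrow>\<^sub>0 real) \<times> ('a \<Rightarrow>\<^sub>0 real)) set" where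
  "tensor_rel A = {(p, q). Poly_Mapping.keys p \<subseteq> carrier A \<and> Poly_Mapping.keys q \<subseteq> carrier A
      \<and> p - q \<in> module.span rscale
          {Poly_Mapping.single (x \<otimes>\<^bsub>A\<^esub> y) 1 - Poly_Mapping.single x 1 - Poly_Mapping.single y 1
            | x y. x \<in> carrier A \<and> y \<in> carrier A}}"

definition tensor_R :: "'a monoid \<Rightarrow> ('a \<Rightarrow>\<^sub>0 real) set set" where
  "tensor_R A = {p. Poly_Mapping.keys p \<subseteq> carrier A} // tensor_rel A"

definition tensor_Q :: "'a monoid \<Rightarrow> ('a \<Rightarrow>\<^sub>0 real) set set" where
  "tensor_Q A = {c \<in> tensor_R A. \<exists>p\<in>c. \<forall>x. Poly_Mapping.lookup p x \<in> \<rat>}"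

definition tensor_of :: "'a monoid \<Rightarrow> 'a \<Rightarrow> ('a \<Rightarrow>\<^sub>0 real) set" where
  "tensor_of A x = tensor_rel A `` {Poly_Mapping.single x 1}"

definition tensor_zero :: "'a monoid \<Rightarrow> ('a \<Rightarrow>\<^sub>0 real) set" where
  "tensor_zero A = tensor_rel A `` {0}"

definition tensor_add ::
  "'a monoid \<Rightarrow> ('a \<Rightarrow>\<^sub>0 real) set \<Rightarrow> ('a \<Rightarrow>\<^sub>0 real) set \<Rightarrow> ('a \<Rightarrow>\<^sub>0 real) set" where
  "tensor_add A c d = (\<Union>p\<in>c. \<Union>q\<in>d. tensor_rel A `` {p + q})"

definition tensor_scale ::
  "'a monoid \<Rightarrow> real \<Rightarrow> ('a \<Rightarrow>\<^sub>0 real) set \<Rightarrow> ('a \<Rightarrow>\<^sub>0 real) set" where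
  "tensor_scale A r c = (\<Union>p\<in>c. tensor_rel A `` {rscale r p})"

type_synonym ('k, 'n) rcochar = "(('k, 'n) cochar \<Rightarrow>\<^sub>0 real) set"
type_synonym ('k, 'n) rchar = "(('k, 'n) char \<Rightarrow>\<^sub>0 real) set"

text \<open>Here and below, \<open>the_elem\<close> extracts the common value of a function which is constant on a class.\<close>

definition pairing_R :: "('k::field, 'n::finite) rcochar \<Rightarrow> ('k, 'n) rchar \<Rightarrow> real" where
  "pairing_R \<nu> \<beta> = the_elem ((\<lambda>(p, q). \<Sum>l\<in>Poly_Mapping.keys p. \<Sum>\<theta>\<in>Poly_Mapping.keys q.
      Poly_Mapping.lookup p l * Poly_Mapping.lookup q \<theta> * of_int (pairing l \<theta>)) ` (\<nu> \<times> \<beta>))"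

text \<open>The map \<open>Y\<^sub>T(\<real>) \<rightarrow> Y\<^bsub>gTg\<inverse>\<^esub>(\<real>)\<close> induced by conjugation.\<close>

definition rcochar_conj :: "'k::field^'n^'n \<Rightarrow> ('k, 'n) rcochar \<Rightarrow> ('k, 'n) rcochar" where
  "rcochar_conj g \<nu> = (\<lambda>p. \<Sum>l\<in>Poly_Mapping.keys p.
      Poly_Mapping.single (cochar_conj g l) (Poly_Mapping.lookup p l)) ` \<nu>"


section \<open>Parabolic and Levi subgroups\<close>

definition parabolic ::
  "('k::field^'n^'n) set \<Rightarrow> ('k^'n^'n) set \<Rightarrow> ('k, 'n) rcochar \<Rightarrow> ('k^'n^'n) set" where
  "parabolic G T \<nu> = generate GL (T \<union> \<Union>{U. \<exists>\<alpha>\<in>roots G T.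
      root_group G T \<alpha> U \<and> pairing_R \<nu> (tensor_of (X_grp T) \<alpha>) \<ge> 0})"

definition levi ::
  "('k::field^'n^'n) set \<Rightarrow> ('k^'n^'n) set \<Rightarrow> ('k, 'n) rcochar \<Rightarrow> ('k^'n^'n) set" where
  "levi G T \<nu> = generate GL (T \<union> \<Union>{U. \<exists>\<alpha>\<in>roots G T.
      root_group G T \<alpha> U \<and> pairing_R \<nu> (tensor_of (X_grp T) \<alpha>) = 0})"


section \<open>The set \<open>Y(\<real>)\<close>\<close>

text \<open>A point of \<open>Y(\<real>)\<close> is a class of pairs \<open>(T, \<nu>)\<close> with \<open>\<nu> \<in> Y\<^sub>T(\<real>)\<close>.\<close>

type_synonym ('k, 'n) ypoint = "(('k^'n^'n) set \<times> ('k, 'n) rcochar) set"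

definition Y_rel :: "('k::field^'n^'n) set \<Rightarrow>
    ((('k^'n^'n) set \<times> ('k, 'n) rcochar) \<times> (('k^'n^'n) set \<times> ('k, 'n) rcochar)) set" where
  "Y_rel G = {((T, \<nu>), (mconj x ` T, rcochar_conj x \<nu>)) | T \<nu> x.
      max_torus G T \<and> \<nu> \<in> tensor_R (Y_grp T) \<and> x \<in> levi G T \<nu>}"

definition Y_R :: "('k::field^'n^'n) set \<Rightarrow> ('k, 'n) ypoint set" where
  "Y_R G = {(T, \<nu>). max_torus G T \<and> \<nu> \<in> tensor_R (Y_grp T)} // Y_rel G"

text \<open>The embedding of \<open>Y\<^sub>T(\<real>)\<close> into \<open>Y(\<real>)\<close>.\<close>

definition Y_point ::
  "('k::field^'n^'n) set \<Rightarrow> ('k^'n^'n) set \<Rightarrow> ('k, 'n) rcochar \<Rightarrow> ('k, 'n) ypoint" where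
  "Y_point G T \<nu> = Y_rel G `` {(T, \<nu>)}"

definition Y_Q :: "('k::field^'n^'n) set \<Rightarrow> ('k, 'n) ypoint set" where
  "Y_Q G = {Y_point G T \<nu> | T \<nu>. max_torus G T \<and> \<nu> \<in> tensor_Q (Y_grp T)}"

text \<open>The zeros of all \<open>Y\<^sub>T(\<real>)\<close> are identified in \<open>Y(\<real>)\<close>, so this set is \<open>{0}\<close>.\<close>

definition Y_zero :: "('k::field^'n^'n) set \<Rightarrow> ('k, 'n) ypoint set" where
  "Y_zero G = {Y_point G T (tensor_zero (Y_grp T)) | T. max_torus G T}"

definition Y_act :: "'k::field^'n^'n \<Rightarrow> ('k, 'n) ypoint \<Rightarrow> ('k, 'n) ypoint" where
  "Y_act g y = (\<lambda>(T, \<nu>). (mconj g ` T, rcochar_conj g \<nu>)) ` y"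

text \<open>Only used for positive scalars, which do not change the group \<open>L\<^sub>\<nu>\<close>.\<close>

definition Y_scale :: "real \<Rightarrow> ('k::field, 'n::finite) ypoint \<Rightarrow> ('k, 'n) ypoint" where
  "Y_scale r y = (\<lambda>(T, \<nu>). (T, tensor_scale (Y_grp T) r \<nu>)) ` y"


section \<open>Norms\<close>

definition cochar_norm :: "('k::field^'n^'n) set \<Rightarrow> (('k, 'n) cochar \<Rightarrow> real) \<Rightarrow> bool" where
  "cochar_norm G N \<longleftrightarrow>
     (\<forall>l\<in>cochars G. N l \<ge> 0) \<and> (\<forall>g\<in>G. \<forall>l\<in>cochars G. N (cochar_conj g l) = N l) \<and>
     (\<forall>T. max_torus G T \<longrightarrow> (\<exists>B :: ('k, 'n) cochar \<Rightarrow> ('k, 'n) cochar \<Rightarrow> int.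
        (\<forall>l\<in>cochars T. \<forall>l'\<in>cochars T. \<forall>m\<in>cochars T.
            B (cochar_mult l l') m = B l m + B l' m \<and> B m (cochar_mult l l') = B m l + B m l') \<and>
        (\<forall>l\<in>cochars T. l \<noteq> one (Y_grp T) \<longrightarrow> B l l > 0) \<and>
        (\<forall>l\<in>cochars T. (N l)\<^sup>2 = of_int (B l l))))"

text \<open>The extension of the norm to \<open>Y\<^sub>T(\<real>)\<close>, through the symmetric bilinear form obtained from
  \<open>N\<^sup>2\<close> by polarisation.\<close>

definition norm_form ::
  "(('k::field, 'n::finite) cochar \<Rightarrow> real) \<Rightarrow> ('k, 'n) cochar \<Rightarrow> ('k, 'n) cochar \<Rightarrow> real" where
  "norm_form N l m = ((N (cochar_mult l m))\<^sup>2 - (N l)\<^sup>2 - (N m)\<^sup>2) / 2"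

definition rcochar_norm :: "(('k::field, 'n::finite) cochar \<Rightarrow> real) \<Rightarrow> ('k, 'n) rcochar \<Rightarrow> real" where
  "rcochar_norm N \<nu> = the_elem ((\<lambda>p. sqrt (\<Sum>l\<in>Poly_Mapping.keys p. \<Sum>m\<in>Poly_Mapping.keys p.
      Poly_Mapping.lookup p l * Poly_Mapping.lookup p m * norm_form N l m)) ` \<nu>)"

definition Y_norm :: "(('k::field, 'n::finite) cochar \<Rightarrow> real) \<Rightarrow> ('k, 'n) ypoint \<Rightarrow> real" where
  "Y_norm N y = the_elem ((\<lambda>(T, \<nu>). rcochar_norm N \<nu>) ` y)"


section \<open>The rational spherical building\<close>

type_synonym ('k, 'n) vpoint = "('k, 'n) ypoint set"

definition V_rel :: "('k::field^'n^'n) set \<Rightarrow> (('k, 'n) ypoint \<times> ('k, 'n) ypoint) set" where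
  "V_rel G = {(y, Y_act u y) | y u.
      y \<in> Y_R G \<and> (\<exists>(T, \<nu>)\<in>y. u \<in> unipotent_radical (parabolic G T \<nu>))}"

definition V_proj :: "('k::field^'n^'n) set \<Rightarrow> ('k, 'n) ypoint \<Rightarrow> ('k, 'n) vpoint" where
  "V_proj G y = V_rel G `` {y}"

definition V_act :: "'k::field^'n^'n \<Rightarrow> ('k, 'n) vpoint \<Rightarrow> ('k, 'n) vpoint" where
  "V_act g v = Y_act g ` v"

definition zeta :: "('k::field^'n^'n) set \<Rightarrow> (('k, 'n) cochar \<Rightarrow> real) \<Rightarrow>
    ('k, 'n) ypoint \<Rightarrow> ('k, 'n) vpoint" where
  "zeta G N y = V_proj G (Y_scale (1 / Y_norm N y) y)"

text \<open>The restriction of \<open>\<zeta>\<close> to \<open>Y\<^sub>T(\<real>)\<close>.\<close>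

definition zeta_T :: "('k::field^'n^'n) set \<Rightarrow> (('k, 'n) cochar \<Rightarrow> real) \<Rightarrow>
    ('k^'n^'n) set \<Rightarrow> ('k, 'n) rcochar \<Rightarrow> ('k, 'n) vpoint" where
  "zeta_T G N T \<nu> = zeta G N (Y_point G T \<nu>)"

definition rational_building :: "('k::field^'n^'n) set \<Rightarrow> (('k, 'n) cochar \<Rightarrow> real) \<Rightarrow>
    ('k, 'n) vpoint set" where
  "rational_building G N = zeta G N ` (Y_Q G - Y_zero G)"

definition nonzero_Q :: "('k::field^'n^'n) set \<Rightarrow> ('k, 'n) rcochar set" where
  "nonzero_Q T = tensor_Q (Y_grp T) - {tensor_zero (Y_grp T)}"

definition apartment :: "('k::field^'n^'n) set \<Rightarrow> (('k, 'n) cochar \<Rightarrow> real) \<Rightarrow>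
    ('k^'n^'n) set \<Rightarrow> ('k, 'n) vpoint set" where
  "apartment G N T = zeta_T G N T ` nonzero_Q T"

definition opposite :: "('k::field^'n^'n) set \<Rightarrow> (('k, 'n) cochar \<Rightarrow> real) \<Rightarrow>
    ('k, 'n) vpoint \<Rightarrow> ('k, 'n) vpoint \<Rightarrow> bool" where
  "opposite G N x y \<longleftrightarrow> (\<exists>T \<nu> \<mu> r. max_torus G T \<and> \<nu> \<in> nonzero_Q T \<and> \<mu> \<in> nonzero_Q T \<and>
      x = zeta_T G N T \<nu> \<and> y = zeta_T G N T \<mu> \<and> r < 0 \<and> \<mu> = tensor_scale (Y_grp T) r \<nu>)"

text \<open>Used only for non-opposite points. The geodesic is independent of the choice of \<open>T\<close>, \<open>\<nu>\<close> and
  \<open>\<mu>\<close>, so taking the union over all choices is harmless.\<close>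

definition geodesic :: "('k::field^'n^'n) set \<Rightarrow> (('k, 'n) cochar \<Rightarrow> real) \<Rightarrow>
    ('k, 'n) vpoint \<Rightarrow> ('k, 'n) vpoint \<Rightarrow> ('k, 'n) vpoint set" where
  "geodesic G N x y =
     {zeta_T G N T (tensor_add (Y_grp T) (tensor_scale (Y_grp T) a \<nu>) (tensor_scale (Y_grp T) b \<mu>))
       | T \<nu> \<mu> a b. max_torus G T \<and> \<nu> \<in> nonzero_Q T \<and> \<mu> \<in> nonzero_Q T \<and>
           x = zeta_T G N T \<nu> \<and> y = zeta_T G N T \<mu> \<and>
           a \<in> \<rat> \<and> b \<in> \<rat> \<and> a \<ge> 0 \<and> b \<ge> 0 \<and> (a, b) \<noteq> (0, 0)}"

definition convex_subset :: "('k::field^'n^'n) set \<Rightarrow> (('k, 'n) cochar \<Rightarrow> real) \<Rightarrow>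
    ('k, 'n) vpoint set \<Rightarrow> bool" where
  "convex_subset G N \<Sigma> \<longleftrightarrow> \<Sigma> \<subseteq> rational_building G N \<and>
     (\<forall>x\<in>\<Sigma>. \<forall>y\<in>\<Sigma>. \<not> opposite G N x y \<longrightarrow> geodesic G N x y \<subseteq> \<Sigma>)"

definition zeta_cone :: "('k::field^'n^'n) set \<Rightarrow> (('k, 'n) cochar \<Rightarrow> real) \<Rightarrow>
    ('k, 'n) vpoint set \<Rightarrow> ('k, 'n) ypoint set" where
  "zeta_cone G N \<Sigma> = {y \<in> Y_Q G - Y_zero G. zeta G N y \<in> \<Sigma>} \<union> Y_zero G"

definition cone_T :: "('k::field^'n^'n) set \<Rightarrow> (('k, 'n) cochar \<Rightarrow> real) \<Rightarrow>
    ('k, 'n) vpoint set \<Rightarrow> ('k^'n^'n) set \<Rightarrow> ('k, 'n) rcochar set" where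
  "cone_T G N \<Sigma> T = {\<nu> \<in> tensor_Q (Y_grp T). Y_point G T \<nu> \<in> zeta_cone G N \<Sigma>}"

definition polyhedral_cone :: "('k::field^'n^'n) set \<Rightarrow> ('k, 'n) rcochar set \<Rightarrow> bool" where
  "polyhedral_cone T K \<longleftrightarrow> (\<exists>D. finite D \<and> D \<subseteq> tensor_Q (X_grp T) \<and>
      K = {\<nu> \<in> tensor_Q (Y_grp T). \<forall>\<beta>\<in>D. pairing_R \<nu> \<beta> \<ge> 0})"

definition polyhedral :: "('k::field^'n^'n) set \<Rightarrow> (('k, 'n) cochar \<Rightarrow> real) \<Rightarrow>
    ('k, 'n) vpoint set \<Rightarrow> bool" where
  "polyhedral G N \<Sigma> \<longleftrightarrow> (\<forall>T. max_torus G T \<longrightarrow> polyhedral_cone T (cone_T G N \<Sigma> T))"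

definition finite_type :: "('k::field^'n^'n) set \<Rightarrow> (('k, 'n) cochar \<Rightarrow> real) \<Rightarrow>
    ('k, 'n) vpoint set \<Rightarrow> bool" where
  "finite_type G N \<Sigma> \<longleftrightarrow> (\<forall>T. max_torus G T \<longrightarrow>
      finite {rcochar_conj g ` cone_T G N \<Sigma> (mconj (matrix_inv g) ` T) | g. g \<in> G})"

definition completely_reducible :: "('k::field^'n^'n) set \<Rightarrow> (('k, 'n) cochar \<Rightarrow> real) \<Rightarrow>
    ('k, 'n) vpoint set \<Rightarrow> bool" where
  "completely_reducible G N \<Sigma> \<longleftrightarrow> (\<forall>x\<in>\<Sigma>. \<exists>y\<in>\<Sigma>. opposite G N x y)"

definition setwise_stabilizer :: "('k::field^'n^'n) set \<Rightarrow> ('k, 'n) vpoint set \<Rightarrow> ('k^'n^'n) set" where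
  "setwise_stabilizer G \<Sigma> = {g \<in> G. V_act g ` \<Sigma> = \<Sigma>}"

definition G_centre :: "('k::field^'n^'n) set \<Rightarrow> ('k, 'n) vpoint set \<Rightarrow> ('k, 'n) vpoint \<Rightarrow> bool" where
  "G_centre G \<Sigma> c \<longleftrightarrow> c \<in> \<Sigma> \<and> (\<forall>g\<in>setwise_stabilizer G \<Sigma>. V_act g c = c)"

end

theory Submission imports Defs
begin

text \<open>
  A cocharacter \<open>l\<close> of \<open>G \<subseteq> GL\<^sub>n(k)\<close> filters \<open>k\<^sup>n\<close> by its weights, and the parabolic subgroup
  \<open>P\<^sub>l\<close> preserves this filtration. Hence the filtration depends only on the point of the building
  defined by \<open>l\<close> (and on the length of \<open>l\<close>). Diagonalising a maximal torus \<open>T\<close> embeds \<open>Y\<^sub>T\<close> into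
  \<open>\<int>\<^sup>n\<close>, and the standard scalar product of two weight vectors can be read off from the dimensions of
  the intersections of the two filtrations. So an element of the stabilizer of \<open>\<Sigma>\<close> acts on the monoid
  \<open>M\<close> of cocharacters in the cone of \<open>\<Sigma>\<close> by a map that preserves scalar products.
  Since \<open>\<Sigma>\<close> is not completely reducible, there is \<open>v \<in> M\<close> with \<open>-v \<notin> M\<close>. The elements of \<open>M\<close> of
  the same length as \<open>v\<close> form a finite set that is permuted by the stabilizer; their sum is fixed,
  and it is nonzero because otherwise \<open>-v\<close> would be the sum of the other elements.
\<close>

section \<open>Laurent polynomials\<close>

text \<open>An element \<open>g\<close> of the stabilizer need not normalise the torus
  \<open>T\<close> of the apartment. For each cocharacter \<open>l\<close> of the cone some
  \<open>k\<close> in \<open>G\<close> normalises \<open>T\<close> and has the same effect on the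
  point of \<open>l\<close> as \<open>g\<close>, but \<open>k\<close> depends on \<open>l\<close>,
  so no linear map of the lattice is at hand. Two cocharacters can be compared only through what the
  one \<open>g\<close> does to both of their filtrations; dimensions of intersections are invariants
  of such a pair. The outcome is a self-map of the lattice points of which only the preservation of
  scalar products is known, and the fixed vector has to be found from that alone.

  The scalar product is the standard one on weight vectors and not the one behind \<open>N\<close>:
  dimensions see weights, whereas \<open>N\<close> may come from any invariant form.
  \<open>N\<close> enters through the unit sphere; by its invariance the conjugate of
  \<open>l\<close> by \<open>k\<close> is as long as \<open>l\<close>, so both are normalised by the
  same factor. Integrality makes spheres finite, so that a finite sum can serve as the
  centre.\<close>

lemma infinite_alg_closed_field: "infinite (UNIV :: 'k::alg_closed_field set)"
proof
  assume fin: "finite (UNIV :: 'k set)"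
  \<comment> \<open>This polynomial vanishes at every element of the field, so \<open>p + 1\<close>
    has positive degree and no root.\<close>
  define p :: "'k poly" where "p = (\<Prod>a\<in>UNIV. [:- a, 1:])"
  have "degree p = CARD('k)"
    unfolding p_def using fin by (subst degree_prod_eq_sum_degree) auto
  moreover have "CARD('k) > 0"
    using fin by (simp add: card_gt_0_iff)
  ultimately have "degree (p + 1) > 0"
    by (subst degree_add_eq_left) auto
  then obtain x where "poly (p + 1) x = 0"
    using alg_closed_imp_poly_has_root by blast
  moreover have "poly p x = 0"
    unfolding p_def poly_prod using fin by (intro prod_zero) auto
  ultimately show False by simp
qed

lemma poly_eq_on_nonzero:
  fixes p q :: "'k::alg_closed_field poly"
  assumes "\<And>a. a \<noteq> 0 \<Longrightarrow> poly p a = poly q a"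
  shows "p = q"
proof (rule ccontr)
  assume "p \<noteq> q"
  then have "finite {x. poly (p - q) x = 0}"
    by (intro poly_roots_finite) auto
  moreover have "UNIV - {0} \<subseteq> {x. poly (p - q) x = 0}"
    using assms by auto
  ultimately show False
    using infinite_alg_closed_field[where 'k='k] by (meson finite_Diff2 finite.simps finite_subset)
qed

text \<open>Linear independence of the powers \<open>a powi r\<close>: dividing by the lowest power
  leaves polynomials, which agree at infinitely many points. The comparisons of coefficients below
  rest on this.\<close>

lemma power_int_sum_unique:
  fixes c d :: "int \<Rightarrow> 'k::alg_closed_field"
  assumes "finite I" "r \<in> I"
    and eq: "\<And>a. a \<noteq> 0 \<Longrightarrow> (\<Sum>r\<in>I. a powi r * c r) = (\<Sum>r\<in>I. a powi r * d r)"
  shows "c r = d r"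
proof -
  define m where "m = Min I"
  define p where "p = (\<lambda>c :: int \<Rightarrow> 'k. \<Sum>r\<in>I. monom (c r) (nat (r - m)))"
  have m: "m \<le> s" if "s \<in> I" for s
    using that assms(1) by (simp add: m_def)
  have p: "poly (p c) a = a powi (- m) * (\<Sum>r\<in>I. a powi r * c r)" if "a \<noteq> 0" for a c
  proof -
    have "a ^ nat (s - m) = a powi (- m) * a powi s" if "s \<in> I" for s
    proof -
      have "a ^ nat (s - m) = a powi (s - m)"
        using m[OF that] by (simp add: power_int_nonneg_exp)
      then show ?thesis
        using \<open>a \<noteq> 0\<close> power_int_add[of a "- m" s] by simp
    qed
    then show ?thesis
      by (auto simp: p_def poly_sum poly_monom sum_distrib_left algebra_simps intro!: sum.cong)
  qed
  have "p c = p d"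
    by (rule poly_eq_on_nonzero) (simp add: p eq)
  moreover have "coeff (p c) (nat (r - m)) = c r" for c
  proof -
    have "coeff (p c) (nat (r - m)) = (\<Sum>s\<in>I. if s = r then c s else 0)"
      unfolding p_def coeff_sum
    proof (rule sum.cong[OF refl])
      fix s assume "s \<in> I"
      then show "coeff (monom (c s) (nat (s - m))) (nat (r - m)) = (if s = r then c s else 0)"
        using m[of s] m[OF assms(2)] by (auto simp: nat_eq_iff2)
    qed
    then show ?thesis
      using assms(1,2) by simp
  qed
  ultimately show ?thesis by metis
qed

lemma power_int_vec_sum_unique:
  fixes c d :: "int \<Rightarrow> 'k::alg_closed_field^'n"
  assumes "finite I" "r \<in> I"
    and eq: "\<And>a. a \<noteq> 0 \<Longrightarrow> (\<Sum>r\<in>I. a powi r *s c r) = (\<Sum>r\<in>I. a powi r *s d r)"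
  shows "c r = d r"
proof -
  have "c r $ i = d r $ i" for i
  proof (rule power_int_sum_unique[where c = "\<lambda>r. c r $ i" and d = "\<lambda>r. d r $ i", OF assms(1,2)])
    fix a :: 'k assume "a \<noteq> 0"
    from arg_cong[OF eq[OF this], where f = "\<lambda>v. v $ i"]
    show "(\<Sum>r\<in>I. a powi r * c r $ i) = (\<Sum>r\<in>I. a powi r * d r $ i)"
      by simp
  qed
  then show ?thesis by (simp add: vec_eq_iff)
qed

lemma power_int_eq_iff:
  fixes m n :: int
  shows "(\<forall>a::'k::alg_closed_field. a \<noteq> 0 \<longrightarrow> a powi m = a powi n) \<longleftrightarrow> m = n"
proof
  assume *: "\<forall>a::'k. a \<noteq> 0 \<longrightarrow> a powi m = a powi n"
  show "m = n"
  proof (rule ccontr)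
    assume "m \<noteq> n"
    then have "(if m = m then 1 else 0 :: 'k) = (if m = n then 1 else 0)"
      by (intro power_int_sum_unique[where I = "{m, n}" and c = "\<lambda>r. if r = m then 1 else 0" and
        d = "\<lambda>r. if r = n then 1 else 0"]) (use * in auto)
    then show False using \<open>m \<noteq> n\<close> by simp
  qed
qed auto

text \<open>The regularity clause of \<open>cochars\<close> for a single entry, isolated so that
  closure under sums, products and inversion of the argument is available.\<close>

definition laurent :: "('k::field \<Rightarrow> 'k) \<Rightarrow> bool" where
  "laurent f \<longleftrightarrow> (\<exists>p m. \<forall>a. a \<noteq> 0 \<longrightarrow> f a = poly p a / a ^ m)"

lemma laurent_const [intro]: "laurent (\<lambda>_. c)"
  unfolding laurent_def by (rule exI[of _ "[:c:]"], rule exI[of _ 0]) auto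

lemma laurent_add [intro]:
  assumes "laurent f" "laurent g"
  shows "laurent (\<lambda>a. f a + g a)"
proof -
  obtain p m where f: "\<And>a. a \<noteq> 0 \<Longrightarrow> f a = poly p a / a ^ m"
    using assms(1) unfolding laurent_def by blast
  obtain q n where g: "\<And>a. a \<noteq> 0 \<Longrightarrow> g a = poly q a / a ^ n"
    using assms(2) unfolding laurent_def by blast
  have "f a + g a = poly (p * monom 1 n + q * monom 1 m) a / a ^ (m + n)" if "a \<noteq> 0" for a
    using that by (simp add: f g poly_monom power_add add_frac_eq)
  then show ?thesis unfolding laurent_def by blast
qed

lemma laurent_mult [intro]:
  assumes "laurent f" "laurent g"
  shows "laurent (\<lambda>a. f a * g a)"
proof -
  obtain p m where f: "\<And>a. a \<noteq> 0 \<Longrightarrow> f a = poly p a / a ^ m"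
    using assms(1) unfolding laurent_def by blast
  obtain q n where g: "\<And>a. a \<noteq> 0 \<Longrightarrow> g a = poly q a / a ^ n"
    using assms(2) unfolding laurent_def by blast
  have "f a * g a = poly (p * q) a / a ^ (m + n)" if "a \<noteq> 0" for a
    using that by (simp add: f g power_add)
  then show ?thesis unfolding laurent_def by blast
qed

lemma laurent_sum [intro]: "(\<And>i. i \<in> A \<Longrightarrow> laurent (f i)) \<Longrightarrow> laurent (\<lambda>a. \<Sum>i\<in>A. f i a)"
  by (induction A rule: infinite_finite_induct) auto

lemma laurent_prod [intro]: "(\<And>i. i \<in> A \<Longrightarrow> laurent (f i)) \<Longrightarrow> laurent (\<lambda>a. \<Prod>i\<in>A. f i a)"
  by (induction A rule: infinite_finite_induct) auto

lemma laurent_power [intro]: "laurent f \<Longrightarrow> laurent (\<lambda>a. f a ^ m)"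
  by (induction m) auto

lemma laurent_cong:
  "(\<And>a. a \<noteq> 0 \<Longrightarrow> f a = g a) \<Longrightarrow> laurent f \<longleftrightarrow> laurent g"
  unfolding laurent_def by auto

text \<open>Replaces division: the inverse of a value of a homomorphism is its value at
  \<open>inverse a\<close>. It serves for inverse cocharacters and for the powers of
  \<open>det\<close> in the denominators of regular functions.\<close>

lemma laurent_inverse_arg:
  assumes "laurent f"
  shows "laurent (\<lambda>a. f (inverse a))"
proof -
  obtain p m where pm: "\<And>a. a \<noteq> 0 \<Longrightarrow> f a = poly p a / a ^ m"
    using assms unfolding laurent_def by blast
  have "f (inverse a) = poly (reflect_poly p * monom 1 m) a / a ^ degree p" if "a \<noteq> 0" for a
    using that by (simp add: pm poly_reflect_poly_nz poly_monom field_simps)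
  then show ?thesis unfolding laurent_def by blast
qed

text \<open>The coefficients stay the same when the range grows; this permits one common range for
  all coordinates of a vector.\<close>

lemma laurent_expand:
  assumes "laurent f"
  shows "\<exists>c K0. \<forall>K\<ge>K0. \<forall>a. a \<noteq> 0 \<longrightarrow> f a = (\<Sum>r\<in>{- K..K::int}. a powi r * c r)"
proof -
  obtain p m where pm: "\<And>a. a \<noteq> 0 \<Longrightarrow> f a = poly p a / a ^ m"
    using assms unfolding laurent_def by blast
  define c where "c = (\<lambda>r::int. if r \<ge> - int m then coeff p (nat (r + m)) else 0)"
  have "f a = (\<Sum>r\<in>{- K..K::int}. a powi r * c r)"
    if K: "K \<ge> int m + int (degree p)" and "a \<noteq> 0" for K a
  proof -
    have "f a = (\<Sum>k\<le>degree p. a powi (int k - int m) * coeff p k)"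
      using \<open>a \<noteq> 0\<close> by (simp add: pm poly_altdef sum_divide_distrib power_int_diff field_simps)
    also have "\<dots> = (\<Sum>r\<in>(\<lambda>k. int k - int m) ` {..degree p}. a powi r * c r)"
      by (subst sum.reindex) (auto simp: inj_on_def c_def)
    also have "\<dots> = (\<Sum>r\<in>{- K..K::int}. a powi r * c r)"
    proof (rule sum.mono_neutral_left)
      show "\<forall>r\<in>{- K..K} - (\<lambda>k. int k - int m) ` {..degree p}. a powi r * c r = 0"
      proof
        fix r assume r: "r \<in> {- K..K} - (\<lambda>k. int k - int m) ` {..degree p}"
        have "coeff p (nat (r + m)) = 0" if "r \<ge> - int m"
        proof (rule coeff_eq_0, rule ccontr)
          assume "\<not> degree p < nat (r + m)"
          then have "r \<in> (\<lambda>k. int k - int m) ` {..degree p}"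
            using that by (intro image_eqI[where x = "nat (r + m)"]) auto
          then show False using r by auto
        qed
        then show "a powi r * c r = 0" by (simp add: c_def)
      qed
    qed (use K in auto)
    finally show ?thesis .
  qed
  then show ?thesis by blast
qed

lemma laurent_vec_expand:
  fixes f :: "'k::field \<Rightarrow> 'k^'n::finite"
  assumes "\<And>i. laurent (\<lambda>a. f a $ i)"
  shows "\<exists>c K. \<forall>a. a \<noteq> 0 \<longrightarrow> f a = (\<Sum>r\<in>{- K..K::int}. a powi r *s c r)"
proof -
  obtain c K0 where cK: "\<And>i K a. K \<ge> K0 i \<Longrightarrow> a \<noteq> 0 \<Longrightarrow>
      f a $ i = (\<Sum>r\<in>{- K..K::int}. a powi r * c i r)"
    using laurent_expand[OF assms] by metis
  define K where "K = Max (range K0)"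
  have "f a = (\<Sum>r\<in>{- K..K::int}. a powi r *s (\<chi> i. c i r))" if "a \<noteq> 0" for a
    using cK[OF _ that, of _ K] by (simp add: vec_eq_iff K_def)
  then show ?thesis by (intro exI[of _ "\<lambda>r. \<chi> i. c i r"] exI[of _ K]) auto
qed

text \<open>Comparing coefficients of the powers of \<open>a\<close> in
  \<open>h (a * b) = h a * h b\<close> gives \<open>b powi r * c r = h b * c r\<close>, so any
  \<open>r\<close> with \<open>c r\<close> nonzero is the exponent. The value at \<open>1\<close>
  guarantees such an \<open>r\<close>.\<close>

lemma laurent_multiplicative:
  fixes h :: "'k::alg_closed_field \<Rightarrow> 'k"
  assumes "laurent h" and mult: "\<And>a b. a \<noteq> 0 \<Longrightarrow> b \<noteq> 0 \<Longrightarrow> h (a * b) = h a * h b"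
    and nz: "h 1 \<noteq> 0"
  shows "\<exists>m. \<forall>a. a \<noteq> 0 \<longrightarrow> h a = a powi m"
proof -
  obtain c K where cK: "\<And>a. a \<noteq> 0 \<Longrightarrow> h a = (\<Sum>r\<in>{- K..K::int}. a powi r * c r)"
    using laurent_expand[OF assms(1)] by blast
  have *: "b powi r * c r = h b * c r" if r: "r \<in> {- K..K}" and b: "b \<noteq> 0" for b r
  proof (rule power_int_sum_unique[OF _ r])
    fix a :: 'k assume "a \<noteq> 0"
    then have "(\<Sum>r\<in>{- K..K}. a powi r * (b powi r * c r)) = h (a * b)"
      using b by (simp add: cK power_int_mult_distrib mult.assoc)
    also have "\<dots> = h b * h a"
      using mult[OF \<open>a \<noteq> 0\<close> b] by simp
    also have "\<dots> = (\<Sum>r\<in>{- K..K}. a powi r * (h b * c r))"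
      by (simp add: cK[OF \<open>a \<noteq> 0\<close>] sum_distrib_left algebra_simps)
    finally show "(\<Sum>r\<in>{- K..K}. a powi r * (b powi r * c r)) = 
      (\<Sum>r\<in>{- K..K}. a powi r * (h b * c r))" .
  qed simp
  have "\<exists>r\<in>{- K..K}. c r \<noteq> 0"
    using nz cK[of 1] by (force intro: sum.neutral)
  then show ?thesis using * by (metis mult_cancel_right)
qed


section \<open>Conjugation of matrices and cocharacters\<close>

lemma matrix_inv_right: "invertible A \<Longrightarrow> A ** matrix_inv A = mat 1"
  and matrix_inv_left: "invertible A \<Longrightarrow> matrix_inv A ** A = mat 1"
  unfolding invertible_def matrix_inv_def by (metis (mono_tags, lifting) someI_ex)+

lemma invertible_matrix_inv: "invertible A \<Longrightarrow> invertible (matrix_inv A)"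
  unfolding invertible_def using matrix_inv_left matrix_inv_right invertible_def by blast

lemma matrix_inv_mult:
  fixes A B :: "'k::field^'n^'n"
  assumes "invertible A" "invertible B"
  shows "matrix_inv (A ** B) = matrix_inv B ** matrix_inv A"
proof -
  have "(A ** B) ** (matrix_inv B ** matrix_inv A) = mat 1"
    using assms by (metis matrix_inv_right matrix_mul_assoc matrix_mul_rid)
  moreover have "matrix_inv (A ** B) ** (A ** B) = mat 1"
    using assms by (simp add: invertible_mult matrix_inv_left)
  ultimately show ?thesis
    by (metis matrix_mul_assoc matrix_mul_lid matrix_mul_rid)
qed

lemma matrix_inv_one: "matrix_inv (mat 1 :: 'k::field^'n^'n) = mat 1"
  by (metis invertible_def matrix_inv_right matrix_mul_lid)

lemma GL_simps [simp]:
  "A \<in> carrier GL \<longleftrightarrow> invertible A" "A \<otimes>\<^bsub>GL\<^esub> B = A ** B" "\<one>\<^bsub>GL\<^esub> = mat 1"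
  by (auto simp: GL_def)

lemma invertible_mat_1 [simp]: "invertible (mat 1 :: 'k::field^'n^'n)"
  unfolding invertible_def by (metis matrix_mul_lid)

lemma group_GL: "group (GL :: ('k::field^'n^'n) monoid)"
proof (rule groupI)
  show "\<exists>y\<in>carrier GL. y \<otimes>\<^bsub>GL\<^esub> x = \<one>\<^bsub>GL\<^esub>" if "x \<in> carrier GL" for x :: "'k^'n^'n"
    using that by (auto intro!: bexI[of _ "matrix_inv x"] simp: matrix_inv_left invertible_matrix_inv)
qed (auto simp: invertible_mult matrix_mul_assoc)

lemma inv_GL:
  fixes A :: "'k::field^'n^'n"
  assumes "invertible A"
  shows "inv\<^bsub>GL\<^esub> A = matrix_inv A"
  by (rule group.inv_equality[OF group_GL]) (use assms in \<open>auto simp: matrix_inv_left invertible_matrix_inv\<close>)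

lemma mconj_mult:
  fixes x :: "'k::field^'n^'n"
  assumes "invertible x"
  shows "mconj x (A ** B) = mconj x A ** mconj x B"
proof -
  have "mconj x A ** mconj x B = x ** A ** (matrix_inv x ** x) ** B ** matrix_inv x"
    by (simp add: mconj_def matrix_mul_assoc)
  then show ?thesis
    using assms by (simp add: mconj_def matrix_inv_left matrix_mul_assoc)
qed

lemma mconj_mconj:
  fixes x :: "'k::field^'n^'n"
  assumes "invertible x" "invertible y"
  shows "mconj x (mconj y A) = mconj (x ** y) A"
  using assms by (simp add: mconj_def matrix_inv_mult matrix_mul_assoc)

lemma mconj_one [simp]: "mconj (mat 1 :: 'k::field^'n^'n) A = A"
  by (simp add: mconj_def matrix_inv_one)

lemma mconj_id [simp]: "invertible x \<Longrightarrow> mconj x (mat 1 :: 'k::field^'n^'n) = mat 1"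
  by (simp add: mconj_def matrix_inv_right)

lemma mconj_zero [simp]: "mconj x (0 :: 'k::field^'n^'n) = 0"
  by (simp add: mconj_def vec_eq_iff matrix_matrix_mult_def)

lemma mconj_inverse:
  fixes x :: "'k::field^'n^'n"
  assumes "invertible x"
  shows "mconj (matrix_inv x) (mconj x A) = A" "mconj x (mconj (matrix_inv x) A) = A"
  using assms by (simp_all add: mconj_mconj invertible_matrix_inv matrix_inv_left matrix_inv_right)

lemma mconj_image_inverse:
  fixes x :: "'k::field^'n^'n"
  assumes "invertible x"
  shows "mconj (matrix_inv x) ` mconj x ` T = T" "mconj x ` mconj (matrix_inv x) ` T = T"
  using assms by (simp_all add: image_image mconj_inverse)

lemma cochar_conj_cochar_conj:
  fixes x :: "'k::field^'n^'n"
  assumes "invertible x" "invertible y"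
  shows "cochar_conj x (cochar_conj y l) = cochar_conj (x ** y) l"
  using assms by (simp add: cochar_conj_def mconj_mconj)

lemma cochar_conj_one [simp]: "cochar_conj (mat 1 :: 'k::field^'n^'n) l = l"
  by (simp add: cochar_conj_def)

lemma cochar_conj_inverse:
  fixes x :: "'k::field^'n^'n"
  assumes "invertible x"
  shows "cochar_conj (matrix_inv x) (cochar_conj x l) = l" "cochar_conj x (cochar_conj (matrix_inv x) l) = l"
  using assms by (simp_all add: cochar_conj_def mconj_inverse)

lemma cochar_conj_mult:
  fixes x :: "'k::field^'n^'n"
  assumes "invertible x"
  shows "cochar_conj x (cochar_mult l m) = cochar_mult (cochar_conj x l) (cochar_conj x m)"
  using assms by (simp add: cochar_conj_def cochar_mult_def mconj_mult)

lemma cocharsD: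
  assumes "l \<in> cochars T"
  shows "l 0 = 0" "a \<noteq> 0 \<Longrightarrow> l a \<in> T" "a \<noteq> 0 \<Longrightarrow> b \<noteq> 0 \<Longrightarrow> l (a * b) = l a ** l b"
    "laurent (\<lambda>a. l a $ i $ j)"
  using assms unfolding cochars_def laurent_def by auto

lemma cochar_one:
  fixes l :: "('k::field, 'n::finite) cochar"
  assumes "l \<in> cochars T" "T \<subseteq> carrier GL"
  shows "l 1 = mat 1"
proof -
  have "l 1 ** l 1 = l 1"
    using cocharsD(3)[OF assms(1), of 1 1] by simp
  moreover have "invertible (l 1)"
    using cocharsD(2)[OF assms(1), of 1] assms(2) by auto
  ultimately show ?thesis
    by (metis matrix_inv_left matrix_mul_assoc matrix_mul_lid)
qed

lemma cochar_conj_in_cochars: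
  fixes x :: "'k::field^'n::finite^'n"
  assumes "l \<in> cochars T" "invertible x"
  shows "cochar_conj x l \<in> cochars (mconj x ` T)"
proof -
  have "laurent (\<lambda>a. cochar_conj x l a $ i $ j)" for i j
    unfolding cochar_conj_def mconj_def matrix_matrix_mult_def
    by (simp only: vec_lambda_beta) (intro laurent_sum laurent_mult laurent_const cocharsD(4)[OF assms(1)])
  then show ?thesis
    using cocharsD(1-3)[OF assms(1)] assms(2)
    unfolding cochars_def laurent_def[symmetric]
    by (auto simp: cochar_conj_def mconj_mult)
qed


section \<open>The filtration attached to a cocharacter\<close>

text \<open>The sum of the weight spaces of \<open>l\<close> for weights at least \<open>r\<close>. Saying that \<open>a\<^sup>-\<^sup>r l(a) v\<close> is
  polynomial in \<open>a\<close> avoids choosing an eigenbasis, and makes invariance under root groups immediate.\<close>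

definition filt :: "('k::field, 'n::finite) cochar \<Rightarrow> int \<Rightarrow> ('k^'n) set" where
  "filt l r = {v. \<forall>i. \<exists>p. \<forall>a. a \<noteq> 0 \<longrightarrow> (l a *v v) $ i = a powi r * poly p a}"

text \<open>The mechanism behind all invariance statements about \<open>filt\<close>: a matrix with
  entries polynomial in \<open>a\<close> cannot lower the order in \<open>a\<close>.
  \<open>M\<close> is constant for conjugation, change of basis and torus elements, and it is
  \<open>u (a ^ m * x)\<close> for root groups.\<close>

lemma filt_transport:
  assumes v: "v \<in> filt l r"
    and M: "\<And>i j. \<exists>p. \<forall>a. a \<noteq> 0 \<longrightarrow> M a $ i $ j = poly p a"
    and eq: "\<And>a. a \<noteq> 0 \<Longrightarrow> l' a *v w = M a *v (l a *v v)"
  shows "w \<in> filt l' r"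
proof -
  obtain p where p: "\<And>i a. a \<noteq> 0 \<Longrightarrow> (l a *v v) $ i = a powi r * poly (p i) a"
    using v unfolding filt_def mem_Collect_eq by metis
  obtain q where q: "\<And>i j a. a \<noteq> 0 \<Longrightarrow> M a $ i $ j = poly (q i j) a"
    using M by metis
  have "(l' a *v w) $ i = a powi r * poly (\<Sum>j\<in>UNIV. q i j * p j) a" if "a \<noteq> 0" for a i
    using that by (simp add: eq matrix_vector_mult_def[of "M a"] p q poly_sum sum_distrib_left algebra_simps)
  then show ?thesis unfolding filt_def by blast
qed

lemma filt_conj:
  fixes g :: "'k::field^'n::finite^'n"
  assumes g: "invertible g"
  shows "filt (cochar_conj g l) r = (*v) g ` filt l r"
proof -
  have sub: "(*v) h ` filt m r \<subseteq> filt (cochar_conj h m) r" if h: "invertible h" for h :: "'k^'n^'n" and m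
  proof
    fix w assume "w \<in> (*v) h ` filt m r"
    then obtain v where v: "v \<in> filt m r" "w = h *v v" by blast
    show "w \<in> filt (cochar_conj h m) r"
    proof (rule filt_transport[OF v(1)])
      show "\<exists>p. \<forall>a. a \<noteq> 0 \<longrightarrow> h $ i $ j = poly p a" for i j
        by (rule exI[of _ "[:h $ i $ j:]"]) simp
      show "cochar_conj h m a *v w = h *v (m a *v v)" for a
        using matrix_inv_left[OF h]
        by (simp add: v(2) cochar_conj_def mconj_def matrix_vector_mul_assoc matrix_mul_assoc[symmetric])
    qed
  qed
  have "(*v) (matrix_inv g) ` filt (cochar_conj g l) r \<subseteq> filt l r"
    using sub[OF invertible_matrix_inv[OF g], of "cochar_conj g l"] by (simp add: cochar_conj_inverse g)
  then have "(*v) g ` (*v) (matrix_inv g) ` filt (cochar_conj g l) r \<subseteq> (*v) g ` filt l r"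
    by (rule image_mono)
  then have "filt (cochar_conj g l) r \<subseteq> (*v) g ` filt l r"
    using g by (simp add: image_image matrix_vector_mul_assoc matrix_inv_right)
  then show ?thesis using sub[OF g] by blast
qed


section \<open>Simultaneous diagonalisation of the cocharacters of a commutative group\<close>

definition weight_space :: "('k::field, 'n::finite) cochar \<Rightarrow> int \<Rightarrow> ('k^'n) set" where
  "weight_space l r = {v. \<forall>a. a \<noteq> 0 \<longrightarrow> l a *v v = a powi r *s v}"

text \<open>For each cocharacter separately, \<open>U\<close> is the sum of its weight subspaces.
  This is said without projections: the coefficients of the Laurent polynomial
  \<open>l a *v v\<close> are the weight components of \<open>v\<close>, by
  \<open>weight_component\<close>.\<close>

definition graded :: "('k::field^'n::finite^'n) set \<Rightarrow> ('k^'n) set \<Rightarrow> bool" where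
  "graded T U \<longleftrightarrow> vec.subspace U \<and> (\<forall>l\<in>cochars T. \<forall>v\<in>U. \<exists>c K. (\<forall>r\<in>{- K..K::int}. c r \<in> U) \<and>
     (\<forall>a. a \<noteq> 0 \<longrightarrow> l a *v v = (\<Sum>r\<in>{- K..K}. a powi r *s c r)))"

lemma subspace_weight_space: "vec.subspace (weight_space l r)"
  unfolding vec.subspace_def weight_space_def
  by (auto simp: matrix_vector_right_distrib vec.scale vec.scale_right_distrib vec.scale_left_commute)

text \<open>Comparison of the coefficients of the powers of \<open>a\<close> in
  \<open>l b *v (l a *v v) = l (b * a) *v v\<close> for fixed \<open>b\<close>.\<close>

lemma weight_component:
  fixes l :: "('k::alg_closed_field, 'n::finite) cochar"
  assumes l: "l \<in> cochars T" and r: "r \<in> {- K..K::int}"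
    and c: "\<And>a. a \<noteq> 0 \<Longrightarrow> l a *v v = (\<Sum>r\<in>{- K..K}. a powi r *s c r)"
  shows "c r \<in> weight_space l r"
  unfolding weight_space_def
proof (intro CollectI allI impI)
  fix b :: 'k assume b: "b \<noteq> 0"
  show "l b *v c r = b powi r *s c r"
  proof (rule power_int_vec_sum_unique[OF _ r, where c = "\<lambda>r. l b *v c r" and d = "\<lambda>r. b powi r *s c r"])
    fix a :: 'k assume a: "a \<noteq> 0"
    have "(\<Sum>r\<in>{- K..K}. a powi r *s (l b *v c r)) = l b *v (l a *v v)"
      by (simp add: c a vec.sum vec.scale)
    also have "\<dots> = l (b * a) *v v"
      using cocharsD(3)[OF l b a] by (simp add: matrix_vector_mul_assoc)
    also have "\<dots> = (\<Sum>r\<in>{- K..K}. a powi r *s (b powi r *s c r))"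
      using a b by (simp add: c power_int_mult_distrib mult.commute)
    finally show "(\<Sum>r\<in>{- K..K}. a powi r *s (l b *v c r)) = (\<Sum>r\<in>{- K..K}. a powi r *s (b powi r *s c r))" .
  qed simp
qed

lemma gradedD:
  assumes "graded T U" "l \<in> cochars T" "v \<in> U"
  shows "\<exists>c K. (\<forall>r\<in>{- K..K::int}. c r \<in> U) \<and>
      (\<forall>a. a \<noteq> 0 \<longrightarrow> l a *v v = (\<Sum>r\<in>{- K..K}. a powi r *s c r))"
  by (rule bspec[OF bspec[OF conjunct2[OF assms(1)[unfolded graded_def]] assms(2)] assms(3)])

lemma graded_UNIV: "graded T (UNIV :: ('k::field^'n::finite) set)"
proof -
  have "laurent (\<lambda>a. (l a *v v) $ i)" if "l \<in> cochars T" for l v i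
    unfolding matrix_vector_mult_def
    by (simp only: vec_lambda_beta) (intro laurent_sum laurent_mult laurent_const cocharsD(4)[OF that])
  then show ?thesis
    unfolding graded_def by (auto intro!: laurent_vec_expand)
qed

text \<open>Since \<open>l b\<close> commutes with \<open>m a\<close>, applying \<open>l b\<close>
  to the expansion of \<open>m a *v v\<close> multiplies the whole sum, and hence each coefficient,
  by \<open>b powi q\<close>. Splitting along one cocharacter is therefore compatible with all the
  others.\<close>

lemma graded_Int_weight_space:
  fixes T :: "('k::alg_closed_field^'n::finite^'n) set"
  assumes U: "graded T U" and l: "l \<in> cochars T"
    and comm: "\<And>s t. s \<in> T \<Longrightarrow> t \<in> T \<Longrightarrow> s ** t = t ** s"
  shows "graded T (U \<inter> weight_space l q)"
  unfolding graded_def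
proof (intro conjI ballI)
  show "vec.subspace (U \<inter> weight_space l q)"
    using U by (intro vec.subspace_inter subspace_weight_space) (simp add: graded_def)
next
  fix m v assume m: "m \<in> cochars T" and v: "v \<in> U \<inter> weight_space l q"
  from gradedD[OF U m IntD1[OF v]] obtain c K where c: "\<forall>r\<in>{- K..K::int}. c r \<in> U"
    and "\<forall>a. a \<noteq> 0 \<longrightarrow> m a *v v = (\<Sum>r\<in>{- K..K}. a powi r *s c r)"
    by (elim exE conjE)
  note sum = this(2)[rule_format]
  have "c r \<in> weight_space l q" if r: "r \<in> {- K..K}" for r
    unfolding weight_space_def
  proof (intro CollectI allI impI)
    fix b :: 'k assume b: "b \<noteq> 0"
    show "l b *v c r = b powi q *s c r"
    proof (rule power_int_vec_sum_unique[OF _ r, where c = "\<lambda>r. l b *v c r" and d = "\<lambda>r. b powi q *s c r"])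
      fix a :: 'k assume a: "a \<noteq> 0"
      have "(\<Sum>r\<in>{- K..K}. a powi r *s (l b *v c r)) = l b *v (m a *v v)"
        by (simp add: sum a vec.sum vec.scale)
      also have "\<dots> = m a *v (l b *v v)"
        using comm[OF cocharsD(2)[OF l b] cocharsD(2)[OF m a]] by (simp add: matrix_vector_mul_assoc)
      also have "\<dots> = b powi q *s (m a *v v)"
        using v b by (simp add: weight_space_def vec.scale)
      also have "\<dots> = (\<Sum>r\<in>{- K..K}. a powi r *s (b powi q *s c r))"
        by (simp add: sum a vec.scale_sum_right mult.commute)
      finally show "(\<Sum>r\<in>{- K..K}. a powi r *s (l b *v c r)) = (\<Sum>r\<in>{- K..K}. a powi r *s (b powi q *s c r))" .
    qed simp
  qed
  then show "\<exists>c K. (\<forall>r\<in>{- K..K::int}. c r \<in> U \<inter> weight_space l q) \<and>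
     (\<forall>a. a \<noteq> 0 \<longrightarrow> m a *v v = (\<Sum>r\<in>{- K..K}. a powi r *s c r))"
    using c sum by blast
qed

text \<open>Induction on the dimension. Either each cocharacter has a single weight on
  \<open>U\<close>, and then \<open>U\<close> consists of common weight vectors, or some
  \<open>l\<close> has none and all the graded subspaces into which it cuts \<open>U\<close> are
  proper.\<close>

lemma graded_subset_span:
  fixes T :: "('k::alg_closed_field^'n::finite^'n) set"
  assumes "graded T U" and T: "T \<subseteq> carrier GL"
    and comm: "\<And>s t. s \<in> T \<Longrightarrow> t \<in> T \<Longrightarrow> s ** t = t ** s"
  shows "U \<subseteq> vec.span {v. \<forall>l\<in>cochars T. \<exists>r. v \<in> weight_space l r}"
  using assms(1)
proof (induction "vec.dim U" arbitrary: U rule: less_induct)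
  case less
  show ?case
  proof (cases "\<forall>l\<in>cochars T. \<exists>r. U \<subseteq> weight_space l r")
    case True
    then have "U \<subseteq> {v. \<forall>l\<in>cochars T. \<exists>r. v \<in> weight_space l r}" by blast
    then show ?thesis using vec.span_superset by (rule order_trans)
  next
    case False
    then obtain l where l: "l \<in> cochars T" and not: "\<And>r. \<not> U \<subseteq> weight_space l r" by blast
    have U: "vec.subspace U" using less.prems by (simp add: graded_def)
    show ?thesis
    proof
      fix v assume v: "v \<in> U"
      from gradedD[OF less.prems l v] obtain c K where c: "\<forall>r\<in>{- K..K::int}. c r \<in> U"
        and "\<forall>a. a \<noteq> 0 \<longrightarrow> l a *v v = (\<Sum>r\<in>{- K..K}. a powi r *s c r)"
        by (elim exE conjE)
      note sum = this(2)[rule_format]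
      \<comment> \<open>At \<open>a = 1\<close> all powers are 1 and \<open>l 1\<close> is the
        identity.\<close>
      have "v = (\<Sum>r\<in>{- K..K}. c r)"
        using sum[of 1] cochar_one[OF l T] by simp
      moreover have "c r \<in> vec.span {v. \<forall>l\<in>cochars T. \<exists>r. v \<in> weight_space l r}" if r: "r \<in> {- K..K}" for r
      proof -
        have sub: "vec.subspace (U \<inter> weight_space l r)"
          using U subspace_weight_space vec.subspace_inter by blast
        have "vec.span (U \<inter> weight_space l r) \<subset> vec.span U"
          unfolding vec.span_eq_iff[THEN iffD2, OF U] vec.span_eq_iff[THEN iffD2, OF sub]
          using not[of r] by blast
        then have "vec.dim (U \<inter> weight_space l r) < vec.dim U"
          by (rule vec.dim_psubset)
        then have "U \<inter> weight_space l r \<subseteq> vec.span {v. \<forall>l\<in>cochars T. \<exists>r. v \<in> weight_space l r}"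
          by (rule less.hyps) (rule graded_Int_weight_space[OF less.prems l comm])
        then show ?thesis
          using c r weight_component[OF l r sum] by blast
      qed
      ultimately show "v \<in> vec.span {v. \<forall>l\<in>cochars T. \<exists>r. v \<in> weight_space l r}"
        by (auto intro: vec.span_sum)
    qed
  qed
qed

text \<open>The matrix of \<open>l a\<close> in the basis given by the columns of \<open>P\<close>
  is diagonal with entries \<open>a powi (w $ i)\<close>, written without an inverse of
  \<open>P\<close>. One \<open>P\<close> is to serve for all cocharacters of a torus.\<close>

definition weights :: "'k::field^'n::finite^'n \<Rightarrow> ('k, 'n) cochar \<Rightarrow> int^'n \<Rightarrow> bool" where
  "weights P l w \<longleftrightarrow> (\<forall>a x. a \<noteq> 0 \<longrightarrow> l a *v (P *v x) = P *v (\<chi> i. a powi (w $ i) * x $ i))"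

lemma cochars_diagonalisable:
  fixes T :: "('k::alg_closed_field^'n::finite^'n) set"
  assumes T: "T \<subseteq> carrier GL"
    and comm: "\<And>s t. s \<in> T \<Longrightarrow> t \<in> T \<Longrightarrow> s ** t = t ** s"
  shows "\<exists>P. invertible P \<and> (\<forall>l\<in>cochars T. \<exists>w. weights P l w)"
proof -
  let ?E = "{v. \<forall>l\<in>cochars T. \<exists>r. v \<in> weight_space l r}"
  have E: "vec.span ?E = UNIV"
    using graded_subset_span[OF graded_UNIV T comm] by blast
  \<comment> \<open>A basis taken from the common weight vectors does not depend on the cocharacter,
    and so neither does \<open>P\<close>.\<close>
  obtain B where B: "B \<subseteq> ?E" "vec.independent B" "?E \<subseteq> vec.span B"
    using vec.maximal_independent_subset by blast
  have spanB: "vec.span B = UNIV"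
    using vec.span_mono[OF B(3)] by (simp add: E vec.span_span top.extremum_unique)
  have "card B = CARD('n)"
    using vec.dim_eq_card_independent[OF B(2)] spanB by (metis vec.dim_span vec_dim_card)
  moreover have "finite B" using B(2) vec.finiteI_independent by blast
  ultimately obtain f where f: "bij_betw f (UNIV :: 'n set) B"
    using finite_same_card_bij[of "UNIV :: 'n set" B] by auto
  define P :: "'k^'n^'n" where "P = (\<chi> i j. f j $ i)"
  have col: "column j P = f j" for j
    by (simp add: column_def P_def)
  have "columns P = B"
    using f by (auto simp: columns_def col bij_betw_def)
  then have "invertible P"
    using spanB matrix_right_invertible_span_columns[of P] invertible_right_inverse by auto
  moreover have "\<exists>w. weights P l w" if l: "l \<in> cochars T" for l
  proof -
    have "\<exists>r. f j \<in> weight_space l r" for j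
      using B(1) f l by (auto simp: bij_betw_def)
    then obtain w where w: "\<And>j. f j \<in> weight_space l (w j)" by metis
    have "l a *v (P *v x) = P *v (\<chi> i. a powi (w i) * x $ i)" if "a \<noteq> 0" for a x
    proof -
      have "l a *v (P *v x) = (\<Sum>j\<in>UNIV. x $ j *s (l a *v f j))"
        by (simp add: matrix_mult_sum[of P] col vec.sum vec.scale)
      also have "\<dots> = (\<Sum>j\<in>UNIV. x $ j *s (a powi (w j) *s f j))"
        using w that by (simp add: weight_space_def)
      also have "\<dots> = P *v (\<chi> i. a powi (w i) * x $ i)"
        by (simp add: matrix_mult_sum[of P] col mult.commute)
      finally show ?thesis .
    qed
    then have "weights P l (\<chi> i. w i)" by (simp add: weights_def)
    then show ?thesis ..
  qed
  ultimately show ?thesis by blast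
qed

lemma weights_mult:
  assumes "weights P l w" "weights P m w'"
  shows "weights P (cochar_mult l m) (w + w')"
  using assms unfolding weights_def cochar_mult_def
  by (simp add: matrix_vector_mul_assoc[symmetric] power_int_add mult.assoc)

lemma matrix_vector_mult_cancel:
  fixes P :: "'k::field^'n::finite^'n"
  assumes "invertible P"
  shows "P *v x = P *v y \<longleftrightarrow> x = y"
  using inj_matrix_vector_mult[OF assms] by (auto dest: injD)

lemma weights_unique:
  fixes P :: "'k::alg_closed_field^'n::finite^'n"
  assumes P: "invertible P" and "weights P l w" "weights P l w'"
  shows "w = w'"
proof -
  have "a powi (w $ i) = a powi (w' $ i)" if "a \<noteq> 0" for a :: 'k and i
  proof -
    \<comment> \<open>The all-ones vector \<open>1\<close> exposes all diagonal entries at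
      once.\<close>
    have "P *v (\<chi> j. a powi (w $ j) * (1 :: 'k^'n) $ j) = P *v (\<chi> j. a powi (w' $ j) * (1 :: 'k^'n) $ j)"
      using assms(2,3) that unfolding weights_def by metis
    then have "(\<chi> j. a powi (w $ j) * (1 :: 'k^'n) $ j) = (\<chi> j. a powi (w' $ j) * (1 :: 'k^'n) $ j)"
      unfolding matrix_vector_mult_cancel[OF P] .
    then show ?thesis
      by (simp add: vec_eq_iff)
  qed
  then have "w $ i = w' $ i" for i
    using power_int_eq_iff[where 'k='k, of "w $ i" "w' $ i"] by blast
  then show ?thesis by (simp add: vec_eq_iff)
qed

text \<open>\<open>weights\<close> says nothing at \<open>a = 0\<close>, so the totalising value
  there is compared separately.\<close>

lemma weights_inj:
  fixes P :: "'k::field^'n::finite^'n"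
  assumes P: "invertible P" and "weights P l w" "weights P m w" and 0: "l 0 = m 0"
  shows "l = m"
proof
  fix a
  show "l a = m a"
  proof (cases "a = 0")
    case False
    have "l a *v v = m a *v v" for v
    proof -
      have "v = P *v (matrix_inv P *v v)"
        by (simp add: matrix_vector_mul_assoc matrix_inv_right P)
      then show ?thesis
        using assms(2,3) False unfolding weights_def by metis
    qed
    then show ?thesis by (simp add: matrix_eq)
  qed (use 0 in simp)
qed

text \<open>In the eigenbasis the coordinate \<open>x $ i\<close> is multiplied by
  \<open>a powi (w $ i)\<close>. Divided by \<open>a powi r\<close> this is polynomial in
  \<open>a\<close> only if \<open>w $ i\<close> is at least \<open>r\<close> or \<open>x $ i\<close>
  vanishes.\<close>

lemma filt_eq_image:
  fixes P :: "'k::alg_closed_field^'n::finite^'n"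
  assumes P: "invertible P" and w: "weights P l w"
  shows "filt l r = (*v) P ` {x. \<forall>i. i \<notin> {i. w $ i \<ge> r} \<longrightarrow> x $ i = 0}"
proof (intro equalityI subsetI)
  fix v assume v: "v \<in> filt l r"
  define x where "x = matrix_inv P *v v"
  have Px: "P *v x = v"
    by (simp add: x_def matrix_vector_mul_assoc matrix_inv_right P)
  \<comment> \<open>Passage to coordinates: \<open>?D\<close> is the diagonal form of the
    cocharacter, and the constant matrix \<open>matrix_inv P\<close> transports the
    filtration.\<close>
  have "x \<in> filt (\<lambda>a. (\<chi> i j. if i = j then a powi (w $ i) else 0)) r" (is "x \<in> filt ?D r")
  proof (rule filt_transport[OF v])
    show "\<exists>p. \<forall>a. a \<noteq> 0 \<longrightarrow> matrix_inv P $ i $ j = poly p a" for i j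
      by (rule exI[of _ "[:matrix_inv P $ i $ j:]"]) simp
    fix a :: 'k assume "a \<noteq> 0"
    then have "l a *v v = P *v (\<chi> i. a powi (w $ i) * x $ i)"
      using w Px by (auto simp: weights_def)
    then show "?D a *v x = matrix_inv P *v (l a *v v)"
      using P by (simp add: matrix_vector_mul_assoc matrix_inv_left)
        (simp add: vec_eq_iff matrix_vector_mult_def if_distrib[where f = "\<lambda>b. b * _"] cong: if_cong)
  qed
  then obtain p where p: "\<And>i a. a \<noteq> 0 \<Longrightarrow> a powi (w $ i) * x $ i = a powi r * poly (p i) a"
    unfolding filt_def mem_Collect_eq
    by (simp add: matrix_vector_mult_def if_distrib[where f = "\<lambda>b. b * _"] cong: if_cong) metis
  have "x $ i = 0" if i: "w $ i < r" for i
  proof -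
    have "poly [:x $ i:] a = poly (monom 1 (nat (r - w $ i)) * p i) a" if "a \<noteq> 0" for a
    proof -
      have "x $ i = a powi (- (w $ i)) * (a powi (w $ i) * x $ i)"
        using that by (simp add: power_int_minus)
      also have "\<dots> = a powi (r - w $ i) * poly (p i) a"
        using that power_int_add[of a "- (w $ i)" r] by (simp add: p[OF that] mult.assoc[symmetric])
      finally show ?thesis
        using i by (simp add: poly_monom power_int_nonneg_exp)
    qed
    then have "[:x $ i:] = monom 1 (nat (r - w $ i)) * p i"
      by (rule poly_eq_on_nonzero)
    \<comment> \<open>Equal polynomials may also be evaluated at \<open>0\<close>, where the
      monomial of positive degree vanishes.\<close>
    then have "poly [:x $ i:] 0 = poly (monom 1 (nat (r - w $ i)) * p i) 0"
      by simp
    then show ?thesis using i by (simp add: poly_monom)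
  qed
  then show "v \<in> (*v) P ` {x. \<forall>i. i \<notin> {i. w $ i \<ge> r} \<longrightarrow> x $ i = 0}"
    using Px by (intro image_eqI[of _ _ x]) auto
next
  fix v assume "v \<in> (*v) P ` {x. \<forall>i. i \<notin> {i. w $ i \<ge> r} \<longrightarrow> x $ i = 0}"
  then obtain x where v: "v = P *v x" and x: "\<And>i. w $ i < r \<Longrightarrow> x $ i = 0"
    by auto
  have "(l a *v v) $ i = a powi r * poly (\<Sum>j\<in>UNIV. smult (P $ i $ j * x $ j) (monom 1 (nat (w $ j - r)))) a"
    if a: "a \<noteq> 0" for a i
  proof -
    have eq: "a powi (w $ j) * x $ j = a powi r * (x $ j * a ^ nat (w $ j - r))" for j
    proof (cases "w $ j < r")
      case False
      then have "a ^ nat (w $ j - r) = a powi (w $ j - r)"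
        by (simp add: power_int_nonneg_exp)
      then show ?thesis using a by (simp add: power_int_diff)
    qed (simp add: x)
    have "(l a *v v) $ i = (\<Sum>j\<in>UNIV. P $ i $ j * (a powi (w $ j) * x $ j))"
      using w a by (simp add: v weights_def) (simp add: matrix_vector_mult_def)
    then show ?thesis
      by (simp only: eq) (simp add: poly_sum poly_monom sum_distrib_left mult_ac)
  qed
  then show "v \<in> filt l r" unfolding filt_def by blast
qed

text \<open>One basis diagonalises both cocharacters, so both filtration steps are spanned by
  columns of \<open>P\<close>, and the dimension of the intersection counts the common
  columns.\<close>

lemma dim_filt_Int:
  fixes P :: "'k::alg_closed_field^'n::finite^'n"
  assumes P: "invertible P" and w: "weights P l w" "weights P m w'"
  shows "vec.dim (filt l r \<inter> filt m s) = card {i. w $ i \<ge> r \<and> w' $ i \<ge> s}"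
proof -
  have "filt l r \<inter> filt m s = (*v) P ` {x. \<forall>i. i \<notin> {i. w $ i \<ge> r \<and> w' $ i \<ge> s} \<longrightarrow> x $ i = 0}"
    unfolding filt_eq_image[OF P w(1)] filt_eq_image[OF P w(2)]
      image_Int[OF inj_matrix_vector_mult[OF P], symmetric]
    by (rule arg_cong[where f = "image _"]) auto
  then show ?thesis
    using vec.dim_image_eq[OF matrix_vector_mul_linear_gen[of P]] inj_matrix_vector_mult[OF P]
      dim_substandard_cart[of "{i. w $ i \<ge> r \<and> w' $ i \<ge> s}", where 'a='k]
    by (metis (no_types, lifting) inj_on_subset subset_UNIV)
qed

section \<open>Scalar products of weight vectors\<close>

definition vdot :: "int^'n::finite \<Rightarrow> int^'n \<Rightarrow> int" where
  "vdot x y = (\<Sum>i\<in>UNIV. x $ i * y $ i)"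

text \<open>Inclusion-exclusion turns the counts over upper quadrants into the number of
  \<open>i\<close> with \<open>(x $ i, y $ i) = (r, s)\<close>. Thus the multiset of these pairs is
  determined, and with it the sum of their products.\<close>

lemma vdot_eqI:
  fixes x y x' y' :: "int^'n::finite"
  assumes card: "\<And>r s. card {i. x $ i \<ge> r \<and> y $ i \<ge> s} = card {i. x' $ i \<ge> r \<and> y' $ i \<ge> s}"
  shows "vdot x y = vdot x' y'"
proof -
  have level: "int (card {i. x $ i = r \<and> y $ i = s}) =
      int (card {i. x $ i \<ge> r \<and> y $ i \<ge> s}) - int (card {i. x $ i \<ge> r + 1 \<and> y $ i \<ge> s})
      - int (card {i. x $ i \<ge> r \<and> y $ i \<ge> s + 1}) + int (card {i. x $ i \<ge> r + 1 \<and> y $ i \<ge> s + 1})"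
    for x y :: "int^'n" and r s
  proof -
    have ind: "int (card {i. Q i}) = (\<Sum>i\<in>UNIV. of_bool (Q i))" for Q :: "'n \<Rightarrow> bool"
      by simp
    show ?thesis
      unfolding ind sum.distrib[symmetric] sum_subtractf[symmetric]
      by (rule sum.cong) (auto simp: of_bool_def)
  qed
  have "card {i. x $ i = r \<and> y $ i = s} = card {i. x' $ i = r \<and> y' $ i = s}" for r s
    using level[of x r y s] level[of x' r y' s] card by simp
  then have "image_mset (\<lambda>i. (x $ i, y $ i)) (mset_set UNIV) = image_mset (\<lambda>i. (x' $ i, y' $ i)) (mset_set UNIV)"
    by (intro multiset_eqI) (auto simp: count_image_mset vimage_def split: prod.split)
  then have "image_mset (\<lambda>(a, b). a * b) (image_mset (\<lambda>i. (x $ i, y $ i)) (mset_set UNIV)) =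
    image_mset (\<lambda>(a, b). a * b) (image_mset (\<lambda>i. (x' $ i, y' $ i)) (mset_set UNIV))"
    by simp
  then show ?thesis
    unfolding vdot_def sum_unfold_sum_mset by (simp add: image_mset.compositionality comp_def)
qed

text \<open>It is essential that the same \<open>g\<close> moves both filtrations: it then maps
  intersections to intersections and preserves their dimensions.\<close>

lemma vdot_filt_eq:
  fixes P :: "'k::alg_closed_field^'n::finite^'n"
  assumes P: "invertible P" and g: "invertible g"
    and w: "weights P l w" "weights P m v" "weights P l' w'" "weights P m' v'"
    and l: "\<And>r. filt l' r = (*v) g ` filt l r" and m: "\<And>r. filt m' r = (*v) g ` filt m r"
  shows "vdot w v = vdot w' v'"
proof (rule vdot_eqI)
  fix r s
  have "filt l' r \<inter> filt m' s = (*v) g ` (filt l r \<inter> filt m s)"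
    unfolding l m by (rule image_Int[OF inj_matrix_vector_mult[OF g], symmetric])
  then have "vec.dim (filt l' r \<inter> filt m' s) = vec.dim (filt l r \<inter> filt m s)"
    using vec.dim_image_eq[OF matrix_vector_mul_linear_gen[of g]] inj_matrix_vector_mult[OF g]
    by (metis inj_on_subset subset_UNIV)
  then show "card {i. w $ i \<ge> r \<and> v $ i \<ge> s} = card {i. w' $ i \<ge> r \<and> v' $ i \<ge> s}"
    using dim_filt_Int[OF P] w by simp
qed


section \<open>Fixed vectors of isometries of an integral cone\<close>

lemma vdot_simps:
  "vdot (x + y) z = vdot x z + vdot y z" "vdot z (x + y) = vdot z x + vdot z y"
  "vdot (x - y) z = vdot x z - vdot y z" "vdot z (x - y) = vdot z x - vdot z y"
  "vdot 0 z = 0" "vdot z 0 = 0"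
  by (simp_all add: vdot_def algebra_simps sum.distrib sum_subtractf)

lemma vdot_commute: "vdot x y = vdot y x"
  by (simp add: vdot_def mult.commute)

lemma vdot_sum_right: "vdot z (\<Sum>i\<in>A. f i) = (\<Sum>i\<in>A. vdot z (f i))"
  by (induction A rule: infinite_finite_induct) (auto simp: vdot_simps)

lemma vdot_self_eq_0: "vdot x x = 0 \<longleftrightarrow> x = 0"
  by (auto simp: vdot_def sum_nonneg_eq_0_iff vec_eq_iff)

text \<open>The absolute value of an integer is at most its square, so \<open>K\<close> bounds all
  coordinates.\<close>

lemma finite_vdot_sphere: "finite {x :: int^'n::finite. vdot x x = K}"
proof (rule finite_subset)
  have "x $ i \<in> {- K..K}" if "vdot x x = K" for x :: "int^'n" and i
  proof -
    have "x $ i * x $ i \<le> K"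
      unfolding that[symmetric] vdot_def by (rule member_le_sum) auto
    moreover have "\<bar>x $ i\<bar> \<le> x $ i * x $ i"
      by (metis abs_ge_zero abs_mult_self_eq mult_right_mono mult_1 mult_zero_left order_le_less
          zless_imp_add1_zle add_0)
    ultimately show ?thesis by auto
  qed
  then show "{x :: int^'n. vdot x x = K} \<subseteq> vec_lambda ` (UNIV \<rightarrow>\<^sub>E {- K..K})"
    by (intro subsetI, rule_tac x = "vec_nth x" in image_eqI) (auto simp: PiE_def)
  show "finite (vec_lambda ` ((UNIV :: 'n set) \<rightarrow>\<^sub>E {- K..K}))"
    by (intro finite_imageI finite_PiE) auto
qed

text \<open>The vector \<open>c\<close> is chosen before \<open>f\<close>. As \<open>f\<close> need
  not be additive, \<open>f c\<close> cannot be computed from the summands of \<open>c\<close>. But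
  \<open>f\<close> permutes the finite sphere \<open>S\<close>, which makes the product of
  \<open>f c\<close> with \<open>c\<close> equal to that of \<open>c\<close> with itself; as
  \<open>f c\<close> and \<open>c\<close> have equal length, they coincide.\<close>

lemma isometry_fixed_vector:
  fixes M :: "(int^'n::finite) set"
  assumes M0: "0 \<in> M" and add: "\<And>x y. x \<in> M \<Longrightarrow> y \<in> M \<Longrightarrow> x + y \<in> M"
    and v: "v \<in> M" "- v \<notin> M"
  shows "\<exists>c\<in>M. c \<noteq> 0 \<and> (\<forall>f. f ` M \<subseteq> M \<longrightarrow> (\<forall>x\<in>M. \<forall>y\<in>M. vdot (f x) (f y) = vdot x y) \<longrightarrow> f c = c)"
proof -
  define S where "S = {x \<in> M. vdot x x = vdot v v}"
  have S: "finite S"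
    unfolding S_def by (rule finite_subset[OF _ finite_vdot_sphere[of "vdot v v"]]) auto
  have sum: "sum id A \<in> M" if "A \<subseteq> M" for A
    using that by (induction A rule: infinite_finite_induct) (auto simp: M0 add)
  define c where "c = sum id S"
  have c: "c \<in> M"
    unfolding c_def by (rule sum) (auto simp: S_def)
  have "c = v + sum id (S - {v})"
    unfolding c_def by (subst sum.remove[OF S, of v]) (use v in \<open>auto simp: S_def\<close>)
  moreover have "sum id (S - {v}) \<in> M"
    by (rule sum) (auto simp: S_def)
  ultimately have "c \<noteq> 0"
    using v(2) by (metis add_eq_0_iff)
  moreover have "f c = c" if fM: "f ` M \<subseteq> M" and f: "\<And>x y. x \<in> M \<Longrightarrow> y \<in> M \<Longrightarrow> vdot (f x) (f y) = vdot x y" for f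
  proof -
    \<comment> \<open>Preservation of products is enough: the squared distance of \<open>x\<close>
      and \<open>y\<close> expands into them.\<close>
    have inj: "inj_on f M"
    proof (rule inj_onI)
      fix x y assume xy: "x \<in> M" "y \<in> M" "f x = f y"
      have "vdot (x - y) (x - y) = vdot (f x - f y) (f x - f y)"
        using xy(1,2) f by (simp add: vdot_simps)
      also have "\<dots> = 0" using xy(3) by (simp add: vdot_simps)
      finally show "x = y" by (simp add: vdot_self_eq_0)
    qed
    have "f ` S \<subseteq> S"
      using fM f by (auto simp: S_def)
    moreover have "inj_on f S"
      by (rule inj_on_subset[OF inj]) (auto simp: S_def)
    ultimately have fS: "bij_betw f S S"
      using S by (simp add: bij_betw_def endo_inj_surj)
    \<comment> \<open>Only the second argument is expanded as a sum over \<open>S\<close>; permuting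
      \<open>S\<close> replaces \<open>s\<close> by \<open>f s\<close> there, after which
      \<open>f\<close> can be cancelled.\<close>
    have "vdot (f c) c = (\<Sum>s\<in>S. vdot (f c) s)"
      by (subst (2) c_def) (simp add: vdot_sum_right)
    also have "\<dots> = (\<Sum>s\<in>S. vdot (f c) (f s))"
      by (rule sum.reindex_bij_betw[OF fS, symmetric])
    also have "\<dots> = (\<Sum>s\<in>S. vdot c s)"
      using f c by (auto simp: S_def)
    also have "\<dots> = vdot c c"
      by (subst (3) c_def) (simp add: vdot_sum_right)
    finally have "vdot (f c - c) (f c - c) = 0"
      using f[OF c c] by (simp add: vdot_simps vdot_commute)
    then show ?thesis by (simp add: vdot_self_eq_0)
  qed
  ultimately show ?thesis using c by blast
qed


section \<open>Tensor products with the real numbers\<close>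

lemma lookup_rscale [simp]: "Poly_Mapping.lookup (rscale r p) x = r * Poly_Mapping.lookup p x"
  by (simp add: rscale_def Poly_Mapping.map.rep_eq when_def)

lemma module_rscale: "module rscale"
  by unfold_locales (auto intro!: poly_mapping_eqI simp: lookup_add algebra_simps)

lemma rscale_single [simp]: "rscale r (Poly_Mapping.single x s) = Poly_Mapping.single x (r * s)"
  by (rule poly_mapping_eqI) (simp add: lookup_single when_def)

lemma keys_rscale_subset: "Poly_Mapping.keys (rscale r p) \<subseteq> Poly_Mapping.keys p"
  by (auto simp: in_keys_iff)

section \<open>Linear functionals on formal combinations\<close>

definition linear_ext :: "('a \<Rightarrow> real) \<Rightarrow> ('a \<Rightarrow>\<^sub>0 real) \<Rightarrow> real" where
  "linear_ext \<phi> p = (\<Sum>x\<in>Poly_Mapping.keys p. Poly_Mapping.lookup p x * \<phi> x)"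

lemma linear_ext_superset:
  assumes "finite A" "Poly_Mapping.keys p \<subseteq> A"
  shows "linear_ext \<phi> p = (\<Sum>x\<in>A. Poly_Mapping.lookup p x * \<phi> x)"
  unfolding linear_ext_def using assms
  by (intro sum.mono_neutral_left) (auto simp: in_keys_iff)

lemma linear_ext_add: "linear_ext \<phi> (p + q) = linear_ext \<phi> p + linear_ext \<phi> q"
proof -
  let ?A = "Poly_Mapping.keys p \<union> Poly_Mapping.keys q"
  have "linear_ext \<phi> r = (\<Sum>x\<in>?A. Poly_Mapping.lookup r x * \<phi> x)" if "r \<in> {p, q, p + q}" for r
    using that Poly_Mapping.keys_add[of p q] by (intro linear_ext_superset) auto
  then show ?thesis by (simp add: lookup_add distrib_right sum.distrib)
qed

lemma linear_ext_scale: "linear_ext \<phi> (rscale r p) = r * linear_ext \<phi> p"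
  using linear_ext_superset[OF finite_keys keys_rscale_subset, of \<phi> r p]
  by (simp add: linear_ext_def sum_distrib_left mult.assoc)

lemma linear_ext_single [simp]: "linear_ext \<phi> (Poly_Mapping.single x s) = s * \<phi> x"
  by (simp add: linear_ext_def)

lemma linear_ext_zero [simp]: "linear_ext \<phi> 0 = 0"
  by (simp add: linear_ext_def)

lemma linear_ext_diff: "linear_ext \<phi> (p - q) = linear_ext \<phi> p - linear_ext \<phi> q"
  using linear_ext_add[of \<phi> "p - q" q] by simp

lemma linear_ext_cong:
  "(\<And>x. x \<in> Poly_Mapping.keys p \<Longrightarrow> \<phi> x = \<psi> x) \<Longrightarrow> linear_ext \<phi> p = linear_ext \<psi> p"
  by (simp add: linear_ext_def)

lemma linear_ext_add_fun: "linear_ext (\<lambda>x. \<phi> x + \<psi> x) p = linear_ext \<phi> p + linear_ext \<psi> p"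
  by (simp add: linear_ext_def distrib_left sum.distrib)

text \<open>The linear extension of such a function is constant on the classes of
  \<open>tensor_rel\<close>, so it both computes values on classes and tells classes apart.\<close>

definition additive_on :: "'a monoid \<Rightarrow> ('a \<Rightarrow> real) \<Rightarrow> bool" where
  "additive_on A \<phi> \<longleftrightarrow> (\<forall>x\<in>carrier A. \<forall>y\<in>carrier A. \<phi> (x \<otimes>\<^bsub>A\<^esub> y) = \<phi> x + \<phi> y)"

definition tensor_span :: "'a monoid \<Rightarrow> ('a \<Rightarrow>\<^sub>0 real) set" where
  "tensor_span A = module.span rscale
          {Poly_Mapping.single (x \<otimes>\<^bsub>A\<^esub> y) 1 - Poly_Mapping.single x 1 - Poly_Mapping.single y 1
            | x y. x \<in> carrier A \<and> y \<in> carrier A}"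

lemma tensor_rel_iff:
  "(p, q) \<in> tensor_rel A \<longleftrightarrow>
    Poly_Mapping.keys p \<subseteq> carrier A \<and> Poly_Mapping.keys q \<subseteq> carrier A \<and> p - q \<in> tensor_span A"
  by (simp add: tensor_rel_def tensor_span_def)

lemma tensor_span_simps:
  "0 \<in> tensor_span A"
  "p \<in> tensor_span A \<Longrightarrow> q \<in> tensor_span A \<Longrightarrow> p + q \<in> tensor_span A"
  "p \<in> tensor_span A \<Longrightarrow> - p \<in> tensor_span A"
  "p \<in> tensor_span A \<Longrightarrow> rscale r p \<in> tensor_span A"
  unfolding tensor_span_def
  using module.span_zero[OF module_rscale] module.span_add[OF module_rscale]
    module.span_neg[OF module_rscale] module.span_scale[OF module_rscale] by blast+

lemma tensor_rel_refl: "Poly_Mapping.keys p \<subseteq> carrier A \<Longrightarrow> (p, p) \<in> tensor_rel A"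
  by (simp add: tensor_rel_iff tensor_span_simps)

lemma tensor_rel_sym: "(p, q) \<in> tensor_rel A \<Longrightarrow> (q, p) \<in> tensor_rel A"
  using tensor_span_simps(3)[of "p - q" A] by (simp add: tensor_rel_iff)

lemma tensor_rel_trans: "(p, q) \<in> tensor_rel A \<Longrightarrow> (q, r) \<in> tensor_rel A \<Longrightarrow> (p, r) \<in> tensor_rel A"
  using tensor_span_simps(2)[of "p - q" A "q - r"] by (simp add: tensor_rel_iff)

lemma tensor_rel_add:
  assumes "(p, q) \<in> tensor_rel A" "(p', q') \<in> tensor_rel A"
  shows "(p + p', q + q') \<in> tensor_rel A"
proof -
  have "p + p' - (q + q') = (p - q) + (p' - q')" by simp
  then show ?thesis
    using assms tensor_span_simps(2)[of "p - q" A "p' - q'"]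
      Poly_Mapping.keys_add[of p p'] Poly_Mapping.keys_add[of q q']
    unfolding tensor_rel_iff \<open>p + p' - (q + q') = _\<close> by blast
qed

lemma rscale_diff: "rscale r (p - q) = rscale r p - rscale r q"
  by (rule poly_mapping_eqI) (simp add: lookup_minus algebra_simps)

lemma tensor_rel_scale:
  assumes "(p, q) \<in> tensor_rel A"
  shows "(rscale r p, rscale r q) \<in> tensor_rel A"
  using assms tensor_span_simps(4)[of "p - q" A r] keys_rscale_subset[of r p] keys_rscale_subset[of r q]
  unfolding tensor_rel_iff rscale_diff by blast

lemma tensor_rel_mult:
  assumes "x \<in> carrier A" "y \<in> carrier A" "x \<otimes>\<^bsub>A\<^esub> y \<in> carrier A"
  shows "(Poly_Mapping.single (x \<otimes>\<^bsub>A\<^esub> y) s, Poly_Mapping.single x s + Poly_Mapping.single y s) \<in> tensor_rel A"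
proof -
  have "(Poly_Mapping.single (x \<otimes>\<^bsub>A\<^esub> y) 1, Poly_Mapping.single x 1 + Poly_Mapping.single y 1) \<in> tensor_rel A"
    using assms Poly_Mapping.keys_add[of "Poly_Mapping.single x (1::real)" "Poly_Mapping.single y 1"]
    unfolding tensor_rel_iff tensor_span_def
    by (intro conjI module.span_base[OF module_rscale]) (fastforce simp: diff_diff_eq)+
  from tensor_rel_scale[OF this, of s] show ?thesis
    by (simp add: module.scale_right_distrib[OF module_rscale])
qed

lemma equiv_tensor_rel: "equiv {p. Poly_Mapping.keys p \<subseteq> carrier A} (tensor_rel A)"
proof (rule equivI)
  show "refl_on {p. Poly_Mapping.keys p \<subseteq> carrier A} (tensor_rel A)"
    by (rule refl_onI) (simp add: tensor_rel_refl)
  show "sym (tensor_rel A)" by (rule symI) (rule tensor_rel_sym)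
  show "trans (tensor_rel A)" by (rule transI) (rule tensor_rel_trans)
  show "tensor_rel A \<subseteq> {p. Poly_Mapping.keys p \<subseteq> carrier A} \<times> {p. Poly_Mapping.keys p \<subseteq> carrier A}"
    by (auto simp: tensor_rel_def)
qed

lemma linear_ext_tensor_rel:
  assumes \<phi>: "additive_on A \<phi>" and "(p, q) \<in> tensor_rel A"
  shows "linear_ext \<phi> p = linear_ext \<phi> q"
proof -
  have "tensor_span A \<subseteq> {p. linear_ext \<phi> p = 0}"
    unfolding tensor_span_def
  proof (rule module.span_minimal[OF module_rscale])
    show "module.subspace rscale {p. linear_ext \<phi> p = 0}"
      by (auto simp: module.subspace_def[OF module_rscale] linear_ext_add linear_ext_scale)
  qed (use \<phi> in \<open>auto simp: additive_on_def linear_ext_diff\<close>)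
  then show ?thesis
    using assms(2) by (auto simp: tensor_rel_iff linear_ext_diff)
qed

lemma tensor_scale_class:
  assumes "Poly_Mapping.keys p \<subseteq> carrier A"
  shows "tensor_scale A r (tensor_rel A `` {p}) = tensor_rel A `` {rscale r p}"
proof -
  have "tensor_rel A `` {rscale r q} = tensor_rel A `` {rscale r p}" if "(p, q) \<in> tensor_rel A" for q
    using equiv_class_eq[OF equiv_tensor_rel tensor_rel_scale[OF that]] by metis
  moreover have "p \<in> tensor_rel A `` {p}"
    using tensor_rel_refl[OF assms] by simp
  ultimately show ?thesis unfolding tensor_scale_def by blast
qed

text \<open>The element \<open>x \<otimes> s\<close> of \<open>A \<otimes> \<real>\<close>.\<close>

definition ray :: "'a monoid \<Rightarrow> real \<Rightarrow> 'a \<Rightarrow> ('a \<Rightarrow>\<^sub>0 real) set" where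
  "ray A s x = tensor_rel A `` {Poly_Mapping.single x s}"

lemma single_in_ray: "x \<in> carrier A \<Longrightarrow> Poly_Mapping.single x s \<in> ray A s x"
  by (simp add: ray_def tensor_rel_refl)

lemma ray_eqI:
  "(Poly_Mapping.single x s, Poly_Mapping.single y r) \<in> tensor_rel A \<Longrightarrow> ray A s x = ray A r y"
  unfolding ray_def by (rule equiv_class_eq[OF equiv_tensor_rel])

lemma tensor_scale_ray: "x \<in> carrier A \<Longrightarrow> tensor_scale A r (ray A s x) = ray A (r * s) x"
  unfolding ray_def by (subst tensor_scale_class) auto

lemma tensor_zero_eq_ray: "tensor_zero A = ray A 0 x"
  by (simp add: tensor_zero_def ray_def)

lemma ray_in_tensor_R: "x \<in> carrier A \<Longrightarrow> ray A s x \<in> tensor_R A"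
  unfolding ray_def tensor_R_def by (rule quotientI) auto

lemma ray_in_tensor_Q: "x \<in> carrier A \<Longrightarrow> s \<in> \<rat> \<Longrightarrow> ray A s x \<in> tensor_Q A"
  unfolding tensor_Q_def
  using ray_in_tensor_R[of x A s] single_in_ray[of x A s]
  by (auto intro!: bexI[of _ "Poly_Mapping.single x s"] simp: lookup_single when_def)

lemma linear_ext_ray:
  assumes "additive_on A \<phi>" "p \<in> ray A s x"
  shows "linear_ext \<phi> p = s * \<phi> x"
  using linear_ext_tensor_rel[OF assms(1), of "Poly_Mapping.single x s" p] assms(2)
  by (simp add: ray_def)

lemma ray_eqD:
  assumes "additive_on A \<phi>" "ray A s x = ray A r y" "x \<in> carrier A"
  shows "s * \<phi> x = r * \<phi> y"
  using linear_ext_ray[OF assms(1)] single_in_ray[OF assms(3)] assms(2) by metis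

section \<open>Inverses, powers and common denominators\<close>

lemma tensor_rel_one:
  fixes A (structure)
  assumes "group A"
  shows "(Poly_Mapping.single \<one>\<^bsub>A\<^esub> s, 0) \<in> tensor_rel A"
proof -
  interpret group A by fact
  have "(Poly_Mapping.single \<one> s, Poly_Mapping.single \<one> s + Poly_Mapping.single \<one> s) \<in> tensor_rel A"
    using tensor_rel_mult[of \<one> A \<one> s] by simp
  then have "Poly_Mapping.single \<one> s \<in> tensor_span A"
    using tensor_span_simps(3)[of "- Poly_Mapping.single \<one> s" A] by (simp add: tensor_rel_iff)
  then show ?thesis by (auto simp: tensor_rel_iff)
qed

lemma tensor_rel_inv:
  fixes A (structure)
  assumes "group A" "x \<in> carrier A"
  shows "(Poly_Mapping.single (inv\<^bsub>A\<^esub> x) s, Poly_Mapping.single x (- s)) \<in> tensor_rel A"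
proof -
  interpret group A by fact
  have "(Poly_Mapping.single (inv x) s + Poly_Mapping.single x s, 0) \<in> tensor_rel A"
    using tensor_rel_mult[of "inv x" A x s] tensor_rel_one[OF assms(1), of s] assms(2)
    by (auto intro: tensor_rel_trans tensor_rel_sym)
  from tensor_rel_add[OF this tensor_rel_refl[of "Poly_Mapping.single x (- s)"]]
  show ?thesis using assms(2) by (simp add: add.assoc single_add[symmetric])
qed

lemma ray_inv:
  assumes "group A" "x \<in> carrier A"
  shows "ray A s (inv\<^bsub>A\<^esub> x) = ray A (- s) x"
  by (rule ray_eqI) (rule tensor_rel_inv[OF assms])

lemma tensor_rel_nat_pow:
  fixes A (structure)
  assumes "group A" "x \<in> carrier A"
  shows "(Poly_Mapping.single (x [^]\<^bsub>A\<^esub> (n::nat)) s, Poly_Mapping.single x (n * s)) \<in> tensor_rel A"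
proof (induction n)
  case 0
  then show ?case using tensor_rel_one[OF assms(1)] by simp
next
  case (Suc n)
  interpret group A by fact
  have "(Poly_Mapping.single (x [^] n \<otimes> x) s, Poly_Mapping.single (x [^] n) s + Poly_Mapping.single x s) \<in> tensor_rel A"
    by (rule tensor_rel_mult) (use assms in auto)
  moreover have "(Poly_Mapping.single (x [^] n) s + Poly_Mapping.single x s, Poly_Mapping.single x (n * s) + Poly_Mapping.single x s) \<in> tensor_rel A"
    by (rule tensor_rel_add[OF Suc tensor_rel_refl]) (use assms in auto)
  ultimately show ?case
    by (auto intro: tensor_rel_trans simp: single_add[symmetric] algebra_simps)
qed

lemma tensor_rel_int_pow:
  fixes A (structure)
  assumes "group A" "x \<in> carrier A"
  shows "(Poly_Mapping.single (x [^]\<^bsub>A\<^esub> (z::int)) s, Poly_Mapping.single x (z * s)) \<in> tensor_rel A"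
proof (cases "z \<ge> 0")
  case True
  then show ?thesis
    using tensor_rel_nat_pow[OF assms, of "nat z" s] by (simp add: int_pow_def nat_pow_def)
next
  case False
  interpret group A by fact
  have "(Poly_Mapping.single (inv (x [^] nat (- z))) s, Poly_Mapping.single (x [^] nat (- z)) (- s)) \<in> tensor_rel A"
    by (rule tensor_rel_inv) (use assms in auto)
  moreover have "(Poly_Mapping.single (x [^] nat (- z)) (- s), Poly_Mapping.single x (z * s)) \<in> tensor_rel A"
    using tensor_rel_nat_pow[OF assms, of "nat (- z)" "- s"] False by simp
  ultimately show ?thesis
    using False tensor_rel_trans by (fastforce simp: int_pow_def nat_pow_def)
qed

text \<open>If the sum so far is \<open>x\<close> with coefficient \<open>1 / m\<close> and the next
  term is \<open>y\<close> with coefficient \<open>z / d\<close>, both coefficients are integral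
  multiples of \<open>1 / (d * m)\<close>, and the integers are absorbed into powers in the
  group.\<close>

lemma rational_tensor_rel_single:
  fixes A (structure)
  assumes A: "group A" and "finite K" "K \<subseteq> carrier A" "\<And>x. x \<in> K \<Longrightarrow> c x \<in> \<rat>"
  shows "\<exists>m x. m > 0 \<and> x \<in> carrier A \<and>
    (\<Sum>x\<in>K. Poly_Mapping.single x (c x), Poly_Mapping.single x (1 / real m)) \<in> tensor_rel A"
  using assms(2-)
proof (induction K rule: finite_induct)
  case empty
  interpret group A by fact
  show ?case
    using tensor_rel_sym[OF tensor_rel_one[OF A, of 1]] by (intro exI[of _ 1] exI[of _ \<one>]) auto
next
  case (insert y K)
  interpret group A by fact
  obtain m x where m: "m > 0" and x: "x \<in> carrier A"
    and rel: "(\<Sum>x\<in>K. Poly_Mapping.single x (c x), Poly_Mapping.single x (1 / real m)) \<in> tensor_rel A"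
    using insert by auto
  obtain z d where d: "d > 0" and c: "c y = real_of_int z / real_of_int d"
    using insert.prems(2)[of y] Rats_cases' by (metis insertI1)
  let ?s = "1 / real (nat d * m)"
  let ?y = "y [^] (z * int m)" and ?x = "x [^] nat d"
  have y: "y \<in> carrier A" using insert.prems(1) by simp
  have "(Poly_Mapping.single (?y \<otimes> ?x) ?s, Poly_Mapping.single ?y ?s + Poly_Mapping.single ?x ?s) \<in> tensor_rel A"
    by (rule tensor_rel_mult) (use x y in auto)
  also have "(Poly_Mapping.single ?y ?s + Poly_Mapping.single ?x ?s,
      Poly_Mapping.single y (of_int (z * int m) * ?s) + Poly_Mapping.single x (nat d * ?s)) \<in> tensor_rel A"
    by (rule tensor_rel_add[OF tensor_rel_int_pow[OF A y] tensor_rel_nat_pow[OF A x]])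
  also (tensor_rel_trans) have "of_int (z * int m) * ?s = c y"
    using m d by (simp add: c)
  also have "nat d * ?s = 1 / real m"
    using m d by simp
  also have "(Poly_Mapping.single y (c y) + Poly_Mapping.single x (1 / real m),
     Poly_Mapping.single y (c y) + (\<Sum>x\<in>K. Poly_Mapping.single x (c x))) \<in> tensor_rel A"
    by (rule tensor_rel_add[OF tensor_rel_refl tensor_rel_sym[OF rel]]) (use y in auto)
  finally (tensor_rel_trans) have "(Poly_Mapping.single (?y \<otimes> ?x) ?s,
     Poly_Mapping.single y (c y) + (\<Sum>x\<in>K. Poly_Mapping.single x (c x))) \<in> tensor_rel A" .
  then have "(\<Sum>x\<in>insert y K. Poly_Mapping.single x (c x), Poly_Mapping.single (?y \<otimes> ?x) ?s) \<in> tensor_rel A"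
    using insert.hyps by (simp add: tensor_rel_sym)
  moreover have "nat d * m > 0" using m d by simp
  moreover have "?y \<otimes> ?x \<in> carrier A" using x y by simp
  ultimately show ?case by blast
qed

text \<open>Makes rational points concrete: questions about them become questions about genuine
  elements of the group and a positive factor.\<close>

lemma tensor_Q_ray:
  assumes A: "group A" and "\<nu> \<in> tensor_Q A"
  shows "\<exists>s x. s > 0 \<and> s \<in> \<rat> \<and> x \<in> carrier A \<and> \<nu> = ray A s x"
proof -
  obtain p where \<nu>: "\<nu> \<in> tensor_R A" and p: "p \<in> \<nu>" "\<And>x. Poly_Mapping.lookup p x \<in> \<rat>"
    using assms(2) by (auto simp: tensor_Q_def)
  obtain q where q: "\<nu> = tensor_rel A `` {q}"
    using \<nu> by (auto simp: tensor_R_def quotient_def)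
  have qp: "(q, p) \<in> tensor_rel A" using p(1) q by simp
  have "p = (\<Sum>x\<in>Poly_Mapping.keys p. Poly_Mapping.single x (Poly_Mapping.lookup p x))"
    by (rule poly_mapping_eqI)
      (auto simp: lookup_sum lookup_single when_def in_keys_iff)
  then obtain m x where "m > 0" "x \<in> carrier A" and rel: "(p, Poly_Mapping.single x (1 / real m)) \<in> tensor_rel A"
    using rational_tensor_rel_single[OF A finite_keys, of p "Poly_Mapping.lookup p"] p(2) qp
    by (auto simp: tensor_rel_iff)
  moreover have "\<nu> = ray A (1 / real m) x"
    unfolding q ray_def
    by (rule equiv_class_eq[OF equiv_tensor_rel]) (rule tensor_rel_trans[OF qp rel])
  ultimately show ?thesis by (intro exI[of _ "1 / real m"] exI[of _ x]) auto
qed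


section \<open>Pairing of cocharacters and characters\<close>

lemma carrier_Y_grp [simp]: "carrier (Y_grp T) = cochars T"
  and mult_Y_grp [simp]: "l \<otimes>\<^bsub>Y_grp T\<^esub> m = cochar_mult l m"
  and carrier_X_grp [simp]: "carrier (X_grp T) = chars T"
  and mult_X_grp: "\<theta> \<otimes>\<^bsub>X_grp T\<^esub> \<psi> = (\<lambda>h. \<theta> h * \<psi> h)"
  by (simp_all add: Y_grp_def X_grp_def)

lemma laurent_det:
  assumes "\<And>i j. laurent (\<lambda>a. l a $ i $ j)"
  shows "laurent (\<lambda>a. det (l a))"
  unfolding det_def by (intro laurent_sum laurent_mult laurent_const laurent_prod assms)

lemma laurent_poly_fun:
  assumes "f \<in> poly_funs" "\<And>i j. laurent (\<lambda>a. l a $ i $ j)"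
  shows "laurent (\<lambda>a. f (l a))"
  using assms(1) by induction (auto intro: assms(2))

text \<open>The denominator of a regular function is a power of \<open>det\<close>. Along a
  cocharacter it is removed by \<open>1 / det (l a) = det (l (inverse a))\<close>, so
  \<open>\<theta> (l a)\<close> is a multiplicative Laurent polynomial in \<open>a\<close> and hence
  a power.\<close>

lemma pairing_power:
  fixes T :: "('k::alg_closed_field^'n::finite^'n) set"
  assumes T: "T \<subseteq> carrier GL" and l: "l \<in> cochars T" and \<theta>: "\<theta> \<in> chars T" and "a \<noteq> 0"
  shows "\<theta> (l a) = a powi pairing l \<theta>"
proof -
  obtain f m where f: "f \<in> poly_funs" and fm: "\<And>h. h \<in> T \<Longrightarrow> \<theta> h = f h / det h ^ m"
    using \<theta> by (auto simp: chars_def regular_funs_def)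
  have det: "det (l (inverse a)) = inverse (det (l a))" if "a \<noteq> 0" for a
  proof -
    have "det (l (inverse a)) * det (l a) = det (l (inverse a) ** l a)"
      by (simp only: det_mul)
    also have "l (inverse a) ** l a = mat 1"
      using cocharsD(3)[OF l, of "inverse a" a] that cochar_one[OF l T] by simp
    finally have "det (l (inverse a)) * det (l a) = 1" by simp
    then show ?thesis by (cases "det (l a) = 0") (auto simp: eq_divide_eq inverse_eq_divide)
  qed
  have "laurent (\<lambda>a. f (l a) * det (l (inverse a)) ^ m)"
    by (rule laurent_mult[OF laurent_poly_fun[OF f cocharsD(4)[OF l]]
          laurent_power[OF laurent_inverse_arg[OF laurent_det[OF cocharsD(4)[OF l]]]]])
  then have "laurent (\<lambda>a. \<theta> (l a))"
    by (rule laurent_cong[THEN iffD1, rotated])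
      (simp add: fm cocharsD(2)[OF l] det divide_inverse power_inverse)
  then have "\<exists>m. \<forall>a. a \<noteq> 0 \<longrightarrow> \<theta> (l a) = a powi m"
    by (rule laurent_multiplicative)
      (use \<theta> cocharsD(2,3)[OF l] in \<open>auto simp: chars_def\<close>)
  then obtain m where m: "\<forall>a. a \<noteq> 0 \<longrightarrow> \<theta> (l a) = a powi m" ..
  have "pairing l \<theta> = m"
    unfolding pairing_def using m power_int_eq_iff[where 'k='k] by (intro the_equality) auto
  then show ?thesis using m \<open>a \<noteq> 0\<close> by simp
qed

lemma pairing_eqI:
  fixes l :: "('k::alg_closed_field, 'n::finite) cochar"
  assumes "\<And>a. a \<noteq> 0 \<Longrightarrow> \<theta> (l a) = a powi m"
  shows "pairing l \<theta> = m"
  unfolding pairing_def using assms power_int_eq_iff[where 'k='k] by (intro the_equality) auto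

lemma additive_pairing_left:
  fixes T :: "('k::alg_closed_field^'n::finite^'n) set"
  assumes "T \<subseteq> carrier GL" "\<theta> \<in> chars T"
  shows "additive_on (Y_grp T) (\<lambda>l. pairing l \<theta>)"
  unfolding additive_on_def
proof (intro ballI)
  fix l m assume lm: "l \<in> carrier (Y_grp T)" "m \<in> carrier (Y_grp T)"
  have "\<theta> (l a ** m a) = \<theta> (l a) * \<theta> (m a)" if "a \<noteq> 0" for a
    using assms(2) cocharsD(2)[of l T a] cocharsD(2)[of m T a] lm that by (auto simp: chars_def)
  then have "pairing (cochar_mult l m) \<theta> = pairing l \<theta> + pairing m \<theta>"
    by (intro pairing_eqI) (use lm pairing_power[OF assms(1) _ assms(2)] in \<open>simp add: cochar_mult_def power_int_add\<close>)
  then show "real_of_int (pairing (l \<otimes>\<^bsub>Y_grp T\<^esub> m) \<theta>) = real_of_int (pairing l \<theta>) + real_of_int (pairing m \<theta>)"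
    by simp
qed

lemma additive_pairing_right:
  fixes T :: "('k::alg_closed_field^'n::finite^'n) set"
  assumes "T \<subseteq> carrier GL" "l \<in> cochars T"
  shows "additive_on (X_grp T) (\<lambda>\<theta>. pairing l \<theta>)"
  unfolding additive_on_def
proof (intro ballI)
  fix \<theta> \<psi> assume "\<theta> \<in> carrier (X_grp T)" "\<psi> \<in> carrier (X_grp T)"
  then have "pairing l (\<lambda>h. \<theta> h * \<psi> h) = pairing l \<theta> + pairing l \<psi>"
    by (intro pairing_eqI) (use pairing_power[OF assms] in \<open>simp add: power_int_add\<close>)
  then show "real_of_int (pairing l (\<theta> \<otimes>\<^bsub>X_grp T\<^esub> \<psi>)) = real_of_int (pairing l \<theta>) + real_of_int (pairing l \<psi>)"
    by (simp add: mult_X_grp)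
qed

lemma additive_linear_ext_pairing:
  fixes T :: "('k::alg_closed_field^'n::finite^'n) set"
  assumes T: "T \<subseteq> carrier GL" and q: "Poly_Mapping.keys q \<subseteq> chars T"
  shows "additive_on (Y_grp T) (\<lambda>l. linear_ext (\<lambda>\<theta>. pairing l \<theta>) q)"
  unfolding additive_on_def
proof (intro ballI)
  fix l m assume lm: "l \<in> carrier (Y_grp T)" "m \<in> carrier (Y_grp T)"
  have "linear_ext (\<lambda>\<theta>. pairing (cochar_mult l m) \<theta>) q = linear_ext (\<lambda>\<theta>. pairing l \<theta> + pairing m \<theta>) q"
    by (rule linear_ext_cong)
      (use additive_pairing_left[OF T] lm q in \<open>auto simp: additive_on_def\<close>)
  then show "linear_ext (\<lambda>\<theta>. pairing (l \<otimes>\<^bsub>Y_grp T\<^esub> m) \<theta>) q =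
      linear_ext (\<lambda>\<theta>. pairing l \<theta>) q + linear_ext (\<lambda>\<theta>. pairing m \<theta>) q"
    by (simp add: linear_ext_add_fun)
qed

lemma the_elem_constant_image:
  assumes "x \<in> A" "\<And>y. y \<in> A \<Longrightarrow> f y = c"
  shows "the_elem (f ` A) = c"
proof -
  have "f ` A = {c}" using assms by blast
  then show ?thesis by simp
qed

text \<open>The double sum is an iterated linear extension. The inner one is constant on the class
  of \<open>q\<close> because \<open>pairing\<close> is additive in characters, the outer one on the
  ray because the result is additive in cocharacters.\<close>

lemma pairing_R_ray:
  fixes T :: "('k::alg_closed_field^'n::finite^'n) set"
  assumes T: "T \<subseteq> carrier GL" and l: "l \<in> cochars T" and q: "Poly_Mapping.keys q \<subseteq> chars T"
  shows "pairing_R (ray (Y_grp T) s l) (tensor_rel (X_grp T) `` {q}) = s * linear_ext (\<lambda>\<theta>. pairing l \<theta>) q"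
  unfolding pairing_R_def
proof (rule the_elem_constant_image)
  show "(Poly_Mapping.single l s, q) \<in> ray (Y_grp T) s l \<times> tensor_rel (X_grp T) `` {q}"
    using single_in_ray[of l "Y_grp T" s] l tensor_rel_refl[of q "X_grp T"] q by simp
next
  fix pq' assume "pq' \<in> ray (Y_grp T) s l \<times> tensor_rel (X_grp T) `` {q}"
  then obtain p q' where pq': "pq' = (p, q')" and p: "p \<in> ray (Y_grp T) s l" and q': "(q, q') \<in> tensor_rel (X_grp T)"
    by auto
  have pT: "Poly_Mapping.keys p \<subseteq> cochars T"
    using p by (simp add: ray_def tensor_rel_iff)
  note add = additive_linear_ext_pairing[OF T q]
  have "(\<Sum>l\<in>Poly_Mapping.keys p. \<Sum>\<theta>\<in>Poly_Mapping.keys q'.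
      Poly_Mapping.lookup p l * Poly_Mapping.lookup q' \<theta> * of_int (pairing l \<theta>))
    = linear_ext (\<lambda>l. linear_ext (\<lambda>\<theta>. pairing l \<theta>) q') p"
    by (simp add: linear_ext_def sum_distrib_left mult.assoc)
  also have "\<dots> = linear_ext (\<lambda>l. linear_ext (\<lambda>\<theta>. pairing l \<theta>) q) p"
    by (rule linear_ext_cong)
      (use linear_ext_tensor_rel[OF additive_pairing_right[OF T] q'] pT in auto)
  also have "\<dots> = s * linear_ext (\<lambda>\<theta>. pairing l \<theta>) q"
    by (rule linear_ext_ray[OF add p])
  finally show "(case pq' of (p, q) \<Rightarrow> \<Sum>l\<in>Poly_Mapping.keys p. \<Sum>\<theta>\<in>Poly_Mapping.keys q.
      Poly_Mapping.lookup p l * Poly_Mapping.lookup q \<theta> * of_int (pairing l \<theta>)) = s * linear_ext (\<lambda>\<theta>. pairing l \<theta>) q"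
    by (simp add: pq')
qed

lemma pairing_R_ray_tensor_of:
  fixes T :: "('k::alg_closed_field^'n::finite^'n) set"
  assumes "T \<subseteq> carrier GL" "l \<in> cochars T" "\<theta> \<in> chars T"
  shows "pairing_R (ray (Y_grp T) s l) (tensor_of (X_grp T) \<theta>) = s * pairing l \<theta>"
  unfolding tensor_of_def using pairing_R_ray[OF assms(1,2), of "Poly_Mapping.single \<theta> 1" s] assms(3)
  by simp

text \<open>Strips off the characters: this is the form in which the inequalities of a polyhedral
  cone are used.\<close>

lemma pairing_R_additive:
  fixes T :: "('k::alg_closed_field^'n::finite^'n) set"
  assumes T: "T \<subseteq> carrier GL" and \<beta>: "\<beta> \<in> tensor_R (X_grp T)"
  shows "\<exists>\<phi>. additive_on (Y_grp T) \<phi> \<and> (\<forall>s. \<forall>l\<in>cochars T. pairing_R (ray (Y_grp T) s l) \<beta> = s * \<phi> l)"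
proof -
  obtain q where q: "Poly_Mapping.keys q \<subseteq> chars T" "\<beta> = tensor_rel (X_grp T) `` {q}"
    using \<beta> by (auto simp: tensor_R_def quotient_def)
  show ?thesis
    using additive_linear_ext_pairing[OF T q(1)] pairing_R_ray[OF T _ q(1)] unfolding q(2) by blast
qed


section \<open>Abelian matrix groups and their cocharacters\<close>

text \<open>This property passes directly to conjugates and so covers the conjugate tori that occur
  inside the classes of \<open>Y_R\<close>.\<close>

definition abelian_subgroup :: "('k::field^'n::finite^'n) set \<Rightarrow> bool" where
  "abelian_subgroup T \<longleftrightarrow> subgroup T GL \<and> (\<forall>s\<in>T. \<forall>t\<in>T. s ** t = t ** s)"

lemma abelian_subgroupD:
  assumes "abelian_subgroup T"
  shows "T \<subseteq> carrier GL" "s \<in> T \<Longrightarrow> t \<in> T \<Longrightarrow> s ** t = t ** s" "mat 1 \<in> T"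
    "s \<in> T \<Longrightarrow> t \<in> T \<Longrightarrow> s ** t \<in> T"
  using assms subgroup.subset[of T GL] subgroup.one_closed[of T GL] subgroup.m_closed[of T GL]
  unfolding abelian_subgroup_def by auto

lemma diag_torus_commute:
  assumes "a \<in> diag_torus J" "b \<in> diag_torus J"
  shows "a ** b = b ** a"
proof -
  have "(\<Sum>k\<in>UNIV. a $ i $ k * b $ k $ j) = (\<Sum>k\<in>UNIV. b $ i $ k * a $ k $ j)" for i j
  proof (rule sum.cong[OF refl])
    fix k
    show "a $ i $ k * b $ k $ j = b $ i $ k * a $ k $ j"
      using assms unfolding diag_torus_def by (cases "k = i"; cases "k = j") auto
  qed
  then show ?thesis by (simp add: matrix_matrix_mult_def)
qed

lemma torus_abelian:
  fixes T :: "('k::field^'n::finite^'n) set"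
  assumes "torus T"
  shows "abelian_subgroup T"
proof -
  obtain J :: "'n set" and \<phi> :: "'k^'n^'n \<Rightarrow> 'k^'n^'n" where
    \<phi>: "\<phi> \<in> iso (GL\<lparr>carrier := diag_torus J\<rparr>) (GL\<lparr>carrier := T\<rparr>)"
    using assms unfolding torus_def alg_iso_def by blast
  have im: "T = \<phi> ` diag_torus J"
    using \<phi> by (simp add: iso_def bij_betw_def)
  have "s ** t = t ** s" if st: "s \<in> T" "t \<in> T" for s t
  proof -
    obtain a b where ab: "a \<in> diag_torus J" "s = \<phi> a" "b \<in> diag_torus J" "t = \<phi> b"
      using im st by blast
    have "\<phi> (a ** b) = \<phi> a ** \<phi> b" "\<phi> (b ** a) = \<phi> b ** \<phi> a"
      using \<phi> ab by (auto simp: iso_def hom_def)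
    then show ?thesis using diag_torus_commute[OF ab(1,3)] ab by simp
  qed
  then show ?thesis
    using assms by (auto simp: abelian_subgroup_def torus_def closed_subgroup_def)
qed

lemma abelian_subgroup_conj:
  fixes x :: "'k::field^'n::finite^'n"
  assumes T: "abelian_subgroup T" and x: "invertible x"
  shows "abelian_subgroup (mconj x ` T)"
proof -
  have inv: "invertible t" if "t \<in> T" for t
    using abelian_subgroupD(1)[OF T] that by auto
  have "subgroup (mconj x ` T) GL"
  proof (rule group.subgroupI[OF group_GL])
    show "mconj x ` T \<subseteq> carrier GL"
      using inv x by (auto simp: mconj_def invertible_mult invertible_matrix_inv)
    show "mconj x ` T \<noteq> {}" using abelian_subgroupD(3)[OF T] by auto
    fix a assume "a \<in> mconj x ` T"
    then obtain t where t: "t \<in> T" "a = mconj x t" by blast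
    have t': "matrix_inv t \<in> T"
      using T t subgroup.m_inv_closed[of T GL t] inv_GL[OF inv[OF t(1)]] by (simp add: abelian_subgroup_def)
    have "mconj x (matrix_inv t) ** mconj x t = mat 1"
      using x inv[OF t(1)] by (simp add: mconj_mult[symmetric] matrix_inv_left)
    then have "inv\<^bsub>GL\<^esub> a = mconj x (matrix_inv t)"
      using inv[OF t(1)] x unfolding t(2)
      by (intro group.inv_equality[OF group_GL]) (auto simp: mconj_def invertible_mult invertible_matrix_inv)
    then show "inv\<^bsub>GL\<^esub> a \<in> mconj x ` T" using t' by blast
  next
    fix a b assume "a \<in> mconj x ` T" "b \<in> mconj x ` T"
    then show "a \<otimes>\<^bsub>GL\<^esub> b \<in> mconj x ` T"
      using abelian_subgroupD(4)[OF T] x by (auto simp: mconj_mult[symmetric])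
  qed
  moreover have "a ** b = b ** a" if "a \<in> mconj x ` T" "b \<in> mconj x ` T" for a b
    using that abelian_subgroupD(2)[OF T] x by (auto simp: mconj_mult[symmetric])
  ultimately show ?thesis by (simp add: abelian_subgroup_def)
qed

lemma cocharsI:
  assumes "l 0 = 0" "\<And>a. a \<noteq> 0 \<Longrightarrow> l a \<in> T" "\<And>a b. a \<noteq> 0 \<Longrightarrow> b \<noteq> 0 \<Longrightarrow> l (a * b) = l a ** l b"
    "\<And>i j. laurent (\<lambda>a. l a $ i $ j)"
  shows "l \<in> cochars T"
  using assms unfolding cochars_def laurent_def by auto

lemma cochar_mult_in_cochars:
  assumes T: "abelian_subgroup T" and l: "l \<in> cochars T" and m: "m \<in> cochars T"
  shows "cochar_mult l m \<in> cochars T"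
proof (rule cocharsI)
  show "cochar_mult l m 0 = 0"
    using cocharsD(1)[OF l] cocharsD(1)[OF m] by (simp add: cochar_mult_def)
  show "cochar_mult l m a \<in> T" if "a \<noteq> 0" for a
    using abelian_subgroupD(4)[OF T cocharsD(2)[OF l that] cocharsD(2)[OF m that]] by (simp add: cochar_mult_def)
  show "cochar_mult l m (a * b) = cochar_mult l m a ** cochar_mult l m b" if a: "a \<noteq> 0" and b: "b \<noteq> 0" for a b
  proof -
    have "l a ** l b ** (m a ** m b) = l a ** (l b ** m a) ** m b"
      by (simp add: matrix_mul_assoc)
    also have "l b ** m a = m a ** l b"
      by (rule abelian_subgroupD(2)[OF T cocharsD(2)[OF l b] cocharsD(2)[OF m a]])
    finally show ?thesis
      using cocharsD(3)[OF l a b] cocharsD(3)[OF m a b] by (simp add: cochar_mult_def matrix_mul_assoc)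
  qed
  show "laurent (\<lambda>a. cochar_mult l m a $ i $ j)" for i j
    unfolding cochar_mult_def matrix_matrix_mult_def
    by (simp only: vec_lambda_beta) (rule laurent_sum laurent_mult cocharsD(4)[OF l] cocharsD(4)[OF m])+
qed

lemma one_Y_grp: "\<one>\<^bsub>Y_grp T\<^esub> = (\<lambda>a. if a = 0 then 0 else mat 1)"
  by (simp add: Y_grp_def)

lemma one_in_cochars:
  assumes "abelian_subgroup T"
  shows "\<one>\<^bsub>Y_grp T\<^esub> \<in> cochars T"
proof (rule cocharsI)
  fix i j
  show "laurent (\<lambda>a. \<one>\<^bsub>Y_grp T\<^esub> a $ i $ j)"
    by (rule laurent_cong[THEN iffD1, OF _ laurent_const[of "mat 1 $ i $ j"]]) (simp add: one_Y_grp)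
qed (use abelian_subgroupD(3)[OF assms] in \<open>auto simp: one_Y_grp\<close>)

lemma group_Y_grp:
  fixes T :: "('k::field^'n::finite^'n) set"
  assumes T: "abelian_subgroup T"
  shows "group (Y_grp T)"
proof (rule groupI)
  fix l assume "l \<in> carrier (Y_grp T)"
  then have l: "l \<in> cochars T" by simp
  show "\<one>\<^bsub>Y_grp T\<^esub> \<otimes>\<^bsub>Y_grp T\<^esub> l = l"
    using cocharsD(1)[OF l] by (auto simp: one_Y_grp cochar_mult_def)
  define l' where "l' = (\<lambda>a. if a = 0 then 0 else l (inverse a))"
  have "l' \<in> cochars T"
  proof (rule cocharsI)
    show "laurent (\<lambda>a. l' a $ i $ j)" for i j
      by (rule laurent_cong[THEN iffD1, OF _ laurent_inverse_arg[OF cocharsD(4)[OF l, of i j]]]) (simp add: l'_def)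
  qed (use cocharsD(2,3)[OF l] in \<open>auto simp: l'_def\<close>)
  moreover have "cochar_mult l' l = \<one>\<^bsub>Y_grp T\<^esub>"
  proof
    fix a
    show "cochar_mult l' l a = \<one>\<^bsub>Y_grp T\<^esub> a"
      using cocharsD(3)[OF l, of "inverse a" a] cochar_one[OF l abelian_subgroupD(1)[OF T]]
      by (auto simp: one_Y_grp cochar_mult_def l'_def)
  qed
  ultimately show "\<exists>y\<in>carrier (Y_grp T). y \<otimes>\<^bsub>Y_grp T\<^esub> l = \<one>\<^bsub>Y_grp T\<^esub>" by auto
qed (use cochar_mult_in_cochars[OF T] one_in_cochars[OF T] in \<open>auto simp: cochar_mult_def matrix_mul_assoc\<close>)

lemma cochars_mono: "T \<subseteq> G \<Longrightarrow> cochars T \<subseteq> cochars G"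
  unfolding cochars_def by auto


section \<open>Conjugation on \<open>Y\<^sub>T(\<real>)\<close>\<close>

text \<open>The map on single representatives whose image on a class is \<open>rcochar_conj\<close>.
  Linearity and composition are read off entrywise from \<open>lookup_push\<close>.\<close>

definition push :: "'k::field^'n::finite^'n \<Rightarrow> (('k, 'n) cochar \<Rightarrow>\<^sub>0 real) \<Rightarrow> (('k, 'n) cochar \<Rightarrow>\<^sub>0 real)" where
  "push x p = (\<Sum>l\<in>Poly_Mapping.keys p. Poly_Mapping.single (cochar_conj x l) (Poly_Mapping.lookup p l))"

lemma rcochar_conj_eq: "rcochar_conj x \<nu> = push x ` \<nu>"
  by (simp add: rcochar_conj_def push_def image_def)

lemma cochar_conj_eq_iff:
  assumes "invertible (x :: 'k::field^'n::finite^'n)"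
  shows "cochar_conj x l = m \<longleftrightarrow> l = cochar_conj (matrix_inv x) m"
  using cochar_conj_inverse[OF assms] by metis

lemma lookup_push:
  assumes "invertible (x :: 'k::field^'n::finite^'n)"
  shows "Poly_Mapping.lookup (push x p) m = Poly_Mapping.lookup p (cochar_conj (matrix_inv x) m)"
  using assms by (simp add: push_def lookup_sum lookup_single when_def cochar_conj_eq_iff in_keys_iff)

lemma keys_push:
  assumes "invertible (x :: 'k::field^'n::finite^'n)" "Poly_Mapping.keys p \<subseteq> cochars T"
  shows "Poly_Mapping.keys (push x p) \<subseteq> cochars (mconj x ` T)"
proof
  fix m assume "m \<in> Poly_Mapping.keys (push x p)"
  then have "cochar_conj (matrix_inv x) m \<in> cochars T"
    using assms by (auto simp: in_keys_iff lookup_push)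
  then show "m \<in> cochars (mconj x ` T)"
    using cochar_conj_in_cochars[OF _ assms(1)] cochar_conj_inverse(2)[OF assms(1)] by metis
qed

lemma push_push:
  assumes "invertible (x :: 'k::field^'n::finite^'n)" "invertible y"
  shows "push x (push y p) = push (x ** y) p"
  by (rule poly_mapping_eqI)
    (simp add: lookup_push assms invertible_mult matrix_inv_mult invertible_matrix_inv cochar_conj_cochar_conj)

lemma push_one [simp]: "push (mat 1 :: 'k::field^'n::finite^'n) p = p"
  by (rule poly_mapping_eqI) (simp add: lookup_push matrix_inv_one)

lemma push_single [simp]: "push x (Poly_Mapping.single l s) = Poly_Mapping.single (cochar_conj x l) s"
  by (simp add: push_def)

text \<open>Conjugation is a homomorphism of cocharacter groups, so it sends the generating
  relations for \<open>T\<close> to relations for the conjugate.\<close>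

lemma tensor_rel_push:
  fixes x :: "'k::field^'n::finite^'n"
  assumes x: "invertible x" and pq: "(p, q) \<in> tensor_rel (Y_grp T)"
  shows "(push x p, push x q) \<in> tensor_rel (Y_grp (mconj x ` T))"
proof -
  let ?S = "tensor_span (Y_grp (mconj x ` T))"
  have lin: "push x (p + q) = push x p + push x q" "push x (p - q) = push x p - push x q"
    "push x 0 = 0" "push x (rscale r p) = rscale r (push x p)" for p q r
    by (auto intro!: poly_mapping_eqI simp: lookup_push[OF x] lookup_add lookup_minus)
  have "tensor_span (Y_grp T) \<subseteq> {d. push x d \<in> ?S}"
    unfolding tensor_span_def[of "Y_grp T"]
  proof (rule module.span_minimal[OF module_rscale], safe)
    fix l m assume "l \<in> carrier (Y_grp T)" "m \<in> carrier (Y_grp T)"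
    then have "cochar_conj x l \<in> carrier (Y_grp (mconj x ` T))" "cochar_conj x m \<in> carrier (Y_grp (mconj x ` T))"
      using cochar_conj_in_cochars[OF _ x] by auto
    then show "push x (Poly_Mapping.single (l \<otimes>\<^bsub>Y_grp T\<^esub> m) 1 - Poly_Mapping.single l 1 - Poly_Mapping.single m 1) \<in> ?S"
      unfolding tensor_span_def lin push_single mult_Y_grp cochar_conj_mult[OF x]
      by (intro module.span_base[OF module_rscale]) auto
  next
    show "module.subspace rscale {d. push x d \<in> ?S}"
      using tensor_span_simps by (auto simp: module.subspace_def[OF module_rscale] lin)
  qed
  then have "push x p - push x q \<in> ?S"
    using pq by (auto simp: tensor_rel_iff lin[symmetric])
  then show ?thesis
    using pq keys_push[OF x] by (simp add: tensor_rel_iff)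
qed

text \<open>Compatibility with \<open>tensor_rel\<close> only places the image inside the target
  class; pushing back with the inverse shows that it fills the class.\<close>

lemma rcochar_conj_ray:
  fixes x :: "'k::field^'n::finite^'n"
  assumes x: "invertible x"
  shows "rcochar_conj x (ray (Y_grp T) s l) = ray (Y_grp (mconj x ` T)) s (cochar_conj x l)"
proof (intro equalityI subsetI)
  fix q assume "q \<in> rcochar_conj x (ray (Y_grp T) s l)"
  then show "q \<in> ray (Y_grp (mconj x ` T)) s (cochar_conj x l)"
    using tensor_rel_push[OF x, of "Poly_Mapping.single l s"] by (auto simp: rcochar_conj_eq ray_def)
next
  fix q assume "q \<in> ray (Y_grp (mconj x ` T)) s (cochar_conj x l)"
  then have "push (matrix_inv x) q \<in> ray (Y_grp T) s l"
    using tensor_rel_push[OF invertible_matrix_inv[OF x], of "Poly_Mapping.single (cochar_conj x l) s" q "mconj x ` T"]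
    by (simp add: ray_def cochar_conj_inverse mconj_image_inverse x)
  moreover have "q = push x (push (matrix_inv x) q)"
    by (simp add: push_push x invertible_matrix_inv matrix_inv_right)
  ultimately show "q \<in> rcochar_conj x (ray (Y_grp T) s l)"
    unfolding rcochar_conj_eq by blast
qed


section \<open>The norm of a ray\<close>

text \<open>The part of \<open>cochar_norm\<close> that determines the norms of rays in one torus,
  phrased so that it can be carried to conjugates.\<close>

definition normed :: "(('k::field, 'n::finite) cochar \<Rightarrow> real) \<Rightarrow> ('k^'n^'n) set \<Rightarrow> bool" where
  "normed N T \<longleftrightarrow> (\<forall>l\<in>cochars T. N l \<ge> 0) \<and> (\<exists>B :: ('k, 'n) cochar \<Rightarrow> ('k, 'n) cochar \<Rightarrow> int.
        (\<forall>l\<in>cochars T. \<forall>l'\<in>cochars T. \<forall>m\<in>cochars T.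
            B (cochar_mult l l') m = B l m + B l' m \<and> B m (cochar_mult l l') = B m l + B m l') \<and>
        (\<forall>l\<in>cochars T. (N l)\<^sup>2 = of_int (B l l)))"

lemma normed_max_torus:
  assumes "cochar_norm G N" "max_torus G T"
  shows "normed N T"
proof -
  have "\<forall>l\<in>cochars T. N l \<ge> 0"
    using assms cochars_mono[of T G] by (auto simp: cochar_norm_def max_torus_def)
  moreover have "\<exists>B :: ('a, 'b) cochar \<Rightarrow> ('a, 'b) cochar \<Rightarrow> int.
        (\<forall>l\<in>cochars T. \<forall>l'\<in>cochars T. \<forall>m\<in>cochars T.
            B (cochar_mult l l') m = B l m + B l' m \<and> B m (cochar_mult l l') = B m l + B m l') \<and>
        (\<forall>l\<in>cochars T. (N l)\<^sup>2 = of_int (B l l))"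
    using assms unfolding cochar_norm_def by (elim conjE allE[of _ T] impE) blast+
  ultimately show ?thesis unfolding normed_def by blast
qed

lemma normed_conj:
  fixes x :: "'k::field^'n::finite^'n"
  assumes "normed N T" and x: "invertible x" and N: "\<And>l. l \<in> cochars T \<Longrightarrow> N (cochar_conj x l) = N l"
  shows "normed N (mconj x ` T)"
proof -
  let ?c = "cochar_conj (matrix_inv x)"
  have c: "?c l \<in> cochars T" if "l \<in> cochars (mconj x ` T)" for l
    using cochar_conj_in_cochars[OF that invertible_matrix_inv[OF x]] by (simp add: mconj_image_inverse x)
  have Nc: "N (?c l) = N l" if "l \<in> cochars (mconj x ` T)" for l
    using N[OF c[OF that]] by (simp add: cochar_conj_inverse x)
  obtain B :: "('k, 'n) cochar \<Rightarrow> ('k, 'n) cochar \<Rightarrow> int" where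
    B: "\<And>l l' m. l \<in> cochars T \<Longrightarrow> l' \<in> cochars T \<Longrightarrow> m \<in> cochars T \<Longrightarrow>
            B (cochar_mult l l') m = B l m + B l' m \<and> B m (cochar_mult l l') = B m l + B m l'"
    and NB: "\<And>l. l \<in> cochars T \<Longrightarrow> (N l)\<^sup>2 = of_int (B l l)" and N0: "\<And>l. l \<in> cochars T \<Longrightarrow> N l \<ge> 0"
    using assms(1) unfolding normed_def by blast
  show ?thesis
    unfolding normed_def
  proof (intro conjI ballI exI[of _ "\<lambda>l m. B (?c l) (?c m)"])
    fix l assume l: "l \<in> cochars (mconj x ` T)"
    show "N l \<ge> 0" using N0[OF c[OF l]] Nc[OF l] by simp
    show "(N l)\<^sup>2 = of_int (B (?c l) (?c l))" using NB[OF c[OF l]] Nc[OF l] by simp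
  next
    fix l l' m assume "l \<in> cochars (mconj x ` T)" "l' \<in> cochars (mconj x ` T)" "m \<in> cochars (mconj x ` T)"
    note B = B[OF this[THEN c]]
    show "B (?c (cochar_mult l l')) (?c m) = B (?c l) (?c m) + B (?c l') (?c m)"
      "B (?c m) (?c (cochar_mult l l')) = B (?c m) (?c l) + B (?c m) (?c l')"
      using B by (simp_all add: cochar_conj_mult[OF invertible_matrix_inv[OF x]])
  qed
qed

text \<open>By polarisation \<open>norm_form\<close> is the symmetrised form \<open>B\<close>,
  additive in each argument, so the double sum equals \<open>(s * N l)^2\<close> on the whole class.
  Non-negativity of \<open>s\<close> and \<open>N l\<close> settles the sign of the root.\<close>

lemma rcochar_norm_ray:
  fixes T :: "('k::field^'n::finite^'n) set"
  assumes T: "abelian_subgroup T" and "normed N T" and l: "l \<in> cochars T" and s: "s \<ge> 0"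
  shows "rcochar_norm N (ray (Y_grp T) s l) = s * N l"
  unfolding rcochar_norm_def
proof (rule the_elem_constant_image)
  show "Poly_Mapping.single l s \<in> ray (Y_grp T) s l"
    by (simp add: single_in_ray l)
  fix p assume p: "p \<in> ray (Y_grp T) s l"
  have pT: "Poly_Mapping.keys p \<subseteq> cochars T"
    using p by (simp add: ray_def tensor_rel_iff)
  obtain B :: "('k, 'n) cochar \<Rightarrow> ('k, 'n) cochar \<Rightarrow> int" where
    B: "\<And>l l' m. l \<in> cochars T \<Longrightarrow> l' \<in> cochars T \<Longrightarrow> m \<in> cochars T \<Longrightarrow>
            B (cochar_mult l l') m = B l m + B l' m \<and> B m (cochar_mult l l') = B m l + B m l'"
    and NB: "\<And>l. l \<in> cochars T \<Longrightarrow> (N l)\<^sup>2 = of_int (B l l)" and N0: "\<And>l. l \<in> cochars T \<Longrightarrow> N l \<ge> 0"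
    using assms(2) unfolding normed_def by blast
  have form: "norm_form N l m = (B l m + B m l) / 2" if "l \<in> cochars T" "m \<in> cochars T" for l m
    using that NB B cochar_mult_in_cochars[OF T that] by (simp add: norm_form_def)
  have add: "additive_on (Y_grp T) (\<lambda>l. norm_form N l m)" "additive_on (Y_grp T) (\<lambda>l. norm_form N m l)"
    if "m \<in> cochars T" for m
    using that B cochar_mult_in_cochars[OF T] unfolding additive_on_def by (auto simp: form add_divide_distrib)
  have "(\<Sum>l\<in>Poly_Mapping.keys p. \<Sum>m\<in>Poly_Mapping.keys p.
      Poly_Mapping.lookup p l * Poly_Mapping.lookup p m * norm_form N l m)
    = linear_ext (\<lambda>l. linear_ext (\<lambda>m. norm_form N l m) p) p"
    by (simp add: linear_ext_def sum_distrib_left mult.assoc)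
  also have "\<dots> = linear_ext (\<lambda>l'. s * norm_form N l' l) p"
    by (rule linear_ext_cong) (use linear_ext_ray[OF add(2) p] pT in auto)
  also have "\<dots> = s * (s * norm_form N l l)"
    by (rule linear_ext_ray[OF _ p]) (use add(1)[OF l] in \<open>auto simp: additive_on_def algebra_simps\<close>)
  also have "\<dots> = (s * N l)\<^sup>2"
    using NB[OF l] form[OF l l] by (simp add: power2_eq_square)
  finally show "sqrt (\<Sum>l\<in>Poly_Mapping.keys p. \<Sum>m\<in>Poly_Mapping.keys p.
      Poly_Mapping.lookup p l * Poly_Mapping.lookup p m * norm_form N l m) = s * N l"
    using s N0[OF l] by simp
qed


section \<open>Parabolic subgroups preserve filtrations\<close>

text \<open>With \<open>m\<close> the pairing of \<open>l\<close> and \<open>\<alpha>\<close> one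
  has \<open>l a ** u x = u (a ^ m * x) ** l a\<close>; for non-negative \<open>m\<close> the factor
  \<open>u (a ^ m * x)\<close> is polynomial in \<open>a\<close>.\<close>

lemma root_group_filt:
  fixes T :: "('k::alg_closed_field^'n::finite^'n) set"
  assumes T: "T \<subseteq> carrier GL" and l: "l \<in> cochars T" and \<alpha>: "\<alpha> \<in> chars T"
    and U: "root_group G T \<alpha> U" and pos: "pairing l \<alpha> \<ge> 0" and g: "g \<in> U" and v: "v \<in> filt l r"
  shows "g *v v \<in> filt l r"
proof -
  obtain u where u: "\<And>i j. \<exists>p. \<forall>x. u x $ i $ j = poly p x" "range u = U"
    "\<And>t x. t \<in> T \<Longrightarrow> mconj t (u x) = u (\<alpha> t * x)"
    using U unfolding root_group_def by metis
  obtain x where x: "g = u x" using u(2) g by blast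
  define m where "m = nat (pairing l \<alpha>)"
  show ?thesis
  proof (rule filt_transport[OF v])
    fix i j
    obtain p where p: "\<And>x. u x $ i $ j = poly p x" using u(1) by metis
    have "u (a ^ m * x) $ i $ j = poly (pcompose p (monom x m)) a" for a
      by (simp add: p poly_pcompose poly_monom mult.commute)
    then show "\<exists>p. \<forall>a. a \<noteq> 0 \<longrightarrow> u (a ^ m * x) $ i $ j = poly p a" by blast
  next
    fix a :: 'k assume a: "a \<noteq> 0"
    have inv: "invertible (l a)" using cocharsD(2)[OF l a] T by auto
    have "l a ** u x ** matrix_inv (l a) = u (a ^ m * x)"
      using u(3)[OF cocharsD(2)[OF l a], of x] pairing_power[OF T l \<alpha> a] pos
      by (simp add: mconj_def m_def power_int_nonneg_exp)
    then have "u (a ^ m * x) ** l a = l a ** u x ** (matrix_inv (l a) ** l a)"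
      by (simp add: matrix_mul_assoc)
    then show "l a *v (g *v v) = u (a ^ m * x) *v (l a *v v)"
      using inv by (simp add: x matrix_vector_mul_assoc matrix_inv_left)
  qed
qed

lemma abelian_filt:
  assumes T: "abelian_subgroup T" and l: "l \<in> cochars T" and t: "t \<in> T" and v: "v \<in> filt l r"
  shows "t *v v \<in> filt l r"
proof (rule filt_transport[OF v])
  show "\<exists>p. \<forall>a. a \<noteq> 0 \<longrightarrow> t $ i $ j = poly p a" for i j
    by (rule exI[of _ "[:t $ i $ j:]"]) simp
  show "l a *v (t *v v) = t *v (l a *v v)" if "a \<noteq> 0" for a
    using abelian_subgroupD(2)[OF T cocharsD(2)[OF l that] t] by (simp add: matrix_vector_mul_assoc)
qed

section \<open>Subgroups generated by a torus and root groups\<close>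

lemma parabolic_generators_subset:
  assumes "T \<subseteq> carrier GL"
  shows "T \<union> \<Union>{U. \<exists>\<alpha>\<in>roots G T. root_group G T \<alpha> U \<and> Q \<alpha>} \<subseteq> carrier GL"
  using assms subgroup.subset[of _ GL] by (fastforce simp: root_group_def closed_subgroup_def)

lemma subgroup_parabolic: "T \<subseteq> carrier GL \<Longrightarrow> subgroup (parabolic G T \<nu>) GL"
  unfolding parabolic_def
  by (rule group.generate_is_subgroup[OF group_GL]) (rule parabolic_generators_subset)

lemma levi_subset_parabolic: "T \<subseteq> carrier GL \<Longrightarrow> levi G T \<nu> \<subseteq> parabolic G T \<nu>"
  unfolding levi_def parabolic_def by (rule group.mono_generate[OF group_GL]) fastforce

lemma subgroup_levi: "T \<subseteq> carrier GL \<Longrightarrow> subgroup (levi G T \<nu>) GL"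
  unfolding levi_def
  by (rule group.generate_is_subgroup[OF group_GL]) (rule parabolic_generators_subset)

lemma parabolic_subset:
  assumes "subgroup G GL" "T \<subseteq> G"
  shows "parabolic G T \<nu> \<subseteq> G"
  unfolding parabolic_def
  by (rule group.generate_subgroup_incl[OF group_GL _ assms(1)]) (use assms(2) in \<open>auto simp: root_group_def\<close>)

lemma parabolic_filt_subset:
  fixes T :: "('k::alg_closed_field^'n::finite^'n) set"
  assumes T: "abelian_subgroup T" and l: "l \<in> cochars T" and s: "s > 0"
    and h: "h \<in> parabolic G T (ray (Y_grp T) s l)" and v: "v \<in> filt l r"
  shows "h *v v \<in> filt l r"
proof -
  let ?K = "T \<union> \<Union>{U. \<exists>\<alpha>\<in>roots G T. root_group G T \<alpha> U \<and>
    pairing_R (ray (Y_grp T) s l) (tensor_of (X_grp T) \<alpha>) \<ge> 0}"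
  have TG: "T \<subseteq> carrier GL" by (rule abelian_subgroupD(1)[OF T])
  have K: "g *v v \<in> filt l r" if gK: "g \<in> ?K" and vf: "v \<in> filt l r" for g v
  proof (cases "g \<in> T")
    case True
    then show ?thesis using abelian_filt[OF T l _ vf] by blast
  next
    case False
    then obtain U \<alpha> where U: "\<alpha> \<in> roots G T" "root_group G T \<alpha> U" "g \<in> U"
      and pos: "pairing_R (ray (Y_grp T) s l) (tensor_of (X_grp T) \<alpha>) \<ge> 0"
      using gK by blast
    have \<alpha>: "\<alpha> \<in> chars T" using U(1) by (simp add: roots_def)
    have "pairing l \<alpha> \<ge> 0"
      using pos s by (simp add: pairing_R_ray_tensor_of[OF TG l \<alpha>] zero_le_mult_iff)
    then show ?thesis
      using root_group_filt[OF TG l \<alpha> U(2) _ U(3) vf] by blast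
  qed
  \<comment> \<open>The generating set is closed under inverses, which reduces the inverse case of
    \<open>generate\<close> to that of generators.\<close>
  have Kinv: "inv\<^bsub>GL\<^esub> g \<in> ?K" if gK: "g \<in> ?K" for g
  proof (cases "g \<in> T")
    case True
    then show ?thesis
      using T subgroup.m_inv_closed[of T GL g] unfolding abelian_subgroup_def by blast
  next
    case False
    then obtain U \<alpha> where U: "\<alpha> \<in> roots G T" "root_group G T \<alpha> U" "g \<in> U"
      "pairing_R (ray (Y_grp T) s l) (tensor_of (X_grp T) \<alpha>) \<ge> 0"
      using gK by blast
    then have "inv\<^bsub>GL\<^esub> g \<in> U"
      using subgroup.m_inv_closed[of U GL g] by (simp add: root_group_def closed_subgroup_def)
    then show ?thesis using U by blast
  qed
  have "\<forall>v\<in>filt l r. h *v v \<in> filt l r"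
    using h unfolding parabolic_def
  proof (induction rule: generate.induct)
    case one
    then show ?case by simp
  next
    case (incl h)
    then show ?case using K by blast
  next
    case (inv h)
    then show ?case using K[OF Kinv] by blast
  next
    case (eng h1 h2)
    then show ?case by (simp add: matrix_vector_mul_assoc[symmetric])
  qed
  then show ?thesis using v by blast
qed

lemma parabolic_filt:
  fixes T :: "('k::alg_closed_field^'n::finite^'n) set"
  assumes T: "abelian_subgroup T" and l: "l \<in> cochars T" and s: "s > 0"
    and h: "h \<in> parabolic G T (ray (Y_grp T) s l)"
  shows "(*v) h ` filt l r = filt l r"
proof
  have P: "subgroup (parabolic G T (ray (Y_grp T) s l)) GL"
    by (rule subgroup_parabolic[OF abelian_subgroupD(1)[OF T]])
  have inv: "invertible h" using subgroup.mem_carrier[OF P h] by simp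
  have h': "matrix_inv h \<in> parabolic G T (ray (Y_grp T) s l)"
    using subgroup.m_inv_closed[OF P h] by (simp add: inv_GL inv)
  show "(*v) h ` filt l r \<subseteq> filt l r"
    using parabolic_filt_subset[OF T l s h] by blast
  show "filt l r \<subseteq> (*v) h ` filt l r"
  proof
    fix v assume "v \<in> filt l r"
    then have "matrix_inv h *v v \<in> filt l r"
      by (rule parabolic_filt_subset[OF T l s h'])
    moreover have "v = h *v (matrix_inv h *v v)"
      by (simp add: matrix_vector_mul_assoc matrix_inv_right inv)
    ultimately show "v \<in> (*v) h ` filt l r" by blast
  qed
qed

section \<open>The identity element in the unipotent radical\<close>

lemma zariski_topspace: "topspace (zariski :: ('k::field^'n::finite^'n) topology) = carrier GL"
proof -
  have "carrier GL \<in> {{A \<in> carrier GL. f A \<noteq> 0} | f. f \<in> (poly_funs :: ('k^'n^'n \<Rightarrow> 'k) set)}"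
    by (intro CollectI exI[of _ "\<lambda>A. 1"] conjI poly_funs.const) auto
  then show ?thesis unfolding zariski_def topology_generated_by_topspace by blast
qed

lemma closedin_zariski_one: "closedin zariski {mat 1 :: 'k::field^'n::finite^'n}"
proof -
  \<comment> \<open>The complement of the identity is the union of the loci where one given entry
    differs from that of \<open>mat 1\<close>.\<close>
  define U where "U = (\<lambda>(i, j). {A \<in> carrier GL. A $ i $ j + - (mat 1 :: 'k^'n^'n) $ i $ j \<noteq> 0})"
  have "openin zariski (U ij)" for ij
    unfolding zariski_def U_def
    by (cases ij, rule topology_generated_by_Basis)
      (auto intro!: exI[of _ "\<lambda>A. A $ _ $ _ + - mat 1 $ _ $ _"] poly_funs.intros)
  then have "openin zariski (\<Union>ij. U ij)" by blast
  moreover have "(\<Union>ij. U ij) = topspace zariski - {mat 1}"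
    by (auto simp: zariski_topspace U_def vec_eq_iff)
  ultimately show ?thesis by (simp add: closedin_def zariski_topspace)
qed

text \<open>The trivial subgroup is the witness in the union. The purpose is to show that the class
  formed by \<open>V_proj\<close> has an element.\<close>

lemma one_in_unipotent_radical:
  fixes H :: "('k::field^'n::finite^'n) set"
  assumes "subgroup H GL"
  shows "mat 1 \<in> unipotent_radical H"
proof -
  have "group (GL\<lparr>carrier := H\<rparr>)"
    by (rule subgroup.subgroup_is_group[OF assms group_GL])
  then have "{mat 1} \<lhd> GL\<lparr>carrier := H\<rparr>"
    using group.one_is_normal[of "GL\<lparr>carrier := H\<rparr>"] by simp
  moreover have "connectedin zariski {mat 1 :: 'k^'n^'n}"
    by (simp add: connectedin_sing zariski_topspace)
  moreover have "unipotent (mat 1 :: 'k^'n^'n)"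
    unfolding unipotent_def by (rule exI[of _ 1]) simp
  ultimately show ?thesis
    unfolding unipotent_radical_def using closedin_zariski_one by blast
qed

lemma unipotent_radical_subset: "unipotent_radical H \<subseteq> H"
proof -
  have "R \<subseteq> H" if "R \<lhd> GL\<lparr>carrier := H\<rparr>" for R
    using subgroup.subset[OF normal_imp_subgroup[OF that]] by simp
  then show ?thesis unfolding unipotent_radical_def by blast
qed


section \<open>Points of the building\<close>

lemma levi_ray:
  fixes T :: "('k::alg_closed_field^'n::finite^'n) set"
  assumes T: "T \<subseteq> carrier GL" and l: "l \<in> cochars T" and s: "s > 0" and r: "r > 0"
  shows "levi G T (ray (Y_grp T) s l) = levi G T (ray (Y_grp T) r l)"
proof -
  have "pairing_R (ray (Y_grp T) s l) (tensor_of (X_grp T) \<alpha>) = 0 \<longleftrightarrow>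
      pairing_R (ray (Y_grp T) r l) (tensor_of (X_grp T) \<alpha>) = 0" if "\<alpha> \<in> roots G T" for \<alpha>
    using that s r by (simp add: roots_def pairing_R_ray_tensor_of[OF T l])
  then have "{U. \<exists>\<alpha>\<in>roots G T. root_group G T \<alpha> U \<and> pairing_R (ray (Y_grp T) s l) (tensor_of (X_grp T) \<alpha>) = 0}
    = {U. \<exists>\<alpha>\<in>roots G T. root_group G T \<alpha> U \<and> pairing_R (ray (Y_grp T) r l) (tensor_of (X_grp T) \<alpha>) = 0}"
    by blast
  then show ?thesis unfolding levi_def by simp
qed

lemma Y_point_eq:
  assumes "max_torus G T" "\<nu> \<in> tensor_R (Y_grp T)"
  shows "Y_point G T \<nu> = (\<lambda>x. (mconj x ` T, rcochar_conj x \<nu>)) ` levi G T \<nu>"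
  unfolding Y_point_def Y_rel_def using assms by auto

locale normed_group =
  fixes G :: "('k::alg_closed_field^'n::finite^'n) set" and N :: "('k, 'n) cochar \<Rightarrow> real"
  assumes subgroup_G: "subgroup G GL" and cochar_norm: "cochar_norm G N"
begin

lemma max_torusD:
  assumes "max_torus G T"
  shows "abelian_subgroup T" "T \<subseteq> G" "T \<subseteq> carrier GL" "group (Y_grp T)"
  using assms torus_abelian[of T] abelian_subgroupD(1)[of T] group_Y_grp[of T] unfolding max_torus_def by auto

lemma invertible_G: "g \<in> G \<Longrightarrow> invertible g"
  using subgroup.mem_carrier[OF subgroup_G] by simp

lemma parabolic_conj_subset:
  assumes "max_torus G T" "x \<in> G"
  shows "parabolic G (mconj x ` T) \<nu> \<subseteq> G"
proof (rule parabolic_subset[OF subgroup_G])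
  have "matrix_inv x \<in> G"
    using subgroup.m_inv_closed[OF subgroup_G assms(2)] by (simp add: inv_GL invertible_G assms(2))
  then show "mconj x ` T \<subseteq> G"
    using max_torusD(2)[OF assms(1)] assms(2) subgroup.m_closed[OF subgroup_G]
    by (fastforce simp: mconj_def)
qed

lemma levi_subset: "max_torus G T \<Longrightarrow> levi G T \<nu> \<subseteq> G"
  using levi_subset_parabolic[OF max_torusD(3)] parabolic_subset[OF subgroup_G max_torusD(2)] by blast

lemma one_in_levi: "max_torus G T \<Longrightarrow> mat 1 \<in> levi G T \<nu>"
  using subgroup.one_closed[OF subgroup_levi[OF max_torusD(3)]] by simp

lemma Y_point_ray_iff:
  assumes "max_torus G T" "l \<in> cochars T"
  shows "(T', \<nu>') \<in> Y_point G T (ray (Y_grp T) s l) \<longleftrightarrow> (\<exists>x\<in>levi G T (ray (Y_grp T) s l).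
    T' = mconj x ` T \<and> \<nu>' = ray (Y_grp (mconj x ` T)) s (cochar_conj x l))"
proof -
  have "rcochar_conj x (ray (Y_grp T) s l) = ray (Y_grp (mconj x ` T)) s (cochar_conj x l)"
    if "x \<in> levi G T (ray (Y_grp T) s l)" for x
    using levi_subset[OF assms(1)] that by (intro rcochar_conj_ray invertible_G) auto
  then show ?thesis
    using assms by (auto simp: Y_point_eq ray_in_tensor_R)
qed

lemma self_in_Y_point:
  assumes "max_torus G T" "l \<in> cochars T"
  shows "(T, ray (Y_grp T) s l) \<in> Y_point G T (ray (Y_grp T) s l)"
  unfolding Y_point_ray_iff[OF assms] using one_in_levi[OF assms(1)] by (auto intro!: bexI[of _ "mat 1"])

lemma N_conj:
  assumes "max_torus G T" "l \<in> cochars T" "x \<in> G"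
  shows "N (cochar_conj x l) = N l"
  using assms cochar_norm cochars_mono[OF max_torusD(2)] unfolding cochar_norm_def by blast

lemma N_pos:
  assumes "max_torus G T" "l \<in> cochars T" "l \<noteq> \<one>\<^bsub>Y_grp T\<^esub>"
  shows "N l > 0"
proof -
  obtain B :: "('k, 'n) cochar \<Rightarrow> ('k, 'n) cochar \<Rightarrow> int" where
    "\<forall>l\<in>cochars T. l \<noteq> \<one>\<^bsub>Y_grp T\<^esub> \<longrightarrow> B l l > 0" "\<forall>l\<in>cochars T. (N l)\<^sup>2 = of_int (B l l)"
    using cochar_norm assms(1) unfolding cochar_norm_def by metis
  then have "(N l)\<^sup>2 > 0" using assms by simp
  moreover have "N l \<ge> 0"
    using normed_max_torus[OF cochar_norm assms(1)] assms(2) by (simp add: normed_def)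
  ultimately show ?thesis by simp
qed

text \<open>Levi conjugates of \<open>l\<close> have the same length by invariance of
  \<open>N\<close>, so the norm is constant on the class.\<close>

lemma Y_norm_ray:
  assumes T: "max_torus G T" and l: "l \<in> cochars T" and s: "s \<ge> 0"
  shows "Y_norm N (Y_point G T (ray (Y_grp T) s l)) = s * N l"
  unfolding Y_norm_def
proof (rule the_elem_constant_image)
  show "(T, ray (Y_grp T) s l) \<in> Y_point G T (ray (Y_grp T) s l)"
    by (rule self_in_Y_point[OF T l])
next
  fix y assume "y \<in> Y_point G T (ray (Y_grp T) s l)"
  then obtain x where x: "x \<in> levi G T (ray (Y_grp T) s l)"
    and y: "y = (mconj x ` T, ray (Y_grp (mconj x ` T)) s (cochar_conj x l))"
    using Y_point_ray_iff[OF T l] by (cases y) auto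
  have xG: "x \<in> G" using x levi_subset[OF T] by blast
  note inv = invertible_G[OF xG]
  have "rcochar_norm N (ray (Y_grp (mconj x ` T)) s (cochar_conj x l)) = s * N (cochar_conj x l)"
    using N_conj[OF T _ xG]
    by (intro rcochar_norm_ray abelian_subgroup_conj normed_conj normed_max_torus[OF cochar_norm]
        cochar_conj_in_cochars max_torusD inv T l s)
  then show "(case y of (T, \<nu>) \<Rightarrow> rcochar_norm N \<nu>) = s * N l"
    using N_conj[OF T l xG] by (simp add: y)
qed

lemma Y_scale_ray:
  assumes T: "max_torus G T" and l: "l \<in> cochars T" and s: "s > 0" and r: "r > 0"
  shows "Y_scale r (Y_point G T (ray (Y_grp T) s l)) = Y_point G T (ray (Y_grp T) (r * s) l)"
proof -
  let ?L = "levi G T (ray (Y_grp T) s l)"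
  have L: "levi G T (ray (Y_grp T) (r * s) l) = ?L"
    by (rule levi_ray[OF max_torusD(3)[OF T] l]) (use s r in auto)
  have eq: "(mconj x ` T, tensor_scale (Y_grp (mconj x ` T)) r (rcochar_conj x (ray (Y_grp T) s l))) =
     (mconj x ` T, rcochar_conj x (ray (Y_grp T) (r * s) l))" if "x \<in> ?L" for x
  proof -
    have "invertible x" using that levi_subset[OF T] invertible_G by blast
    then show ?thesis
      by (simp add: rcochar_conj_ray tensor_scale_ray cochar_conj_in_cochars l)
  qed
  show ?thesis
    unfolding Y_scale_def Y_point_eq[OF T ray_in_tensor_R[of l "Y_grp T", unfolded carrier_Y_grp, OF l]] L image_image prod.case
    by (rule image_cong[OF refl eq])
qed

text \<open>The factor \<open>s\<close> cancels against the norm \<open>s * N l\<close>: the point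
  of the building sees only the direction.\<close>

lemma zeta_T_ray:
  assumes T: "max_torus G T" and l: "l \<in> cochars T" and s: "s > 0" and l1: "l \<noteq> \<one>\<^bsub>Y_grp T\<^esub>"
  shows "zeta_T G N T (ray (Y_grp T) s l) = V_proj G (Y_point G T (ray (Y_grp T) (1 / N l) l))"
proof -
  have "N l > 0" by (rule N_pos[OF T l l1])
  then show ?thesis
    using s unfolding zeta_T_def zeta_def
    by (simp add: Y_norm_ray[OF T l] Y_scale_ray[OF T l])
qed

lemma Y_point_in_Y_R:
  assumes "max_torus G T" "\<nu> \<in> tensor_R (Y_grp T)"
  shows "Y_point G T \<nu> \<in> Y_R G"
  unfolding Y_point_def Y_R_def by (rule quotientI) (use assms in auto)

text \<open>Equality of two points of the building is an equality of sets; a nonempty member lets a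
  concrete torus and vector be extracted from it.\<close>

lemma V_proj_nonempty:
  assumes T: "max_torus G T" and l: "l \<in> cochars T"
  shows "\<exists>z\<in>V_proj G (Y_point G T (ray (Y_grp T) s l)). z \<noteq> {}"
proof -
  let ?y = "Y_point G T (ray (Y_grp T) s l)"
  have self: "(T, ray (Y_grp T) s l) \<in> ?y" by (rule self_in_Y_point[OF T l])
  have "?y \<in> Y_R G"
    by (rule Y_point_in_Y_R[OF T]) (simp add: ray_in_tensor_R l)
  moreover have "mat 1 \<in> unipotent_radical (parabolic G T (ray (Y_grp T) s l))"
    by (rule one_in_unipotent_radical[OF subgroup_parabolic[OF max_torusD(3)[OF T]]])
  ultimately have "Y_act (mat 1) ?y \<in> V_proj G ?y"
    using self unfolding V_proj_def V_rel_def by blast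
  moreover have "Y_act (mat 1) ?y \<noteq> {}"
    using self unfolding Y_act_def by blast
  ultimately show ?thesis by blast
qed

text \<open>A point of \<open>V(\<real>)\<close> determines the filtrations of its representatives.\<close>

lemma V_proj_filt:
  assumes T: "max_torus G T" and l0: "l0 \<in> cochars T" and s0: "s0 > 0"
    and z: "z \<in> V_proj G (Y_point G T (ray (Y_grp T) s0 l0))" and e: "(T'', \<nu>'') \<in> z"
  shows "\<exists>h\<in>G. T'' = mconj h ` T \<and> \<nu>'' = rcochar_conj h (ray (Y_grp T) s0 l0) \<and>
    (\<forall>s l r. s > 0 \<longrightarrow> l \<in> cochars T \<longrightarrow> ray (Y_grp T) s0 l0 = ray (Y_grp T) s l \<longrightarrow> (*v) h ` filt l r = filt l r)"
proof -
  let ?\<nu> = "ray (Y_grp T) s0 l0"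
  let ?y = "Y_point G T ?\<nu>"
  have \<nu>: "?\<nu> \<in> tensor_R (Y_grp T)" by (simp add: ray_in_tensor_R l0)
  note y = Y_point_eq[OF T \<nu>]
  obtain u T' \<nu>' where z_eq: "z = Y_act u ?y" and "(T', \<nu>') \<in> ?y"
    and u: "u \<in> unipotent_radical (parabolic G T' \<nu>')"
    using z unfolding V_proj_def V_rel_def by blast
  then obtain x where x: "x \<in> levi G T ?\<nu>" "T' = mconj x ` T" "\<nu>' = rcochar_conj x ?\<nu>"
    unfolding y by blast
  \<comment> \<open>Two unrelated Levi elements occur: \<open>x\<close> leads to the pair whose
    parabolic subgroup contains \<open>u\<close>, and \<open>w\<close> to the pair that
    \<open>u\<close> moves to \<open>(T'', \<nu>'')\<close>.\<close>
  obtain w where w: "w \<in> levi G T ?\<nu>" "T'' = mconj u ` mconj w ` T" "\<nu>'' = rcochar_conj u (rcochar_conj w ?\<nu>)"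
    using e unfolding z_eq Y_act_def y by auto
  have G: "x \<in> G" "w \<in> G" using x(1) w(1) levi_subset[OF T] by blast+
  have uP: "u \<in> parabolic G T' \<nu>'" using u unipotent_radical_subset by blast
  then have uG: "u \<in> G" using parabolic_conj_subset[OF T G(1)] x(2) by blast
  note inv = invertible_G[OF G(1)] invertible_G[OF G(2)] invertible_G[OF uG]
  show ?thesis
  proof (intro bexI[of _ "u ** w"] conjI allI impI)
    show "u ** w \<in> G" using subgroup.m_closed[OF subgroup_G uG G(2)] by simp
    show "T'' = mconj (u ** w) ` T"
      using inv by (simp add: w(2) image_image mconj_mconj)
    show "\<nu>'' = rcochar_conj (u ** w) ?\<nu>"
      using inv by (simp add: w(3) rcochar_conj_eq image_image push_push)
    fix s :: real and l r assume s: "s > 0" and l: "l \<in> cochars T" and eq: "?\<nu> = ray (Y_grp T) s l"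
    have levi: "(*v) g ` filt l r = filt l r" if "g \<in> levi G T ?\<nu>" for g r
    proof (rule parabolic_filt[OF max_torusD(1)[OF T] l s])
      show "g \<in> parabolic G T (ray (Y_grp T) s l)"
        using that levi_subset_parabolic[OF max_torusD(3)[OF T]] unfolding eq by blast
    qed
    \<comment> \<open>As an element of the parabolic subgroup of the pair conjugated by
      \<open>x\<close>, \<open>u\<close> preserves the filtration of \<open>cochar_conj x l\<close>.
      That filtration is the one of \<open>l\<close>, because \<open>x\<close> preserves the
      latter.\<close>
    have "\<nu>' = ray (Y_grp T') s (cochar_conj x l)"
      unfolding x eq by (rule rcochar_conj_ray[OF inv(1)])
    moreover have "abelian_subgroup T'"
      unfolding x by (rule abelian_subgroup_conj[OF max_torusD(1)[OF T] inv(1)])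
    moreover have "cochar_conj x l \<in> cochars T'"
      unfolding x by (rule cochar_conj_in_cochars[OF l inv(1)])
    ultimately have "(*v) u ` filt (cochar_conj x l) r = filt (cochar_conj x l) r"
      using parabolic_filt s uP by metis
    then have "(*v) u ` filt l r = filt l r"
      unfolding filt_conj[OF inv(1)] levi[OF x(1)] .
    then show "(*v) (u ** w) ` filt l r = filt l r"
      using levi[OF w(1), of r] by (simp add: matrix_vector_mul_assoc[symmetric] image_image[symmetric])
  qed
qed

text \<open>Zero is expressed by membership of the formal combination \<open>0\<close>, a condition
  that does not mention the torus: the element of \<open>Y_zero\<close> may come from a torus other
  than \<open>T\<close>.\<close>

lemma Y_point_in_Y_zero:
  assumes T: "max_torus G T" and l: "l \<in> cochars T" and "Y_point G T (ray (Y_grp T) s l) \<in> Y_zero G"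
  shows "0 \<in> ray (Y_grp T) s l"
proof -
  obtain T' where T': "max_torus G T'"
    and eq: "Y_point G T (ray (Y_grp T) s l) = Y_point G T' (tensor_zero (Y_grp T'))"
    using assms(3) unfolding Y_zero_def by blast
  let ?o = "\<one>\<^bsub>Y_grp T'\<^esub>"
  have o: "?o \<in> cochars T'" by (rule one_in_cochars[OF max_torusD(1)[OF T']])
  have "(T, ray (Y_grp T) s l) \<in> Y_point G T' (ray (Y_grp T') 0 ?o)"
    using self_in_Y_point[OF T l, of s] unfolding eq tensor_zero_eq_ray[of _ ?o] .
  then obtain x where x: "ray (Y_grp T) s l = ray (Y_grp (mconj x ` T')) 0 (cochar_conj x ?o)"
    unfolding Y_point_ray_iff[OF T' o] by auto
  show ?thesis
    unfolding x tensor_zero_eq_ray[symmetric] by (simp add: tensor_zero_def tensor_rel_refl)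
qed

end


section \<open>Polyhedral cones in one apartment\<close>

locale cone_in_apartment = normed_group G N
  for G :: "('k::alg_closed_field^'n::finite^'n) set" and N :: "('k, 'n) cochar \<Rightarrow> real" +
  fixes T :: "('k^'n^'n) set" and \<Sigma> :: "('k, 'n) vpoint set"
    and P :: "'k^'n^'n" and w :: "('k, 'n) cochar \<Rightarrow> int^'n"
  assumes T: "max_torus G T" and apartment: "\<Sigma> \<subseteq> apartment G N T"
    and polyhedral: "polyhedral_cone T (cone_T G N \<Sigma> T)"
    and P: "invertible P" and w: "\<And>l. l \<in> cochars T \<Longrightarrow> weights P l (w l)"
begin

abbreviation "C \<equiv> cone_T G N \<Sigma> T"
abbreviation "rayT \<equiv> ray (Y_grp T)"

text \<open>The integral points of the cone. Through \<open>w\<close> they embed into integer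
  vectors, where spheres are finite.\<close>

definition "M = {l \<in> cochars T. rayT 1 l \<in> C}"

sublocale Y: group "Y_grp T" by (rule max_torusD(4)[OF T])

lemma one_in_T: "\<one>\<^bsub>Y_grp T\<^esub> \<in> cochars T"
  using Y.one_closed by simp

lemma w_mult:
  assumes "l \<in> cochars T" "m \<in> cochars T"
  shows "w (cochar_mult l m) = w l + w m"
proof -
  have "cochar_mult l m \<in> cochars T" using Y.m_closed assms by simp
  then show ?thesis
    using weights_unique[OF P w weights_mult[OF w w]] assms by blast
qed

lemma w_one: "w \<one>\<^bsub>Y_grp T\<^esub> = 0"
proof -
  have "w \<one>\<^bsub>Y_grp T\<^esub> = w \<one>\<^bsub>Y_grp T\<^esub> + w \<one>\<^bsub>Y_grp T\<^esub>"
    using w_mult[OF one_in_T one_in_T] Y.l_one[OF Y.one_closed] by (simp only: mult_Y_grp)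
  then show ?thesis by (metis add_cancel_right_right)
qed

lemma w_inv:
  assumes "l \<in> cochars T"
  shows "w (inv\<^bsub>Y_grp T\<^esub> l) = - w l"
proof -
  have "inv\<^bsub>Y_grp T\<^esub> l \<in> cochars T" using Y.inv_closed assms by simp
  from w_mult[OF this assms] show ?thesis
    using Y.l_inv[of l] assms w_one by (simp add: eq_neg_iff_add_eq_0)
qed

lemma w_inj:
  assumes "l \<in> cochars T" "m \<in> cochars T" "w l = w m"
  shows "l = m"
proof (rule weights_inj[OF P])
  show "weights P l (w m)" using w[OF assms(1)] assms(3) by simp
  show "weights P m (w m)" by (rule w[OF assms(2)])
  show "l 0 = m 0" using cocharsD(1)[OF assms(1)] cocharsD(1)[OF assms(2)] by simp
qed

lemma additive_w: "additive_on (Y_grp T) (\<lambda>l. of_int (w l $ i))"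
  by (simp add: additive_on_def w_mult)

lemma ray_eq_w:
  assumes "rayT s l = rayT r m" "l \<in> cochars T"
  shows "s * of_int (w l $ i) = r * of_int (w m $ i)"
  using ray_eqD[OF additive_w assms(1)] assms(2) by simp

lemma ray_zero_imp_one:
  assumes "0 \<in> rayT s l" "s > 0" "l \<in> cochars T"
  shows "l = \<one>\<^bsub>Y_grp T\<^esub>"
proof -
  have "w l $ i = 0" for i
    using linear_ext_ray[OF additive_w assms(1), of i] assms(2) by simp
  then have "w l = 0" by (simp add: vec_eq_iff)
  then show ?thesis using w_inj[OF assms(3) one_in_T] w_one by simp
qed

lemma ray_in_nonzero_Q:
  assumes "s \<in> \<rat>" "s > 0" "l \<in> cochars T" "l \<noteq> \<one>\<^bsub>Y_grp T\<^esub>"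
  shows "rayT s l \<in> nonzero_Q T"
proof -
  have "0 \<in> tensor_zero (Y_grp T)" by (simp add: tensor_zero_def tensor_rel_refl)
  then show ?thesis
    using ray_zero_imp_one[of s l] ray_in_tensor_Q[of l "Y_grp T" s] assms by (auto simp: nonzero_Q_def)
qed

section \<open>Points of \<open>\<Sigma>\<close> as rays of the cone\<close>

lemma zeta_T_in_Sigma:
  assumes "rayT s l \<in> C" "s > 0" "l \<in> cochars T" "l \<noteq> \<one>\<^bsub>Y_grp T\<^esub>"
  shows "zeta_T G N T (rayT s l) \<in> \<Sigma>"
proof -
  have "Y_point G T (rayT s l) \<notin> Y_zero G"
    using Y_point_in_Y_zero[OF T assms(3)] ray_zero_imp_one[OF _ assms(2,3)] assms(4) by blast
  then show ?thesis
    using assms(1) by (auto simp: cone_T_def zeta_cone_def zeta_T_def)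
qed

lemma Sigma_ray:
  assumes "x \<in> \<Sigma>"
  shows "\<exists>s l. s > 0 \<and> s \<in> \<rat> \<and> l \<in> cochars T \<and> l \<noteq> \<one>\<^bsub>Y_grp T\<^esub> \<and> rayT s l \<in> C \<and> x = zeta_T G N T (rayT s l)"
proof -
  obtain \<nu> where \<nu>: "\<nu> \<in> tensor_Q (Y_grp T)" "\<nu> \<noteq> tensor_zero (Y_grp T)" and x: "x = zeta_T G N T \<nu>"
    using assms apartment by (auto simp: apartment_def nonzero_Q_def)
  obtain s l where s: "s > 0" "s \<in> \<rat>" and l: "l \<in> cochars T" and eq: "\<nu> = rayT s l"
    using tensor_Q_ray[OF Y.is_group \<nu>(1)] by auto
  have l1: "l \<noteq> \<one>\<^bsub>Y_grp T\<^esub>"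
    using \<nu>(2) equiv_class_eq[OF equiv_tensor_rel tensor_rel_one[OF Y.is_group, of s]]
    unfolding eq tensor_zero_def ray_def by blast
  have "Y_point G T \<nu> \<notin> Y_zero G"
    using Y_point_in_Y_zero[OF T l] ray_zero_imp_one[OF _ s(1) l] l1 unfolding eq by blast
  moreover have "Y_point G T \<nu> \<in> Y_Q G"
    using T \<nu>(1) unfolding Y_Q_def by blast
  ultimately have "\<nu> \<in> C"
    using \<nu>(1) assms x by (simp add: cone_T_def zeta_cone_def zeta_T_def)
  then show ?thesis using s l l1 x eq by blast
qed

text \<open>The inequalities of the cone become conditions on the cocharacter alone, independent of
  the positive factor \<open>s\<close>. Closure of \<open>M\<close> under products and the passage
  between multiples of a vector come from this.\<close>

lemma M_functionals:
  "\<exists>\<Phi>. (\<forall>\<phi>\<in>\<Phi>. additive_on (Y_grp T) \<phi>) \<and>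
    (\<forall>s l. s > 0 \<longrightarrow> l \<in> cochars T \<longrightarrow> rayT s l \<in> tensor_Q (Y_grp T) \<longrightarrow> (rayT s l \<in> C \<longleftrightarrow> (\<forall>\<phi>\<in>\<Phi>. \<phi> l \<ge> 0)))"
proof -
  obtain D where D: "D \<subseteq> tensor_Q (X_grp T)"
    and C: "C = {\<nu> \<in> tensor_Q (Y_grp T). \<forall>\<beta>\<in>D. pairing_R \<nu> \<beta> \<ge> 0}"
    using polyhedral unfolding polyhedral_cone_def by blast
  have "\<exists>\<phi>. additive_on (Y_grp T) \<phi> \<and> (\<forall>s. \<forall>l\<in>cochars T. pairing_R (rayT s l) \<beta> = s * \<phi> l)" if "\<beta> \<in> D" for \<beta>
    using pairing_R_additive[OF max_torusD(3)[OF T]] that D by (auto simp: tensor_Q_def)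
  then obtain \<phi> where \<phi>: "\<And>\<beta>. \<beta> \<in> D \<Longrightarrow> additive_on (Y_grp T) (\<phi> \<beta>)"
    "\<And>\<beta> s l. \<beta> \<in> D \<Longrightarrow> l \<in> cochars T \<Longrightarrow> pairing_R (rayT s l) \<beta> = s * \<phi> \<beta> l"
    by metis
  show ?thesis
    by (rule exI[of _ "\<phi> ` D"]) (auto simp: \<phi> C zero_le_mult_iff)
qed

lemma ray_in_C_iff:
  assumes "s > 0" "l \<in> cochars T" "rayT s l \<in> tensor_Q (Y_grp T)"
  shows "rayT s l \<in> C \<longleftrightarrow> l \<in> M"
  using M_functionals assms ray_in_tensor_Q[of l "Y_grp T" 1] unfolding M_def by auto

lemma ray_in_C_imp_M:
  assumes "s > 0" "l \<in> cochars T" "rayT s l \<in> C"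
  shows "l \<in> M"
  using ray_in_C_iff[OF assms(1,2)] assms(3) by (simp add: cone_T_def)

lemma one_in_M: "\<one>\<^bsub>Y_grp T\<^esub> \<in> M"
proof -
  obtain \<Phi> where \<Phi>: "\<And>\<phi>. \<phi> \<in> \<Phi> \<Longrightarrow> additive_on (Y_grp T) \<phi>"
    and C: "\<And>s l. s > 0 \<Longrightarrow> l \<in> cochars T \<Longrightarrow> rayT s l \<in> tensor_Q (Y_grp T) \<Longrightarrow> rayT s l \<in> C \<longleftrightarrow> (\<forall>\<phi>\<in>\<Phi>. \<phi> l \<ge> 0)"
    using M_functionals by metis
  have "\<phi> \<one>\<^bsub>Y_grp T\<^esub> = 0" if "\<phi> \<in> \<Phi>" for \<phi>
    using \<Phi>[OF that] Y.one_closed Y.l_one[OF Y.one_closed] unfolding additive_on_def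
    by (metis add_cancel_right_right)
  then have "\<forall>\<phi>\<in>\<Phi>. \<phi> \<one>\<^bsub>Y_grp T\<^esub> \<ge> 0" by (metis order_refl)
  then show ?thesis
    using C[of 1 "\<one>\<^bsub>Y_grp T\<^esub>"] one_in_T ray_in_tensor_Q[of _ "Y_grp T" 1] by (simp add: M_def)
qed

lemma mult_in_M:
  assumes "l \<in> M" "m \<in> M"
  shows "cochar_mult l m \<in> M"
proof -
  obtain \<Phi> where \<Phi>: "\<And>\<phi>. \<phi> \<in> \<Phi> \<Longrightarrow> additive_on (Y_grp T) \<phi>"
    and C: "\<And>s l. s > 0 \<Longrightarrow> l \<in> cochars T \<Longrightarrow> rayT s l \<in> tensor_Q (Y_grp T) \<Longrightarrow> rayT s l \<in> C \<longleftrightarrow> (\<forall>\<phi>\<in>\<Phi>. \<phi> l \<ge> 0)"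
    using M_functionals by metis
  have M: "l \<in> M \<longleftrightarrow> l \<in> cochars T \<and> (\<forall>\<phi>\<in>\<Phi>. \<phi> l \<ge> 0)" for l
    using C[of 1 l] ray_in_tensor_Q[of l "Y_grp T" 1] by (auto simp: M_def)
  have "\<phi> (cochar_mult l m) = \<phi> l + \<phi> m" if "\<phi> \<in> \<Phi>" for \<phi>
    using \<Phi>[OF that] assms by (simp add: additive_on_def M)
  then have "\<phi> (cochar_mult l m) \<ge> 0" if "\<phi> \<in> \<Phi>" for \<phi>
    using assms that unfolding M by (metis add_nonneg_nonneg)
  then show ?thesis
    using assms Y.m_closed[of l m] unfolding M by simp
qed

text \<open>A point of \<open>\<Sigma>\<close> without an opposite in \<open>\<Sigma>\<close>
  supplies \<open>l\<close>: were the inverse of \<open>l\<close> in \<open>M\<close>, the ray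
  through it would give such an opposite.\<close>

lemma inv_notin_M:
  assumes "\<not> completely_reducible G N \<Sigma>"
  shows "\<exists>l\<in>M. inv\<^bsub>Y_grp T\<^esub> l \<notin> M"
proof -
  obtain x where x: "x \<in> \<Sigma>" and no: "\<And>y. y \<in> \<Sigma> \<Longrightarrow> \<not> opposite G N x y"
    using assms unfolding completely_reducible_def by blast
  obtain s l where s: "s > 0" "s \<in> \<rat>" and l: "l \<in> cochars T" and l1: "l \<noteq> \<one>\<^bsub>Y_grp T\<^esub>"
    and C: "rayT s l \<in> C" and eq: "x = zeta_T G N T (rayT s l)"
    using Sigma_ray[OF x] by blast
  have "inv\<^bsub>Y_grp T\<^esub> l \<notin> M"
  proof
    assume M: "inv\<^bsub>Y_grp T\<^esub> l \<in> M"
    have il: "inv\<^bsub>Y_grp T\<^esub> l \<in> cochars T" using M by (simp add: M_def)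
    have il1: "inv\<^bsub>Y_grp T\<^esub> l \<noteq> \<one>\<^bsub>Y_grp T\<^esub>" using l l1 by (simp add: Y.inv_eq_1_iff)
    \<comment> \<open>Keeping the factor \<open>s\<close> makes this vector exactly
      \<open>- 1\<close> times the original one.\<close>
    let ?\<mu> = "rayT s (inv\<^bsub>Y_grp T\<^esub> l)"
    have "?\<mu> \<in> C"
      using ray_in_C_iff[OF s(1) il] M ray_in_tensor_Q[of "inv\<^bsub>Y_grp T\<^esub> l" "Y_grp T" s] il s(2) by simp
    then have "zeta_T G N T ?\<mu> \<in> \<Sigma>" by (rule zeta_T_in_Sigma[OF _ s(1) il il1])
    moreover have "opposite G N x (zeta_T G N T ?\<mu>)"
      unfolding opposite_def
    proof (intro exI conjI)
      show "?\<mu> = tensor_scale (Y_grp T) (- 1) (rayT s l)"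
        using ray_inv[OF Y.is_group, of l s] tensor_scale_ray[of l "Y_grp T" "- 1" s] l by simp
    qed (use T eq ray_in_nonzero_Q[OF s(2,1)] l l1 il il1 in auto)
    ultimately show False using no by blast
  qed
  then show ?thesis using ray_in_C_imp_M[OF s(1) l C] by blast
qed

text \<open>The image point again lies in the apartment and is represented along some
  \<open>l0\<close>. Equality of the points yields \<open>h\<close> and \<open>h0\<close>,
  preserving the respective filtrations, such that \<open>g ** h\<close> and \<open>h0\<close> carry
  \<open>T\<close> with the two normalised vectors to the same pair. Then \<open>k\<close>, the
  product of the inverse of \<open>h0\<close> with \<open>g ** h\<close>, normalises
  \<open>T\<close>. The conjugate \<open>l'\<close> of \<open>l\<close> by \<open>k\<close> is a
  cocharacter on the ray of \<open>l0\<close>, and it replaces \<open>l0\<close>, whose length is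
  arbitrary.\<close>

lemma stabilizer_action:
  assumes g: "g \<in> setwise_stabilizer G \<Sigma>" and lM: "l \<in> M" and l1: "l \<noteq> \<one>\<^bsub>Y_grp T\<^esub>"
  shows "\<exists>l'\<in>M. (\<forall>r. filt l' r = (*v) g ` filt l r) \<and>
    V_act g (zeta_T G N T (rayT 1 l)) = zeta_T G N T (rayT 1 l')"
proof -
  have gG: "g \<in> G" using g by (simp add: setwise_stabilizer_def)
  have l: "l \<in> cochars T" and lC: "rayT 1 l \<in> C" using lM by (auto simp: M_def)
  have "V_act g (zeta_T G N T (rayT 1 l)) \<in> \<Sigma>"
    using zeta_T_in_Sigma[OF lC _ l l1] g by (auto simp: setwise_stabilizer_def)
  then obtain s0 l0 where s0: "s0 > 0" and l0: "l0 \<in> cochars T" "l0 \<noteq> \<one>\<^bsub>Y_grp T\<^esub>" "rayT s0 l0 \<in> C"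
    and act: "V_act g (zeta_T G N T (rayT 1 l)) = zeta_T G N T (rayT s0 l0)"
    using Sigma_ray by metis
  obtain \<Phi> where \<Phi>: "\<And>\<phi>. \<phi> \<in> \<Phi> \<Longrightarrow> additive_on (Y_grp T) \<phi>"
    and C: "\<And>s l. s > 0 \<Longrightarrow> l \<in> cochars T \<Longrightarrow> rayT s l \<in> tensor_Q (Y_grp T) \<Longrightarrow> rayT s l \<in> C \<longleftrightarrow> (\<forall>\<phi>\<in>\<Phi>. \<phi> l \<ge> 0)"
    using M_functionals by metis
  let ?s = "1 / N l" and ?t = "1 / N l0"
  have pos: "?s > 0" "?t > 0" using N_pos[OF T] l l1 l0 by simp_all
  have act': "V_act g (V_proj G (Y_point G T (rayT ?s l))) = V_proj G (Y_point G T (rayT ?t l0))"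
    using act zeta_T_ray[OF T l _ l1, of 1] zeta_T_ray[OF T l0(1) s0 l0(2)] by simp
  \<comment> \<open>A concrete member of the common class is traced back on both sides.\<close>
  obtain z where z: "z \<in> V_proj G (Y_point G T (rayT ?t l0))" and "z \<noteq> {}"
    using V_proj_nonempty[OF T l0(1), of ?t] by blast
  from z have "z \<in> V_act g (V_proj G (Y_point G T (rayT ?s l)))" by (simp only: act')
  then obtain z1 where z1: "z1 \<in> V_proj G (Y_point G T (rayT ?s l))" "z = Y_act g z1"
    unfolding V_act_def by blast
  then have "z1 \<noteq> {}" using \<open>z \<noteq> {}\<close> by (auto simp: Y_act_def)
  then obtain T1 \<nu>1 where e1: "(T1, \<nu>1) \<in> z1" by (metis ex_in_conv surj_pair)
  have e: "(mconj g ` T1, rcochar_conj g \<nu>1) \<in> z"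
    unfolding z1(2) Y_act_def using e1 by force
  from V_proj_filt[OF T l pos(1) z1(1) e1] obtain h
    where h: "h \<in> G" "T1 = mconj h ` T" "\<nu>1 = rcochar_conj h (rayT ?s l)"
    and h': "\<forall>s m r. s > 0 \<longrightarrow> m \<in> cochars T \<longrightarrow> rayT ?s l = rayT s m \<longrightarrow> (*v) h ` filt m r = filt m r"
    by (elim bexE conjE)
  have h_filt: "(*v) h ` filt l r = filt l r" for r
    by (rule h'[rule_format, OF pos(1) l refl])
  from V_proj_filt[OF T l0(1) pos(2) z e] obtain h0
    where h0: "h0 \<in> G" "mconj g ` T1 = mconj h0 ` T" "rcochar_conj g \<nu>1 = rcochar_conj h0 (rayT ?t l0)"
    and h0': "\<forall>s m r. s > 0 \<longrightarrow> m \<in> cochars T \<longrightarrow> rayT ?t l0 = rayT s m \<longrightarrow> (*v) h0 ` filt m r = filt m r"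
    by (elim bexE conjE)
  note inv = invertible_G[OF gG] invertible_G[OF h(1)] invertible_G[OF h0(1)]
  define k where "k = matrix_inv h0 ** (g ** h)"
  have invk: "invertible k"
    by (simp add: k_def invertible_mult invertible_matrix_inv inv)
  have "matrix_inv h0 \<in> G"
    using subgroup.m_inv_closed[OF subgroup_G h0(1)] by (simp add: inv_GL inv)
  then have kG: "k \<in> G"
    using subgroup.m_closed[OF subgroup_G] gG h(1) by (simp add: k_def)
  have kT: "mconj k ` T = T"
  proof -
    have "mconj k ` T = mconj (matrix_inv h0) ` mconj g ` mconj h ` T"
      by (simp add: k_def image_image mconj_mconj invertible_mult invertible_matrix_inv inv)
    then show ?thesis by (simp add: h0(2)[unfolded h(2)] mconj_image_inverse inv)
  qed
  define l' where "l' = cochar_conj k l"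
  have l': "l' \<in> cochars T"
    using cochar_conj_in_cochars[OF l invk] by (simp add: kT l'_def)
  have Nl': "N l' = N l" unfolding l'_def by (rule N_conj[OF T l kG])
  have ray: "rayT ?t l0 = rayT ?s l'"
  proof -
    have "rcochar_conj (matrix_inv h0) (rcochar_conj g (rcochar_conj h (rayT ?s l)))
      = rcochar_conj (matrix_inv h0) (rcochar_conj h0 (rayT ?t l0))"
      using h0(3) by (simp add: h(3))
    then have "rcochar_conj k (rayT ?s l) = rayT ?t l0"
      by (simp add: k_def rcochar_conj_eq image_image push_push invertible_mult invertible_matrix_inv inv matrix_inv_left)
    then show ?thesis by (simp add: rcochar_conj_ray invk kT l'_def)
  qed
  \<comment> \<open>\<open>l0\<close> and \<open>l'\<close> span the same ray, so every functional
    takes values of the same sign on them.\<close>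
  have l'M: "l' \<in> M"
  proof -
    have "\<phi> l' \<ge> 0" if \<phi>: "\<phi> \<in> \<Phi>" for \<phi>
    proof -
      have "\<phi> l0 \<ge> 0" using C[OF s0 l0(1)] l0(3) \<phi> by (auto simp: cone_T_def)
      moreover have "?t * \<phi> l0 = ?s * \<phi> l'"
        using ray_eqD[OF \<Phi>[OF \<phi>] ray] l0(1) by simp
      ultimately have "0 \<le> ?s * \<phi> l'" using pos(2) by (metis less_imp_le mult_nonneg_nonneg)
      then show ?thesis using pos(1) by (simp only: zero_le_mult_iff) auto
    qed
    then show ?thesis
      using C[of 1 l'] l' ray_in_tensor_Q[of l' "Y_grp T" 1] by (simp add: M_def)
  qed
  have l'1: "l' \<noteq> \<one>\<^bsub>Y_grp T\<^esub>"
  proof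
    assume "l' = \<one>\<^bsub>Y_grp T\<^esub>"
    then have "w l0 $ i = 0" for i
      using ray_eq_w[OF ray l0(1), of i] pos(2) w_one by simp
    then have "w l0 = w \<one>\<^bsub>Y_grp T\<^esub>" by (simp add: vec_eq_iff w_one)
    then show False using w_inj[OF l0(1) one_in_T] l0(2) by simp
  qed
  \<comment> \<open>\<open>h0\<close> was obtained for the vector of \<open>l0\<close>, but it
    preserves the filtration of \<open>l'\<close> too, because \<open>V_proj_filt\<close> covers
    every cocharacter that represents the same ray.\<close>
  have "filt l' r = (*v) g ` filt l r" for r
  proof -
    have "(*v) g ` filt l r = (*v) g ` (*v) h ` filt l r" by (simp add: h_filt)
    also have "\<dots> = (*v) h0 ` (*v) k ` filt l r"
      by (simp add: image_image k_def matrix_vector_mul_assoc matrix_mul_assoc matrix_inv_right inv)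
    also have "(*v) k ` filt l r = filt l' r" by (simp add: l'_def filt_conj invk)
    also have "(*v) h0 ` filt l' r = filt l' r" by (rule h0'[rule_format, OF pos(1) l' ray])
    finally show ?thesis by simp
  qed
  moreover have "V_act g (zeta_T G N T (rayT 1 l)) = zeta_T G N T (rayT 1 l')"
    using act zeta_T_ray[OF T l' _ l'1, of 1] zeta_T_ray[OF T l0(1) s0 l0(2)] ray by (simp add: Nl')
  ultimately show ?thesis using l'M by blast
qed

text \<open>The cocharacter \<open>c\<close> is found among the weight vectors before any
  \<open>g\<close> is considered; each \<open>g\<close> then induces a self-map \<open>f\<close> of
  the weight vectors of \<open>M\<close> to which the fixed vector property applies.\<close>

lemma centre_exists:
  assumes "\<not> completely_reducible G N \<Sigma>"
  shows "\<exists>c. G_centre G \<Sigma> c"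
proof -
  obtain l0 where l0: "l0 \<in> M" "inv\<^bsub>Y_grp T\<^esub> l0 \<notin> M" using inv_notin_M[OF assms] by blast
  have MT: "M \<subseteq> cochars T" by (auto simp: M_def)
  have inj: "inj_on w M" using w_inj MT by (intro inj_onI) blast
  have "\<exists>x\<in>w ` M. x \<noteq> 0 \<and> (\<forall>f. f ` w ` M \<subseteq> w ` M \<longrightarrow>
      (\<forall>x\<in>w ` M. \<forall>y\<in>w ` M. vdot (f x) (f y) = vdot x y) \<longrightarrow> f x = x)"
  proof (rule isometry_fixed_vector)
    show "0 \<in> w ` M" using one_in_M w_one by (metis imageI)
    show "x + y \<in> w ` M" if xy: "x \<in> w ` M" "y \<in> w ` M" for x y
    proof -
      obtain l m where lm: "l \<in> M" "x = w l" "m \<in> M" "y = w m" using xy by blast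
      then have "x + y = w (cochar_mult l m)" using w_mult[of l m] subsetD[OF MT] by simp
      then show ?thesis using mult_in_M[OF lm(1,3)] by blast
    qed
    show "w l0 \<in> w ` M" using l0 by blast
    show "- w l0 \<notin> w ` M"
    proof
      assume "- w l0 \<in> w ` M"
      then obtain m where m: "m \<in> M" "w m = - w l0" by force
      have "l0 \<in> cochars T" "m \<in> cochars T" using l0(1) m(1) MT by auto
      moreover from this have "inv\<^bsub>Y_grp T\<^esub> l0 \<in> cochars T" using Y.inv_closed[of l0] by simp
      ultimately have "m = inv\<^bsub>Y_grp T\<^esub> l0" using w_inj w_inv m(2) by metis
      then show False using m(1) l0(2) by simp
    qed
  qed
  then obtain x where "x \<in> w ` M" "x \<noteq> 0" and fx: "\<forall>f. f ` w ` M \<subseteq> w ` M \<longrightarrow>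
      (\<forall>x\<in>w ` M. \<forall>y\<in>w ` M. vdot (f x) (f y) = vdot x y) \<longrightarrow> f x = x"
    by (elim bexE conjE)
  then obtain c where x: "x = w c" and c: "c \<in> M" "w c \<noteq> 0" by blast
  note fixed = fx[unfolded x, THEN spec, THEN mp, THEN mp]
  have c1: "c \<noteq> \<one>\<^bsub>Y_grp T\<^esub>" using c(2) w_one by auto
  have "zeta_T G N T (rayT 1 c) \<in> \<Sigma>"
    using zeta_T_in_Sigma[of 1 c] c(1) c1 by (simp add: M_def)
  moreover have "V_act g (zeta_T G N T (rayT 1 c)) = zeta_T G N T (rayT 1 c)" if g: "g \<in> setwise_stabilizer G \<Sigma>" for g
  proof -
    obtain F where F: "\<And>l. l \<in> M \<Longrightarrow> l \<noteq> \<one>\<^bsub>Y_grp T\<^esub> \<Longrightarrow> F l \<in> M \<and> (\<forall>r. filt (F l) r = (*v) g ` filt l r) \<and>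
      V_act g (zeta_T G N T (rayT 1 l)) = zeta_T G N T (rayT 1 (F l))"
      using stabilizer_action[OF g] by metis
    have gi: "invertible g" using g invertible_G by (simp add: setwise_stabilizer_def)
    \<comment> \<open>The trivial cocharacter defines no point of the building, so the value at the
      zero vector is prescribed; products with it stay zero.\<close>
    define f where "f = (\<lambda>x. if x = 0 then 0 else w (F (inv_into M w x)))"
    have f: "f (w l) = w (F l)" if "l \<in> M" "l \<noteq> \<one>\<^bsub>Y_grp T\<^esub>" for l
    proof -
      have "w l \<noteq> 0" using that w_inj[of l "\<one>\<^bsub>Y_grp T\<^esub>"] one_in_T w_one MT by auto
      then show ?thesis using inj that(1) by (simp add: f_def)
    qed
    have f0: "f 0 = 0" by (simp add: f_def)
    have "f (w c) = w c"
    proof (rule fixed)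
      show "f ` w ` M \<subseteq> w ` M"
      proof safe
        fix l assume l: "l \<in> M"
        show "f (w l) \<in> w ` M"
        proof (cases "l = \<one>\<^bsub>Y_grp T\<^esub>")
          case True
          then show ?thesis using l f0 w_one by (metis imageI)
        next
          case False
          then show ?thesis using f[OF l] F[OF l] by simp
        qed
      qed
    next
      show "\<forall>x\<in>w ` M. \<forall>y\<in>w ` M. vdot (f x) (f y) = vdot x y"
      proof (intro ballI)
        fix x y assume "x \<in> w ` M" "y \<in> w ` M"
        then obtain l m where l: "l \<in> M" "x = w l" and m: "m \<in> M" "y = w m" by blast
        show "vdot (f x) (f y) = vdot x y"
        proof (cases "l = \<one>\<^bsub>Y_grp T\<^esub> \<or> m = \<one>\<^bsub>Y_grp T\<^esub>")
          case True
          then show ?thesis using l m f0 w_one by (auto simp: vdot_simps)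
        next
          case False
          then have Fl: "F l \<in> M" "\<And>r. filt (F l) r = (*v) g ` filt l r"
            and Fm: "F m \<in> M" "\<And>r. filt (F m) r = (*v) g ` filt m r"
            using F l m by auto
          have "vdot (w l) (w m) = vdot (w (F l)) (w (F m))"
            by (rule vdot_filt_eq[OF P gi w w w w Fl(2) Fm(2)]) (use l m Fl Fm MT in auto)
          then show ?thesis using False f l m by simp
        qed
      qed
    qed
    then have "w (F c) = w c" using f c(1) c1 by simp
    \<comment> \<open>Weight vectors determine cocharacters, so a fixed weight vector gives a fixed
      point of the building.\<close>
    then have "F c = c" using w_inj F[OF c(1) c1] c(1) MT by blast
    then show ?thesis using F[OF c(1) c1] by simp
  qed
  ultimately show ?thesis unfolding G_centre_def by blast
qed

end

theorem theorem5p5: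
  fixes G :: "('k::alg_closed_field^'n::finite^'n) set"
    and N :: "('k, 'n) cochar \<Rightarrow> real"
    and \<Sigma> :: "('k, 'n) vpoint set"
  assumes "semisimple G"
    and "cochar_norm G N"
    and "convex_subset G N \<Sigma>"
    and "polyhedral G N \<Sigma>"
    and "finite_type G N \<Sigma>"
    and "\<exists>T. max_torus G T \<and> \<Sigma> \<subseteq> apartment G N T"
    and "\<not> completely_reducible G N \<Sigma>"
  shows "\<exists>c. G_centre G \<Sigma> c"
proof -
  obtain T where T: "max_torus G T" and apartment: "\<Sigma> \<subseteq> apartment G N T"
    using assms(6) by blast
  have abelian: "abelian_subgroup T"
    using T by (simp add: max_torus_def torus_abelian)
  obtain P w where P: "invertible P" and w: "\<And>l. l \<in> cochars T \<Longrightarrow> weights P l (w l)"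
    using cochars_diagonalisable[OF abelian_subgroupD(1,2)[OF abelian]] by metis
  interpret cone_in_apartment G N T \<Sigma> P w
  proof (intro cone_in_apartment.intro normed_group.intro cone_in_apartment_axioms.intro)
    show "subgroup G GL" using assms(1) by (simp add: semisimple_def closed_subgroup_def)
    show "polyhedral_cone T (cone_T G N \<Sigma> T)" using assms(4) T by (simp add: polyhedral_def)
  qed (fact assms(2) T apartment P w)+
  show ?thesis by (rule centre_exists) fact
qed

end
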